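(* Both the extended Parikh coverability problem and the extended termination problem for QDAS extended by fork/join are undecidable.
   Context: A QDAS extended by fork/join (eQDAS) consists of: a finite data domain $\mathbb D$ with initial value $d_0$; a finite set $\mathcal X$ of variables over $\mathbb D$; a finite set $CQID$ of concurrent queues (there are no serial queues); a finite set $\Gamma$ of blocks with a distinguished initial block $main$; and for each block $\gamma$ a finite labelled transition system with pairwise disjoint state sets $S_\gamma$, initial state $s^0_\gamma$, final state $f_\gamma$, and transitions $\Delta_\gamma\subseteq S_\gamma\times\Sigma\times S_\gamma$; let $S=\bigcup_\gamma S_\gamma$. The actions $\Sigma$ are: asynchronous dispatches $\mathrm{dispatch_a}(q,\gamma)$ and fork/join actions $\mathrm{forkjoin}(q,\gamma,p)$ with $q\in CQID$, $\gamma\in\Gamma\setminus\{main\}$, $p\in\mathbb N\cup\{\ast\}$; guards (finite conjunctions of atoms $x=d$, $x\ne d$); and assignments $x\gets d$. A configuration is a pair $(G,\mathbf d)$ of a valuation $\mathbf d$ and a call-task graph $G$: a finite set of vertices, each either a call vertex (a dispatched block waiting in a queue, FIFO-ordered per queue) or a task vertex (a running block instance), each labelled with a block $\lambda(v)$ and a state $state(v)\in S_{\lambda(v)}$ (call vertices carry the block's initial state), together with wait edges ($v\to w$ means $v$ is blocked until $w$ is removed). A task vertex is unblocked if it has no outgoing wait edge. Initially there is a single task vertex for $main$ in $s^0_{main}$ and all variables equal $d_0$. Steps: an unblocked task vertex $v$ in state $s$ with $(s,a,s')\in\Delta_{\lambda(v)}$ moves to $s'$, where a guard must hold in $\mathbf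 d$, an assignment updates $\mathbf d$, $\mathrm{dispatch_a}(q,\gamma)$ appends a new call vertex for $\gamma$ to the end of $q$, and $\mathrm{forkjoin}(q,\gamma,p)$ appends $n$ new call vertices for $\gamma$ to the end of $q$, where $n=p$ if $p\in\mathbb N$ and $n\in\mathbb N$ is chosen nondeterministically if $p=\ast$, adding a wait edge from $v$ to each new vertex. Scheduler steps: remove an unblocked task vertex $v$ in state $f_{\lambda(v)}$ (with the wait edges into it), or turn the first call vertex of some queue into a task vertex. The Parikh image $\mathrm{Parikh}(G):S\to\mathbb N$ counts, for each $s$, the vertices $v$ with $state(v)=s$. Extended Parikh coverability problem: given an eQDAS and $f:S\to\mathbb N$, decide whether some reachable configuration $(G,\mathbf d)$ satisfies $f(s)\le \mathrm{Parikh}(G)(s)$ for all $s$. Extended termination problem: given an eQDAS, decide whether it has no infinite run. *)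

theory Defs
  imports Main "HOL-Library.FuncSet" "HOL-Library.Disjoint_Sets" "HOL-Library.Nat_Bijection"
begin

section \<open>Partial recursive functions and decidability\<close>

datatype recf =
    Zero
  | Succ
  | Proj nat
  | Comp recf "recf list"
  | PrimRec recf recf
  | Mu recf

text \<open>
  \<open>rec_eval r xs y\<close>: the partial recursive function denoted by \<open>r\<close> is defined at the argument
  tuple \<open>xs\<close> and has value \<open>y\<close> there. In \<open>PrimRec f g\<close> the recursion argument comes first, and the
  step function \<open>g\<close> receives the predecessor, the previous value and the parameters.
\<close>

inductive rec_eval :: "recf \<Rightarrow> nat list \<Rightarrow> nat \<Rightarrow> bool" where
  Zero: "rec_eval Zero xs 0"
| Succ: "rec_eval Succ [x] (Suc x)"
| Proj: "i < length xs \<Longrightarrow> rec_eval (Proj i) xs (xs ! i)"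
| Comp: "list_all2 (\<lambda>g y. rec_eval g xs y) gs ys \<Longrightarrow> rec_eval f ys z
          \<Longrightarrow> rec_eval (Comp f gs) xs z"
| PrimRec_0: "rec_eval f xs y \<Longrightarrow> rec_eval (PrimRec f g) (0 # xs) y"
| PrimRec_Suc: "rec_eval (PrimRec f g) (n # xs) y \<Longrightarrow> rec_eval g (n # y # xs) z
          \<Longrightarrow> rec_eval (PrimRec f g) (Suc n # xs) z"
| Mu: "rec_eval f (n # xs) 0 \<Longrightarrow> (\<And>m. m < n \<Longrightarrow> \<exists>y. rec_eval f (m # xs) (Suc y))
          \<Longrightarrow> rec_eval (Mu f) xs n"

inductive_cases rec_eval_ZeroE: "rec_eval Zero xs y"
inductive_cases rec_eval_SuccE: "rec_eval Succ xs y"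
inductive_cases rec_eval_ProjE: "rec_eval (Proj i) xs y"
inductive_cases rec_eval_CompE: "rec_eval (Comp f gs) xs y"
inductive_cases rec_eval_PrimRec_0E: "rec_eval (PrimRec f g) (0 # xs) y"
inductive_cases rec_eval_PrimRec_SucE: "rec_eval (PrimRec f g) (Suc n # xs) y"
inductive_cases rec_eval_MuE: "rec_eval (Mu f) xs y"

lemma rec_eval_deterministic: "rec_eval r xs y \<Longrightarrow> rec_eval r xs z \<Longrightarrow> y = z"
proof (induction arbitrary: z rule: rec_eval.induct)
  case (Zero xs)
  then show ?case by (blast elim: rec_eval_ZeroE)
next
  case (Succ x)
  then show ?case by (auto elim: rec_eval_SuccE)
next
  case (Proj i xs)
  then show ?case by (auto elim: rec_eval_ProjE)
next
  case (Comp xs gs ys f w)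
  from Comp.prems obtain ys' where ys':
      "list_all2 (\<lambda>g y. rec_eval g xs y) gs ys'" "rec_eval f ys' z"
    by (rule rec_eval_CompE)
  have "ys = ys'"
  proof (rule nth_equalityI)
    show "length ys = length ys'"
      using list_all2_lengthD[OF Comp.IH(1)] list_all2_lengthD[OF ys'(1)] by simp
    show "ys ! i = ys' ! i" if "i < length ys" for i
      using list_all2_nthD[OF Comp.IH(1), of i] list_all2_nthD[OF ys'(1), of i]
        list_all2_lengthD[OF Comp.IH(1)] that by simp
  qed
  then show ?case using Comp.IH(2) ys'(2) by blast
next
  case (PrimRec_0 f xs y g)
  from PrimRec_0.prems show ?case
    by (rule rec_eval_PrimRec_0E) (rule PrimRec_0.IH)
next
  case (PrimRec_Suc f g n xs y w)
  from PrimRec_Suc.prems obtain y' where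
      "rec_eval (PrimRec f g) (n # xs) y'" "rec_eval g (n # y' # xs) z"
    by (rule rec_eval_PrimRec_SucE)
  then show ?case using PrimRec_Suc.IH by blast
next
  case (Mu f n xs)
  from Mu.prems have z: "rec_eval f (z # xs) 0"
      "\<And>m. m < z \<Longrightarrow> \<exists>y. rec_eval f (m # xs) (Suc y)"
    by (blast elim: rec_eval_MuE)+
  show ?case
  proof (rule linorder_cases[of n z])
    assume "n < z"
    then obtain y where "rec_eval f (n # xs) (Suc y)" using z(2) by blast
    then have "0 = Suc y" by (rule Mu.IH(1))
    then show ?thesis by simp
  next
    assume "z < n"
    then obtain y where "\<forall>w. rec_eval f (z # xs) w \<longrightarrow> Suc y = w" using Mu.IH(2) by blast
    then have "Suc y = 0" using z(1) by blast
    then show ?thesis by simp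
  qed
qed

text \<open>
  A decision problem consists of a set of instances, a coding of the instances by natural numbers,
  and the property to be decided. The algorithm only has to halt, with the right answer, on codes of
  instances.
\<close>

definition decidable_problem :: "('i \<Rightarrow> nat) \<Rightarrow> 'i set \<Rightarrow> ('i \<Rightarrow> bool) \<Rightarrow> bool" where
  "decidable_problem code I P \<longleftrightarrow>
     (\<exists>r. \<forall>x\<in>I. rec_eval r [code x] (if P x then 1 else 0))"


section \<open>QDAS extended by fork/join\<close>

datatype ('d, 'x) atom = Eq 'x 'd | Neq 'x 'd

text \<open>
  A guard is the conjunction of a list of atoms. The multiplicity of a fork/join is \<open>Some n\<close> for a
  number \<open>n\<close> and \<open>None\<close> for the symbol \<open>*\<close>.
\<close>

datatype ('d, 'x, 'q, 'b) action =
    DispatchA 'q 'b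
  | ForkJoin 'q 'b "nat option"
  | Guard "('d, 'x) atom list"
  | Assign 'x 'd

record ('d, 'x, 'q, 'b, 's) lts =
  lts_states :: "'s set"
  lts_init :: 's
  lts_final :: 's
  lts_trans :: "('s \<times> ('d, 'x, 'q, 'b) action \<times> 's) set"

record ('d, 'x, 'q, 'b, 's) eqdas =
  domain :: "'d set"
  dinit :: 'd
  vars :: "'x set"
  cqid :: "'q set"
  blocks :: "'b set"
  main_block :: 'b
  block_lts :: "'b \<Rightarrow> ('d, 'x, 'q, 'b, 's) lts"

fun atom_vars_vals :: "('d, 'x) atom \<Rightarrow> 'x \<times> 'd" where
  "atom_vars_vals (Eq x d) = (x, d)"
| "atom_vars_vals (Neq x d) = (x, d)"

definition actions :: "('d, 'x, 'q, 'b, 's) eqdas \<Rightarrow> ('d, 'x, 'q, 'b) action set" where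
  "actions A =
     {DispatchA q b | q b. q \<in> cqid A \<and> b \<in> blocks A - {main_block A}}
   \<union> {ForkJoin q b p | q b p. q \<in> cqid A \<and> b \<in> blocks A - {main_block A}}
   \<union> {Guard as | as. atom_vars_vals ` set as \<subseteq> vars A \<times> domain A}
   \<union> {Assign x d | x d. x \<in> vars A \<and> d \<in> domain A}"

text \<open>
  The map from blocks to transition systems is taken to be extensional, so that an eQDAS carries
  no information about names that are not blocks.
\<close>

definition eqdas :: "('d, 'x, 'q, 'b, 's) eqdas \<Rightarrow> bool" where
  "eqdas A \<longleftrightarrow>
     finite (domain A) \<and> dinit A \<in> domain A \<and> finite (vars A) \<and> finite (cqid A) \<and>
     finite (blocks A) \<and> main_block A \<in> blocks A \<and>
     block_lts A \<in> extensional (blocks A) \<and>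
     disjoint_family_on (\<lambda>b. lts_states (block_lts A b)) (blocks A) \<and>
     (\<forall>b\<in>blocks A. let L = block_lts A b in
        finite (lts_states L) \<and> lts_init L \<in> lts_states L \<and> lts_final L \<in> lts_states L \<and>
        finite (lts_trans L) \<and> lts_trans L \<subseteq> lts_states L \<times> actions A \<times> lts_states L)"

definition all_states :: "('d, 'x, 'q, 'b, 's) eqdas \<Rightarrow> 's set" where
  "all_states A = (\<Union>b\<in>blocks A. lts_states (block_lts A b))"


subsection \<open>Call-task graphs and steps\<close>

text \<open>
  Vertices are named by natural numbers. The call vertices are those occurring in the queues
  (head of the list = first to be served). The values of \<open>vblock\<close> and \<open>vstate\<close> outside
  \<open>vertices G\<close> are irrelevant. \<open>(v, w) \<in> waits G\<close> means that \<open>v\<close> waits for \<open>w\<close>.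
\<close>

type_synonym vertex = nat

record ('q, 'b, 's) ctgraph =
  tasks :: "vertex set"
  queue :: "'q \<Rightarrow> vertex list"
  vblock :: "vertex \<Rightarrow> 'b"
  vstate :: "vertex \<Rightarrow> 's"
  waits :: "(vertex \<times> vertex) set"

type_synonym ('d, 'x, 'q, 'b, 's) config = "('q, 'b, 's) ctgraph \<times> ('x \<Rightarrow> 'd)"

definition calls :: "('q, 'b, 's) ctgraph \<Rightarrow> vertex set" where
  "calls G = (\<Union>q. set (queue G q))"

definition vertices :: "('q, 'b, 's) ctgraph \<Rightarrow> vertex set" where
  "vertices G = tasks G \<union> calls G"

definition unblocked :: "('q, 'b, 's) ctgraph \<Rightarrow> vertex \<Rightarrow> bool" where
  "unblocked G v \<longleftrightarrow> (\<forall>w. (v, w) \<notin> waits G)"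

definition initial_config ::
  "('d, 'x, 'q, 'b, 's) eqdas \<Rightarrow> ('d, 'x, 'q, 'b, 's) config" where
  "initial_config A =
     (\<lparr>tasks = {0}, queue = (\<lambda>_. []), vblock = (\<lambda>_. main_block A),
       vstate = (\<lambda>_. lts_init (block_lts A (main_block A))), waits = {}\<rparr>,
      \<lambda>x\<in>vars A. dinit A)"

fun holds :: "('x \<Rightarrow> 'd) \<Rightarrow> ('d, 'x) atom \<Rightarrow> bool" where
  "holds \<sigma> (Eq x d) \<longleftrightarrow> \<sigma> x = d"
| "holds \<sigma> (Neq x d) \<longleftrightarrow> \<sigma> x \<noteq> d"

definition set_state ::
  "vertex \<Rightarrow> 's \<Rightarrow> ('q, 'b, 's) ctgraph \<Rightarrow> ('q, 'b, 's) ctgraph" where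
  "set_state v s G = G\<lparr>vstate := (vstate G)(v := s)\<rparr>"

definition enqueue ::
  "('d, 'x, 'q, 'b, 's) eqdas \<Rightarrow> 'q \<Rightarrow> 'b \<Rightarrow> vertex list
     \<Rightarrow> ('q, 'b, 's) ctgraph \<Rightarrow> ('q, 'b, 's) ctgraph" where
  "enqueue A q b vs G = G\<lparr>
     queue := (queue G)(q := queue G q @ vs),
     vblock := (\<lambda>v. if v \<in> set vs then b else vblock G v),
     vstate := (\<lambda>v. if v \<in> set vs then lts_init (block_lts A b) else vstate G v)\<rparr>"

definition enabled ::
  "('d, 'x, 'q, 'b, 's) eqdas \<Rightarrow> ('q, 'b, 's) ctgraph \<Rightarrow> vertex
     \<Rightarrow> ('d, 'x, 'q, 'b) action \<Rightarrow> 's \<Rightarrow> bool" where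
  "enabled A G v a s' \<longleftrightarrow> v \<in> tasks G \<and> unblocked G v \<and>
     (vstate G v, a, s') \<in> lts_trans (block_lts A (vblock G v))"

inductive step ::
  "('d, 'x, 'q, 'b, 's) eqdas \<Rightarrow> ('d, 'x, 'q, 'b, 's) config
     \<Rightarrow> ('d, 'x, 'q, 'b, 's) config \<Rightarrow> bool"
  for A where
  guard: "enabled A G v (Guard as) s' \<Longrightarrow> \<forall>a\<in>set as. holds \<sigma> a
     \<Longrightarrow> step A (G, \<sigma>) (set_state v s' G, \<sigma>)"
| assign: "enabled A G v (Assign x d) s'
     \<Longrightarrow> step A (G, \<sigma>) (set_state v s' G, \<sigma>(x := d))"
| dispatch: "enabled A G v (DispatchA q b) s' \<Longrightarrow> w \<notin> vertices G
     \<Longrightarrow> step A (G, \<sigma>) (enqueue A q b [w] (set_state v s' G), \<sigma>)"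
| forkjoin: "enabled A G v (ForkJoin q b p) s' \<Longrightarrow> p = None \<or> p = Some (length ws)
     \<Longrightarrow> distinct ws \<Longrightarrow> set ws \<inter> vertices G = {}
     \<Longrightarrow> H = enqueue A q b ws (set_state v s' G)
     \<Longrightarrow> step A (G, \<sigma>) (H\<lparr>waits := waits H \<union> {v} \<times> set ws\<rparr>, \<sigma>)"
| finish: "v \<in> tasks G \<Longrightarrow> unblocked G v \<Longrightarrow> vstate G v = lts_final (block_lts A (vblock G v))
     \<Longrightarrow> step A (G, \<sigma>) (G\<lparr>tasks := tasks G - {v}, waits := waits G - UNIV \<times> {v}\<rparr>, \<sigma>)"
| serve: "q \<in> cqid A \<Longrightarrow> queue G q = v # vs
     \<Longrightarrow> step A (G, \<sigma>) (G\<lparr>tasks := insert v (tasks G), queue := (queue G)(q := vs)\<rparr>, \<sigma>)"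

definition reachable ::
  "('d, 'x, 'q, 'b, 's) eqdas \<Rightarrow> ('d, 'x, 'q, 'b, 's) config \<Rightarrow> bool" where
  "reachable A c \<longleftrightarrow> (step A)\<^sup>*\<^sup>* (initial_config A) c"

definition parikh :: "('q, 'b, 's) ctgraph \<Rightarrow> 's \<Rightarrow> nat" where
  "parikh G s = card {v \<in> vertices G. vstate G v = s}"

lemma step_finite_vertices:
  "step A c c' \<Longrightarrow> finite (vertices (fst c)) \<Longrightarrow> finite (vertices (fst c'))"
proof (induction rule: step.induct)
  case (dispatch G v q b s' w \<sigma>)
  have "vertices (enqueue A q b [w] (set_state v s' G)) \<subseteq> insert w (vertices G)"
    by (auto simp: vertices_def calls_def enqueue_def set_state_def split: if_splits)
  with dispatch.prems show ?case by (auto intro: finite_subset)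
next
  case (forkjoin G v q b p s' ws H \<sigma>)
  have "vertices (H\<lparr>waits := waits H \<union> {v} \<times> set ws\<rparr>) \<subseteq> set ws \<union> vertices G"
    unfolding forkjoin.hyps(5)
    by (auto simp: vertices_def calls_def enqueue_def set_state_def split: if_splits)
  with forkjoin.prems show ?case by (auto intro: finite_subset)
next
  case (serve q G v vs \<sigma>)
  have "vertices (G\<lparr>tasks := insert v (tasks G), queue := (queue G)(q := vs)\<rparr>) \<subseteq> vertices G"
    using serve(2) by (auto simp: vertices_def calls_def split: if_splits)
      (metis list.set_intros)+
  with serve.prems show ?case by (auto intro: finite_subset)
qed (auto simp: vertices_def calls_def set_state_def)

lemma reachable_finite_vertices: "reachable A c \<Longrightarrow> finite (vertices (fst c))"
  unfolding reachable_def
proof (induction rule: rtranclp_induct)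
  case base
  show ?case by (simp add: initial_config_def vertices_def calls_def)
next
  case (step c c')
  then show ?case by (blast intro: step_finite_vertices)
qed


section \<open>The two decision problems\<close>

definition parikh_coverable :: "('d, 'x, 'q, 'b, 's) eqdas \<Rightarrow> ('s \<Rightarrow> nat) \<Rightarrow> bool" where
  "parikh_coverable A f \<longleftrightarrow>
     (\<exists>G \<sigma>. reachable A (G, \<sigma>) \<and> (\<forall>s\<in>all_states A. f s \<le> parikh G s))"

definition infinite_run ::
  "('d, 'x, 'q, 'b, 's) eqdas \<Rightarrow> (nat \<Rightarrow> ('d, 'x, 'q, 'b, 's) config) \<Rightarrow> bool" where
  "infinite_run A c \<longleftrightarrow> c 0 = initial_config A \<and> (\<forall>i. step A (c i) (c (Suc i)))"

definition terminating :: "('d, 'x, 'q, 'b, 's) eqdas \<Rightarrow> bool" where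
  "terminating A \<longleftrightarrow> (\<nexists>c. infinite_run A c)"

text \<open>
  As inputs of an algorithm, the finite sets making up an eQDAS are sets of natural numbers; every
  eQDAS is of this form up to renaming. Finite sets are coded by \<open>set_encode\<close>, tuples by
  \<open>prod_encode\<close> and \<open>list_encode\<close>, and functions with finite domain by their graphs.
\<close>

type_synonym nat_lts = "(nat, nat, nat, nat, nat) lts"
type_synonym nat_eqdas = "(nat, nat, nat, nat, nat) eqdas"

fun atom_code :: "(nat, nat) atom \<Rightarrow> nat" where
  "atom_code (Eq x d) = prod_encode (0, prod_encode (x, d))"
| "atom_code (Neq x d) = prod_encode (1, prod_encode (x, d))"

fun mult_code :: "nat option \<Rightarrow> nat" where
  "mult_code None = 0"
| "mult_code (Some n) = Suc n"

fun action_code :: "(nat, nat, nat, nat) action \<Rightarrow> nat" where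
  "action_code (DispatchA q b) = prod_encode (0, prod_encode (q, b))"
| "action_code (ForkJoin q b p) = prod_encode (1, prod_encode (q, prod_encode (b, mult_code p)))"
| "action_code (Guard as) = prod_encode (2, list_encode (map atom_code as))"
| "action_code (Assign x d) = prod_encode (3, prod_encode (x, d))"

definition trans_code :: "nat \<times> (nat, nat, nat, nat) action \<times> nat \<Rightarrow> nat" where
  "trans_code = (\<lambda>(s, a, s'). prod_encode (s, prod_encode (action_code a, s')))"

definition lts_code :: "nat_lts \<Rightarrow> nat" where
  "lts_code L = list_encode
     [set_encode (lts_states L), lts_init L, lts_final L, set_encode (trans_code ` lts_trans L)]"

definition graph_code :: "nat set \<Rightarrow> (nat \<Rightarrow> nat) \<Rightarrow> nat" where
  "graph_code A f = set_encode ((\<lambda>x. prod_encode (x, f x)) ` A)"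

definition eqdas_code :: "nat_eqdas \<Rightarrow> nat" where
  "eqdas_code A = list_encode
     [set_encode (domain A), dinit A, set_encode (vars A), set_encode (cqid A),
      set_encode (blocks A), main_block A, graph_code (blocks A) (\<lambda>b. lts_code (block_lts A b))]"

definition coverability_instances :: "(nat_eqdas \<times> (nat \<Rightarrow> nat)) set" where
  "coverability_instances = {(A, f). eqdas A \<and> f \<in> all_states A \<rightarrow>\<^sub>E UNIV}"

definition coverability_code :: "nat_eqdas \<times> (nat \<Rightarrow> nat) \<Rightarrow> nat" where
  "coverability_code = (\<lambda>(A, f). prod_encode (eqdas_code A, graph_code (all_states A) f))"


subsection \<open>The codings are injective\<close>

lemma inj_atom_code: "inj atom_code"
proof (rule injI)
  fix a b assume "atom_code a = atom_code b"
  then show "a = b" by (cases a; cases b) auto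
qed

lemma mult_code_inject [simp]: "mult_code p = mult_code p' \<longleftrightarrow> p = p'"
  by (cases p; cases p') auto

lemma inj_action_code: "inj action_code"
proof (rule injI)
  fix a b assume "action_code a = action_code b"
  then show "a = b"
    by (cases a; cases b) (auto simp: list_encode_eq inj_map_eq_map[OF inj_atom_code])
qed

lemma inj_trans_code: "inj trans_code"
  by (auto simp: inj_def trans_code_def inj_eq[OF inj_action_code])

lemma lts_code_inject:
  assumes "finite (lts_states L)" "finite (lts_trans L)"
    and "finite (lts_states L')" "finite (lts_trans L')"
    and "lts_code L = lts_code L'"
  shows "L = L'"
proof -
  have "lts_states L = lts_states L'" "lts_init L = lts_init L'" "lts_final L = lts_final L'"
      "trans_code ` lts_trans L = trans_code ` lts_trans L'"
    using assms by (simp_all add: lts_code_def list_encode_eq set_encode_eq del: list_encode.simps)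
  then show ?thesis by (intro lts.equality) (simp_all add: inj_image_eq_iff[OF inj_trans_code])
qed

lemma graph_code_inject:
  assumes "finite A" "graph_code A f = graph_code A g" "x \<in> A"
  shows "f x = g x"
proof -
  have "(\<lambda>x. prod_encode (x, f x)) ` A = (\<lambda>x. prod_encode (x, g x)) ` A"
    using assms(1,2) by (simp add: graph_code_def set_encode_eq)
  with assms(3) have "prod_encode (x, f x) \<in> (\<lambda>x. prod_encode (x, g x)) ` A" by blast
  then show ?thesis by auto
qed

lemma inj_on_eqdas_code: "inj_on eqdas_code {A. eqdas A}"
proof (rule inj_onI, clarsimp)
  fix A B assume A: "eqdas A" and B: "eqdas B" and eq: "eqdas_code A = eqdas_code B"
  have fin: "finite (domain A)" "finite (vars A)" "finite (cqid A)" "finite (blocks A)"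
      "finite (domain B)" "finite (vars B)" "finite (cqid B)" "finite (blocks B)"
    using A B by (auto simp: eqdas_def)
  have codes: "set_encode (domain A) = set_encode (domain B)" "dinit A = dinit B"
      "set_encode (vars A) = set_encode (vars B)" "set_encode (cqid A) = set_encode (cqid B)"
      "set_encode (blocks A) = set_encode (blocks B)" "main_block A = main_block B"
      "graph_code (blocks A) (\<lambda>b. lts_code (block_lts A b)) =
       graph_code (blocks B) (\<lambda>b. lts_code (block_lts B b))"
    using eq unfolding eqdas_code_def list_encode_eq list.inject by blast+
  have same: "domain A = domain B" "vars A = vars B" "cqid A = cqid B" "blocks A = blocks B"
    using codes fin by (simp_all add: set_encode_eq)
  have "block_lts A = block_lts B"
  proof (rule extensionalityI)
    show "block_lts A \<in> extensional (blocks A)" "block_lts B \<in> extensional (blocks A)"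
      using A B same by (auto simp: eqdas_def)
    fix b assume b: "b \<in> blocks A"
    have "lts_code (block_lts A b) = lts_code (block_lts B b)"
      using graph_code_inject[OF _ _ b] fin(4) codes(7) unfolding same(4) by blast
    then show "block_lts A b = block_lts B b"
      using A B b same by (intro lts_code_inject) (auto simp: eqdas_def Let_def)
  qed
  with codes(2,6) same show "A = B" by (intro eqdas.equality) simp_all
qed

lemma inj_on_coverability_code: "inj_on coverability_code coverability_instances"
proof (rule inj_onI)
  fix p p' assume p: "p \<in> coverability_instances" and p': "p' \<in> coverability_instances"
    and eq: "coverability_code p = coverability_code p'"
  obtain A f B g where pp: "p = (A, f)" "p' = (B, g)" by fastforce
  have AB: "A = B" and gr: "graph_code (all_states A) f = graph_code (all_states A) g"
    using p p' eq inj_onD[OF inj_on_eqdas_code]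
    by (auto simp: pp coverability_code_def coverability_instances_def)
  have "finite (all_states A)"
    using p by (auto simp: pp coverability_instances_def all_states_def eqdas_def Let_def)
  then have "f = g"
    using p p' AB graph_code_inject[OF _ gr]
    by (intro PiE_ext[of f "all_states A" "\<lambda>_. UNIV" g])
      (auto simp: pp coverability_instances_def)
  with AB show "p = p'" by (simp add: pp)
qed

end

theory Submission
  imports Defs "HOL-Library.Countable"
begin

text \<open>
  A fork with a single child blocks its parent until the child has gone, so a vertex can be the
  base of a chain of \<open>m\<close> descendants of which only the last one is unblocked. Such a chain is a
  counter with value \<open>m\<close>: the last vertex increments it by forking and decrements it by terminating,
  and the base is unblocked iff the counter is zero. A controller task that talks to the chains
  through a shared variable thus simulates a counter machine, and it does so deterministically: in
  every reachable configuration at most one step is possible, up to the names of new vertices. The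
  halting state is coverable iff the machine halts, and the system terminates iff the machine halts.

  No universal machine is needed. If \<open>r\<close> were a decision procedure, let \<open>p\<close> be a machine that, on
  input \<open>x\<close>, applies \<open>r\<close> to the code of the system with the transitions coded by \<open>x\<close> and additional
  transitions that load \<open>x\<close> into the input register, and that halts iff the answer is negative. The
  code of this system is a recursive function of \<open>x\<close>, and if \<open>x\<close> codes the transitions of \<open>p\<close>, the
  answer is wrong.
\<close>

section \<open>Recursive functions\<close>

text \<open>The diagonal argument needs the code of the whole system as an explicit recursive
  function of the code \<open>x\<close> of the program transitions. Finite sets are coded by sums of
  powers of two, so the codes of disjoint sets add up: the program contributes the number
  \<open>x\<close> itself, however its commands are coded, and only the loading transitions, whose
  codes are elementary in their index, must be computed. For the same reason states and data values
  fill intervals with an end that depends on \<open>x\<close> alone, instead of being just those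
  that occur.

  The main block can be neither dispatched nor forked, so one further block plays controller, base
  and links; a newborn task learns its role from the shared variable.

  Vertex names are arbitrary, so determinism is stated for chains regarded as stacks of local states
  and transferred by a bisimulation. One forced run then answers both problems: it gets stuck with
  the halting state covered, or closes into a cycle that never covers it.\<close>

definition recursive :: "nat \<Rightarrow> (nat list \<Rightarrow> nat) \<Rightarrow> bool" where
  "recursive n f \<longleftrightarrow> (\<exists>r. \<forall>xs. length xs = n \<longrightarrow> rec_eval r xs (f xs))"

lemma recursiveI: "(\<And>xs. length xs = n \<Longrightarrow> rec_eval r xs (f xs)) \<Longrightarrow> recursive n f"
  unfolding recursive_def by blast

lemma recursive_nth: "i < n \<Longrightarrow> recursive n (\<lambda>xs. xs ! i)"
  by (rule recursiveI[of _ "Proj i"]) (simp add: rec_eval.Proj)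

lemma recursive_hd: "recursive (Suc n) hd"
proof (rule recursiveI)
  fix xs :: "nat list" assume "length xs = Suc n"
  then show "rec_eval (Proj 0) xs (hd xs)"
    using rec_eval.Proj[of 0 xs] by (cases xs) auto
qed

lemma recursive_comp:
  assumes "recursive (length gs) f" "\<And>g. g \<in> set gs \<Longrightarrow> recursive n g"
  shows "recursive n (\<lambda>xs. f (map (\<lambda>g. g xs) gs))"
proof -
  obtain r where r: "\<And>xs. length xs = length gs \<Longrightarrow> rec_eval r xs (f xs)"
    using assms(1) unfolding recursive_def by blast
  obtain R where R: "\<And>g xs. g \<in> set gs \<Longrightarrow> length xs = n \<Longrightarrow> rec_eval (R g) xs (g xs)"
    using assms(2) unfolding recursive_def by metis
  show ?thesis
  proof (rule recursiveI)
    fix xs :: "nat list" assume "length xs = n"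
    then show "rec_eval (Comp r (map R gs)) xs (f (map (\<lambda>g. g xs) gs))"
      by (intro rec_eval.Comp[where ys = "map (\<lambda>g. g xs) gs"] r)
        (auto simp: list_all2_conv_all_nth R)
  qed
qed

lemma recursive_Suc:
  assumes "recursive n f" shows "recursive n (\<lambda>xs. Suc (f xs))"
proof -
  obtain r where "\<And>xs. length xs = n \<Longrightarrow> rec_eval r xs (f xs)"
    using assms unfolding recursive_def by blast
  then show ?thesis
    by (intro recursiveI[of _ "Comp Succ [r]"] rec_eval.Comp[OF _ rec_eval.Succ]) auto
qed

lemma recursive_const: "recursive n (\<lambda>_. c)"
proof (induction c)
  case 0
  show ?case by (rule recursiveI) (rule rec_eval.Zero)
qed (rule recursive_Suc)

lemma recursive_tl:
  assumes "recursive n f" shows "recursive (Suc n) (\<lambda>xs. f (tl xs))"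
proof -
  have "recursive (Suc n) (\<lambda>xs. f (map (\<lambda>g. g xs) (map (\<lambda>i xs. xs ! Suc i) [0..<n])))"
    using assms by (intro recursive_comp) (auto intro: recursive_nth)
  moreover have "map (\<lambda>g. g xs) (map (\<lambda>i xs. xs ! Suc i) [0..<n]) = tl xs"
    if "length xs = Suc n" for xs :: "nat list"
    using that by (intro nth_equalityI) (auto simp: nth_tl)
  ultimately show ?thesis unfolding recursive_def by auto
qed

text \<open>The recursion argument is itself a function of \<open>xs\<close>, so
  \<open>PrimRec\<close> is composed with \<open>k\<close> followed by all projections, which pass
  the parameters on.\<close>

lemma recursive_rec_nat:
  assumes "recursive n f" "recursive (Suc (Suc n)) g" "recursive n k"
  shows "recursive n (\<lambda>xs. rec_nat (f xs) (\<lambda>i y. g (i # y # xs)) (k xs))"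
proof -
  obtain rf where rf: "\<And>xs. length xs = n \<Longrightarrow> rec_eval rf xs (f xs)"
    using assms(1) unfolding recursive_def by blast
  obtain rg where rg: "\<And>xs. length xs = Suc (Suc n) \<Longrightarrow> rec_eval rg xs (g xs)"
    using assms(2) unfolding recursive_def by blast
  obtain rk where rk: "\<And>xs. length xs = n \<Longrightarrow> rec_eval rk xs (k xs)"
    using assms(3) unfolding recursive_def by blast
  have rec: "rec_eval (PrimRec rf rg) (m # xs) (rec_nat (f xs) (\<lambda>i y. g (i # y # xs)) m)"
    if "length xs = n" for m xs
  proof (induction m)
    case (Suc m)
    then show ?case using that rg by (auto intro: rec_eval.PrimRec_Suc)
  qed (use that rf in \<open>auto intro: rec_eval.PrimRec_0\<close>)
  show ?thesis
  proof (rule recursiveI)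
    fix xs :: "nat list" assume len: "length xs = n"
    have "list_all2 (\<lambda>g y. rec_eval g xs y) (rk # map Proj [0..<n]) (k xs # xs)"
      using len rk by (auto simp: list_all2_conv_all_nth nth_Cons split: nat.split intro: rec_eval.Proj)
    then show "rec_eval (Comp (PrimRec rf rg) (rk # map Proj [0..<n])) xs
        (rec_nat (f xs) (\<lambda>i y. g (i # y # xs)) (k xs))"
      using rec[OF len] by (rule rec_eval.Comp)
  qed
qed

section \<open>Arithmetic, bounded sums and pairing\<close>

lemma recursive_add:
  assumes "recursive n f" "recursive n g" shows "recursive n (\<lambda>xs. f xs + g xs)"
proof -
  have "recursive n (\<lambda>xs. rec_nat (f xs) (\<lambda>i y. Suc ((i # y # xs) ! 1)) (g xs))"
    using assms by (intro recursive_rec_nat recursive_Suc recursive_nth) auto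
  moreover have "rec_nat a (\<lambda>i y. Suc y) b = a + b" for a b :: nat
    by (induction b) auto
  ultimately show ?thesis by simp
qed

lemma recursive_pow2:
  assumes "recursive n f" shows "recursive n (\<lambda>xs. 2 ^ f xs)"
proof -
  have "recursive n (\<lambda>xs. rec_nat 1 (\<lambda>i y. (i # y # xs) ! 1 + (i # y # xs) ! 1) (f xs))"
    using assms by (intro recursive_rec_nat recursive_add recursive_nth recursive_const) auto
  moreover have "rec_nat 1 (\<lambda>i y. y + y) b = (2 :: nat) ^ b" for b
    by (induction b) auto
  ultimately show ?thesis by simp
qed

text \<open>Bounded sums are the main tool for codes: triangular numbers and codes of finite sets
  are both of this form. The index is the head of the argument list of the summand and the
  parameters are its tail.\<close>

lemma recursive_sum:
  assumes "recursive n k" "recursive (Suc n) (\<lambda>xs. f (hd xs) (tl xs))"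
  shows "recursive n (\<lambda>xs. \<Sum>i<k xs. f i xs)"
proof -
  \<comment> \<open>During the recursion the accumulated value stands between index and parameters;
    composing with projections skips it.\<close>
  have "recursive (Suc (Suc n)) (\<lambda>xs. f (hd (map (\<lambda>g. g xs) (hd # map (\<lambda>i xs. xs ! Suc (Suc i)) [0..<n])))
      (tl (map (\<lambda>g. g xs) (hd # map (\<lambda>i xs. xs ! Suc (Suc i)) [0..<n]))))"
    using assms(2)
    by (intro recursive_comp[where f = "\<lambda>xs. f (hd xs) (tl xs)"])
      (auto intro: recursive_nth recursive_hd)
  moreover have "map (\<lambda>g. g xs) (map (\<lambda>i xs. xs ! Suc (Suc i)) [0..<n]) = tl (tl xs)"
    if "length xs = Suc (Suc n)" for xs :: "nat list"
    using that by (intro nth_equalityI) (auto simp: nth_tl)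
  ultimately have "recursive (Suc (Suc n)) (\<lambda>xs. f (hd xs) (tl (tl xs)))"
    unfolding recursive_def by auto
  then have "recursive n (\<lambda>xs. rec_nat 0 (\<lambda>i y. (i # y # xs) ! 1 + f (hd (i # y # xs)) (tl (tl (i # y # xs)))) (k xs))"
    using assms(1)
    by (intro recursive_rec_nat[where g = "\<lambda>xs. xs ! 1 + f (hd xs) (tl (tl xs))"]
        recursive_add recursive_nth recursive_const) auto
  moreover have "rec_nat 0 (\<lambda>i y. y + g i) b = (\<Sum>i<b. g i)" for g :: "nat \<Rightarrow> nat" and b
    by (induction b) auto
  ultimately show ?thesis by simp
qed

lemma recursive_prod_encode:
  assumes "recursive n f" "recursive n g"
  shows "recursive n (\<lambda>xs. prod_encode (f xs, g xs))"
proof -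
  have "triangle m = (\<Sum>i<m. Suc i)" for m by (induction m) auto
  then have "prod_encode (a, b) = (\<Sum>i<a + b. Suc i) + a" for a b
    by (simp add: prod_encode_def)
  then show ?thesis
    using assms by (auto intro!: recursive_add recursive_sum recursive_Suc recursive_hd)
qed

section \<open>Counter programs\<close>

text \<open>\<open>Loop r c\<close> tests and decrements \<open>r\<close> before each pass. This is
  what one request to a chain can do: a decrement is either carried out or refused because the
  counter is zero. \<open>Loop r Skip\<close> clears \<open>r\<close>, and
  \<open>Loop 1 (Inc 1)\<close> runs forever unless register 1 is zero.\<close>

datatype com = Skip | Inc nat | Seq com com | Loop nat com

inductive exec :: "com \<Rightarrow> (nat \<Rightarrow> nat) \<Rightarrow> (nat \<Rightarrow> nat) \<Rightarrow> bool" where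
  Skip: "exec Skip \<rho> \<rho>"
| Inc: "exec (Inc r) \<rho> (\<rho>(r := Suc (\<rho> r)))"
| Seq: "exec c \<rho> \<rho>' \<Longrightarrow> exec d \<rho>' \<rho>'' \<Longrightarrow> exec (Seq c d) \<rho> \<rho>''"
| Loop_zero: "\<rho> r = 0 \<Longrightarrow> exec (Loop r c) \<rho> \<rho>"
| Loop_Suc: "\<rho> r = Suc n \<Longrightarrow> exec c (\<rho>(r := n)) \<rho>' \<Longrightarrow> exec (Loop r c) \<rho>' \<rho>''
               \<Longrightarrow> exec (Loop r c) \<rho> \<rho>''"

section \<open>Clearing, moving and copying registers\<close>

lemma exec_clear: "exec (Loop r Skip) \<rho> (\<rho>(r := 0))"
proof (induction "\<rho> r" arbitrary: \<rho>)
  case 0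
  then show ?case by (metis exec.Loop_zero fun_upd_triv)
next
  case (Suc n)
  have "exec (Loop r Skip) (\<rho>(r := n)) (\<rho>(r := 0))"
    using Suc.hyps(1)[of "\<rho>(r := n)"] by simp
  then show ?case using Suc.hyps(2) by (metis exec.Loop_Suc exec.Skip)
qed

lemma exec_move:
  assumes "a \<noteq> b" shows "exec (Loop a (Inc b)) \<rho> (\<rho>(a := 0, b := \<rho> b + \<rho> a))"
proof (induction "\<rho> a" arbitrary: \<rho>)
  case 0
  then show ?case
    using exec.Loop_zero[of \<rho> a] by (metis add.right_neutral fun_upd_triv)
next
  case (Suc n)
  let ?\<rho> = "\<rho>(a := n, b := Suc (\<rho> b))"
  have 1: "exec (Inc b) (\<rho>(a := n)) ?\<rho>"
    using exec.Inc[of b "\<rho>(a := n)"] assms by simp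
  have "exec (Loop a (Inc b)) ?\<rho> (?\<rho>(a := 0, b := ?\<rho> b + ?\<rho> a))"
    using assms by (intro Suc.hyps(1)) simp
  also have "?\<rho>(a := 0, b := ?\<rho> b + ?\<rho> a) = \<rho>(a := 0, b := \<rho> b + \<rho> a)"
    using assms Suc.hyps(2) by (auto simp: fun_eq_iff)
  finally show ?case using 1 Suc.hyps(2) by (metis exec.Loop_Suc)
qed

text \<open>Reading a register destroys it, so its contents go to \<open>b\<close> and to the
  temporary \<open>t\<close> at once, and \<open>t\<close> is then moved back.\<close>

lemma exec_copy:
  assumes "a \<noteq> b" "a \<noteq> t" "b \<noteq> t" "\<rho> t = 0"
  shows "exec (Seq (Loop a (Seq (Inc b) (Inc t))) (Loop t (Inc a))) \<rho> (\<rho>(b := \<rho> b + \<rho> a))"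
proof -
  have "exec (Loop a (Seq (Inc b) (Inc t))) \<rho> (\<rho>(a := 0, b := \<rho> b + \<rho> a, t := \<rho> t + \<rho> a))" for \<rho>
  proof (induction "\<rho> a" arbitrary: \<rho>)
    case 0
    then show ?case
      using exec.Loop_zero[of \<rho> a] by (metis add.right_neutral fun_upd_triv)
  next
    case (Suc n)
    let ?\<rho> = "\<rho>(a := n, b := Suc (\<rho> b), t := Suc (\<rho> t))"
    have 1: "exec (Seq (Inc b) (Inc t)) (\<rho>(a := n)) ?\<rho>"
      using exec.Inc[of b "\<rho>(a := n)"] exec.Inc[of t "\<rho>(a := n, b := Suc (\<rho> b))"] assms
      by (auto intro: exec.Seq)
    have "exec (Loop a (Seq (Inc b) (Inc t))) ?\<rho> (?\<rho>(a := 0, b := ?\<rho> b + ?\<rho> a, t := ?\<rho> t + ?\<rho> a))"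
      using assms by (intro Suc.hyps(1)) simp
    also have "?\<rho>(a := 0, b := ?\<rho> b + ?\<rho> a, t := ?\<rho> t + ?\<rho> a) =
        \<rho>(a := 0, b := \<rho> b + \<rho> a, t := \<rho> t + \<rho> a)"
      using assms Suc.hyps(2) by (auto simp: fun_eq_iff)
    finally show ?case using 1 Suc.hyps(2) by (metis exec.Loop_Suc)
  qed
  then show ?thesis
  proof (rule exec.Seq)
    let ?\<rho> = "\<rho>(a := 0, b := \<rho> b + \<rho> a, t := \<rho> t + \<rho> a)"
    have "exec (Loop t (Inc a)) ?\<rho> (?\<rho>(t := 0, a := ?\<rho> a + ?\<rho> t))"
      using assms by (intro exec_move) simp
    also have "?\<rho>(t := 0, a := ?\<rho> a + ?\<rho> t) = \<rho>(b := \<rho> b + \<rho> a)"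
      using assms by (auto simp: fun_eq_iff)
    finally show "exec (Loop t (Inc a)) ?\<rho> (\<rho>(b := \<rho> b + \<rho> a))" .
  qed
qed

text \<open>
  The registers from \<open>n\<close> on are scratch space, which is zero before and after the execution.
\<close>

definition implements :: "com \<Rightarrow> recf \<Rightarrow> nat list \<Rightarrow> nat \<Rightarrow> nat \<Rightarrow> bool" where
  "implements c f as q n \<longleftrightarrow>
     (\<forall>\<rho> y. (\<forall>j\<ge>n. \<rho> j = 0) \<longrightarrow> \<rho> q = 0 \<longrightarrow> rec_eval f (map \<rho> as) y \<longrightarrow> exec c \<rho> (\<rho>(q := y)))"

lemma implementsI:
  assumes "\<And>\<rho> y. (\<And>j. j \<ge> n \<Longrightarrow> \<rho> j = 0) \<Longrightarrow> \<rho> q = 0 \<Longrightarrow> rec_eval f (map \<rho> as) y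
    \<Longrightarrow> exec c \<rho> (\<rho>(q := y))"
  shows "implements c f as q n"
  using assms unfolding implements_def by blast

lemma implementsD:
  assumes "implements c f as q n" "\<And>j. j \<ge> n \<Longrightarrow> \<rho> j = 0" "\<rho> q = 0" "rec_eval f xs y" "map \<rho> as = xs"
  shows "exec c \<rho> (\<rho>(q := y))"
  using assms unfolding implements_def by blast

text \<open>Composition keeps its intermediate results in scratch registers; this program resets
  them.\<close>

lemma exec_clear_range: "\<exists>c. \<forall>\<rho>. exec c \<rho> (\<lambda>j. if n \<le> j \<and> j < n + m then 0 else \<rho> j)"
proof (induction m)
  case 0
  have "(\<lambda>j. if n \<le> j \<and> j < n + 0 then 0 else \<rho> j) = \<rho>" for \<rho> :: "nat \<Rightarrow> nat" by auto
  then show ?case using exec.Skip by metis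
next
  case (Suc m)
  then obtain c where c: "\<And>\<rho>. exec c \<rho> (\<lambda>j. if n \<le> j \<and> j < n + m then 0 else \<rho> j)" by blast
  have "exec (Seq c (Loop (n + m) Skip)) \<rho> (\<lambda>j. if n \<le> j \<and> j < n + Suc m then 0 else \<rho> j)" for \<rho>
  proof (rule exec.Seq[OF c])
    let ?\<rho> = "\<lambda>j. if n \<le> j \<and> j < n + m then 0 else \<rho> j"
    have "exec (Loop (n + m) Skip) ?\<rho> (?\<rho>(n + m := 0))" by (rule exec_clear)
    also have "?\<rho>(n + m := 0) = (\<lambda>j. if n \<le> j \<and> j < n + Suc m then 0 else \<rho> j)"
      by (auto simp: fun_eq_iff less_Suc_eq)
    finally show "exec (Loop (n + m) Skip) ?\<rho> \<dots>" .
  qed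
  then show ?case by blast
qed

text \<open>All results lie in registers from \<open>n\<close> on and the arguments below
  \<open>n\<close>, so earlier results do not disturb later evaluations. Every \<open>cs j\<close>
  takes its scratch space beyond the whole result block, which is therefore still zero when
  \<open>cs j\<close> starts.\<close>

lemma exec_list:
  assumes "\<And>j. j < length gs \<Longrightarrow> implements (cs j) (gs ! j) as (n + j) (n + length gs)"
    and "set as \<subseteq> {..<n}" "m \<le> length gs"
  shows "\<exists>c. \<forall>\<rho> ys. (\<forall>j\<ge>n. \<rho> j = 0) \<longrightarrow> list_all2 (\<lambda>g y. rec_eval g (map \<rho> as) y) gs ys
    \<longrightarrow> exec c \<rho> (\<lambda>j. if n \<le> j \<and> j < n + m then ys ! (j - n) else \<rho> j)"
  using assms(3)
proof (induction m)
  case 0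
  have "(\<lambda>j. if n \<le> j \<and> j < n + 0 then ys ! (j - n) else \<rho> j) = \<rho>"
    for \<rho> :: "nat \<Rightarrow> nat" and ys by auto
  then show ?case using exec.Skip by metis
next
  case (Suc m)
  then obtain c where c: "\<And>\<rho> ys. (\<forall>j\<ge>n. \<rho> j = 0) \<Longrightarrow> list_all2 (\<lambda>g y. rec_eval g (map \<rho> as) y) gs ys
    \<Longrightarrow> exec c \<rho> (\<lambda>j. if n \<le> j \<and> j < n + m then ys ! (j - n) else \<rho> j)" by auto
  have "exec (Seq c (cs m)) \<rho> (\<lambda>j. if n \<le> j \<and> j < n + Suc m then ys ! (j - n) else \<rho> j)"
    if zero: "\<forall>j\<ge>n. \<rho> j = 0" and ys: "list_all2 (\<lambda>g y. rec_eval g (map \<rho> as) y) gs ys" for \<rho> ys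
  proof (rule exec.Seq[OF c[OF zero ys]])
    let ?\<rho> = "\<lambda>j. if n \<le> j \<and> j < n + m then ys ! (j - n) else \<rho> j"
    have "exec (cs m) ?\<rho> (?\<rho>(n + m := ys ! m))"
    proof (rule implementsD[OF assms(1)])
      show "map ?\<rho> as = map \<rho> as" using assms(2) by auto
      show "rec_eval (gs ! m) (map \<rho> as) (ys ! m)"
        using ys Suc.prems by (auto simp: list_all2_conv_all_nth)
    qed (use Suc.prems zero in auto)
    also have "?\<rho>(n + m := ys ! m) = (\<lambda>j. if n \<le> j \<and> j < n + Suc m then ys ! (j - n) else \<rho> j)"
      by (auto simp: fun_eq_iff less_Suc_eq)
    finally show "exec (cs m) ?\<rho> \<dots>" .
  qed
  then show ?case by blast
qed

text \<open>Register \<open>n\<close> holds the index reached, \<open>n + 1\<close> the number of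
  rounds left, \<open>q\<close> the value at the index, and \<open>n + 2\<close> the previous value
  while \<open>d\<close> computes the next one into the cleared \<open>q\<close>. The initial copy
  of \<open>a\<close> into \<open>n + 1\<close> borrows \<open>n\<close> as its temporary.\<close>

lemma implements_PrimRec:
  assumes f: "implements c f as q (n + 3)" and g: "implements d g (n # (n + 2) # as) q (n + 3)"
    and as: "set as \<subseteq> {..<n}" "a < n" "q < n" "q \<notin> set as" "q \<noteq> a"
  defines "body \<equiv> Seq (Loop q (Inc (n + 2))) (Seq d (Seq (Loop (n + 2) Skip) (Inc n)))"
  shows "implements (Seq (Seq (Loop a (Seq (Inc (n + 1)) (Inc n))) (Loop n (Inc a)))
    (Seq c (Seq (Loop (n + 1) body) (Loop n Skip)))) (PrimRec f g) (a # as) q n"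
proof (rule implementsI)
  fix \<rho> y assume zero: "\<And>j. j \<ge> n \<Longrightarrow> \<rho> j = 0" "\<rho> q = 0"
    and "rec_eval (PrimRec f g) (map \<rho> (a # as)) y"
  then have rec: "rec_eval (PrimRec f g) (\<rho> a # map \<rho> as) y" by simp
  have unch: "map (\<rho>(n := i, n + 1 := k, q := z, n + 2 := u)) as = map \<rho> as" for i k z u
    using as by auto
  have loop: "exec (Loop (n + 1) body) (\<rho>(n := i, n + 1 := k, q := z)) (\<rho>(n := i + k, n + 1 := 0, q := y))"
    if "rec_eval (PrimRec f g) (i # map \<rho> as) z" "rec_eval (PrimRec f g) ((i + k) # map \<rho> as) y" for i k z
    using that
  proof (induction k arbitrary: i z)
    case 0
    then have "y = z" by (auto dest: rec_eval_deterministic)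
    then show ?case using as by (auto intro: exec.Loop_zero)
  next
    case (Suc k)
    \<comment> \<open>The loop needs a value at the next index. A primitive recursion with a value
      at \<open>i + Suc k\<close> has one at every smaller argument, by descent from there.\<close>
    have "\<exists>w. rec_eval (PrimRec f g) (Suc i # map \<rho> as) w"
      using Suc.prems(2)
    proof (induction k arbitrary: y)
      case (Suc k)
      then show ?case by (metis add_Suc_right rec_eval_PrimRec_SucE)
    qed auto
    then obtain w where w: "rec_eval (PrimRec f g) (Suc i # map \<rho> as) w" ..
    then have gw: "rec_eval g (i # z # map \<rho> as) w"
      by (metis Suc.prems(1) rec_eval_PrimRec_SucE rec_eval_deterministic)
    let ?s1 = "\<rho>(n := i, n + 1 := k, q := z)"
    let ?s2 = "\<rho>(n := i, n + 1 := k, q := 0, n + 2 := z)"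
    let ?s3 = "\<rho>(n := i, n + 1 := k, q := w, n + 2 := z)"
    let ?s4 = "\<rho>(n := i, n + 1 := k, q := w)"
    let ?s5 = "\<rho>(n := Suc i, n + 1 := k, q := w)"
    have "exec (Loop q (Inc (n + 2))) ?s1 (?s1(q := 0, n + 2 := ?s1 (n + 2) + ?s1 q))"
      using as by (intro exec_move) auto
    also have "?s1(q := 0, n + 2 := ?s1 (n + 2) + ?s1 q) = ?s2"
      using as zero by (auto simp: fun_eq_iff)
    finally have 1: "exec (Loop q (Inc (n + 2))) ?s1 ?s2" .
    have "exec d ?s2 (?s2(q := w))"
    proof (rule implementsD[OF g _ _ gw])
      show "map ?s2 (n # (n + 2) # as) = i # z # map \<rho> as" using as by auto
    qed (use as zero in auto)
    also have "?s2(q := w) = ?s3" using as by (auto simp: fun_eq_iff)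
    finally have 2: "exec d ?s2 ?s3" .
    have "exec (Loop (n + 2) Skip) ?s3 (?s3(n + 2 := 0))" by (rule exec_clear)
    also have "?s3(n + 2 := 0) = ?s4" using as zero by (auto simp: fun_eq_iff)
    finally have 3: "exec (Loop (n + 2) Skip) ?s3 ?s4" .
    have "exec (Inc n) ?s4 (?s4(n := Suc (?s4 n)))" by (rule exec.Inc)
    also have "?s4(n := Suc (?s4 n)) = ?s5" using as by (auto simp: fun_eq_iff)
    finally have body: "exec body ?s1 ?s5"
      unfolding body_def using 1 2 3 by (blast intro: exec.Seq)
    have "exec (Loop (n + 1) body) ?s5 (\<rho>(n := Suc i + k, n + 1 := 0, q := y))"
      using w Suc.prems(2) by (intro Suc.IH) auto
    then have 4: "exec (Loop (n + 1) body) ?s5 (\<rho>(n := i + Suc k, n + 1 := 0, q := y))" by simp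
    have "(\<rho>(n := i, n + 1 := Suc k, q := z))(n + 1 := k) = ?s1"
        "(\<rho>(n := i, n + 1 := Suc k, q := z)) (n + 1) = Suc k"
      using as by (auto simp: fun_eq_iff)
    then show ?case using body 4 exec.Loop_Suc by metis
  qed
  have "\<exists>z. rec_eval (PrimRec f g) (0 # map \<rho> as) z"
    using rec
  proof (induction "\<rho> a" arbitrary: y)
    case 0 then show ?case by auto
  next
    case (Suc m)
    have "\<exists>z. rec_eval (PrimRec f g) (0 # map \<rho> as) z" if "rec_eval (PrimRec f g) (k # map \<rho> as) y" for k y
      using that by (induction k arbitrary: y) (auto elim: rec_eval_PrimRec_SucE)
    then show ?case using Suc.prems by blast
  qed
  then obtain z where z: "rec_eval (PrimRec f g) (0 # map \<rho> as) z" ..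
  then have fz: "rec_eval f (map \<rho> as) z" by (auto elim: rec_eval_PrimRec_0E)
  have "exec (Seq (Loop a (Seq (Inc (n + 1)) (Inc n))) (Loop n (Inc a))) \<rho> (\<rho>(n + 1 := \<rho> (n + 1) + \<rho> a))"
    using as zero by (intro exec_copy) auto
  also have "\<rho>(n + 1 := \<rho> (n + 1) + \<rho> a) = \<rho>(n + 1 := \<rho> a)" using zero by simp
  finally have 1: "exec (Seq (Loop a (Seq (Inc (n + 1)) (Inc n))) (Loop n (Inc a))) \<rho> (\<rho>(n + 1 := \<rho> a))" .
  have "exec c (\<rho>(n + 1 := \<rho> a)) ((\<rho>(n + 1 := \<rho> a))(q := z))"
  proof (rule implementsD[OF f _ _ fz])
    show "map (\<rho>(n + 1 := \<rho> a)) as = map \<rho> as" using as by auto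
  qed (use as zero in auto)
  also have "(\<rho>(n + 1 := \<rho> a))(q := z) = \<rho>(n := 0, n + 1 := \<rho> a, q := z)"
    using zero as by (auto simp: fun_eq_iff)
  finally have 2: "exec c (\<rho>(n + 1 := \<rho> a)) (\<rho>(n := 0, n + 1 := \<rho> a, q := z))" .
  have 3: "exec (Loop (n + 1) body) (\<rho>(n := 0, n + 1 := \<rho> a, q := z)) (\<rho>(n := \<rho> a, n + 1 := 0, q := y))"
    using loop[OF z, of "\<rho> a"] rec by simp
  have "exec (Loop n Skip) (\<rho>(n := \<rho> a, n + 1 := 0, q := y)) ((\<rho>(n := \<rho> a, n + 1 := 0, q := y))(n := 0))"
    by (rule exec_clear)
  also have "(\<rho>(n := \<rho> a, n + 1 := 0, q := y))(n := 0) = \<rho>(q := y)"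
    using zero as by (auto simp: fun_eq_iff)
  finally show "exec (Seq (Seq (Loop a (Seq (Inc (n + 1)) (Inc n))) (Loop n (Inc a)))
    (Seq c (Seq (Loop (n + 1) body) (Loop n Skip)))) \<rho> (\<rho>(q := y))"
    using 1 2 3 by (blast intro: exec.Seq)
qed

text \<open>The result register \<open>q\<close> is the candidate of the search and an argument of
  \<open>f\<close>; register \<open>n\<close> receives the value of \<open>f\<close> and controls
  the loop. A nonzero value is cleared before \<open>q\<close> is incremented and \<open>f\<close>
  evaluated again, so on exit \<open>n\<close> is zero and \<open>q\<close> is the least
  zero.\<close>

lemma implements_Mu:
  assumes f: "implements c f (q # as) n (n + 1)" and as: "set as \<subseteq> {..<n}" "q < n" "q \<notin> set as"
  shows "implements (Seq c (Loop n (Seq (Loop n Skip) (Seq (Inc q) c)))) (Mu f) as q n"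
proof (rule implementsI)
  fix \<rho> y assume zero: "\<And>j. j \<ge> n \<Longrightarrow> \<rho> j = 0" "\<rho> q = 0"
    and "rec_eval (Mu f) (map \<rho> as) y"
  then have y: "rec_eval f (y # map \<rho> as) 0"
      "\<And>m. m < y \<Longrightarrow> \<exists>z. rec_eval f (m # map \<rho> as) (Suc z)"
    by (auto elim: rec_eval_MuE)
  have c: "exec c (\<rho>(q := m)) (\<rho>(q := m, n := z))" if "rec_eval f (m # map \<rho> as) z" for m z
  proof (rule implementsD[OF f _ _ that])
    show "map (\<rho>(q := m)) (q # as) = m # map \<rho> as" using as by auto
  qed (use zero as in auto)
  let ?B = "Seq (Loop n Skip) (Seq (Inc q) c)"
  have loop: "exec (Loop n ?B) (\<rho>(q := m, n := z)) (\<rho>(q := y))"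
    if "m + k = y" "rec_eval f (m # map \<rho> as) z" for k m z
    using that
  proof (induction k arbitrary: m z)
    case 0
    then have "z = 0" using y(1) by (auto dest: rec_eval_deterministic)
    moreover have "\<rho>(q := m, n := 0) = \<rho>(q := y)" using zero 0 as by (auto simp: fun_eq_iff)
    ultimately show ?case by (metis exec.Loop_zero fun_upd_same)
  next
    case (Suc k)
    then obtain w where "z = Suc w" using y(2)[of m] by (auto dest: rec_eval_deterministic)
    \<comment> \<open>The next candidate is at most \<open>y\<close>: below \<open>y\<close> the
      function has a positive value, at \<open>y\<close> the value zero.\<close>
    have "\<exists>z. rec_eval f (Suc m # map \<rho> as) z"
      using y(1) y(2)[of "Suc m"] Suc.prems(1) by (cases k) auto
    then obtain z' where z': "rec_eval f (Suc m # map \<rho> as) z'" ..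
    have "exec (Loop n Skip) (\<rho>(q := m, n := w)) ((\<rho>(q := m, n := w))(n := 0))"
      by (rule exec_clear)
    also have "(\<rho>(q := m, n := w))(n := 0) = \<rho>(q := m)"
      using zero as by (auto simp: fun_eq_iff)
    finally have 1: "exec (Loop n Skip) (\<rho>(q := m, n := w)) (\<rho>(q := m))" .
    have "exec (Inc q) (\<rho>(q := m)) (\<rho>(q := Suc m))"
      using exec.Inc[of q "\<rho>(q := m)"] by simp
    with 1 c[OF z'] have "exec ?B (\<rho>(q := m, n := w)) (\<rho>(q := Suc m, n := z'))"
      by (blast intro: exec.Seq)
    moreover have "exec (Loop n ?B) (\<rho>(q := Suc m, n := z')) (\<rho>(q := y))"
      using Suc.prems z' by (intro Suc.IH) auto
    ultimately have "exec (Loop n ?B) (\<rho>(q := m, n := Suc w)) (\<rho>(q := y))"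
      using exec.Loop_Suc[of "\<rho>(q := m, n := Suc w)" n w] by (metis fun_upd_same fun_upd_upd)
    then show ?case unfolding \<open>z = Suc w\<close> .
  qed
  have "\<exists>z. rec_eval f (0 # map \<rho> as) z" using y by (cases y) auto
  then obtain z where z: "rec_eval f (0 # map \<rho> as) z" ..
  have "\<rho>(q := 0) = \<rho>" using zero by auto
  then have "exec c \<rho> (\<rho>(q := 0, n := z))" using c[OF z] by simp
  with loop[of 0 y, OF _ z]
  show "exec (Seq c (Loop n ?B)) \<rho> (\<rho>(q := y))" by (auto intro: exec.Seq)
qed

text \<open>The registers are generalised because subfunctions get their own argument, result and
  scratch registers. Where the number of arguments does not fit, \<open>f\<close> has no value and
  \<open>implements\<close> demands nothing, so \<open>Skip\<close> serves.\<close>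

lemma ex_implements:
  assumes "set as \<subseteq> {..<n}" "q < n" "q \<notin> set as"
  shows "\<exists>c. implements c f as q n"
  using assms
proof (induction f arbitrary: as q n)
  case Zero
  have "implements Skip Zero as q n"
    by (auto intro!: implementsI elim!: rec_eval_ZeroE) (metis exec.Skip fun_upd_triv)
  then show ?case ..
next
  case Succ
  show ?case
  proof (cases "\<exists>a. as = [a]")
    case True
    then obtain a where a: "as = [a]" ..
    have "implements (Seq (Seq (Loop a (Seq (Inc q) (Inc n))) (Loop n (Inc a))) (Inc q)) Succ as q n"
    proof (rule implementsI)
      fix \<rho> y assume zero: "\<And>j. j \<ge> n \<Longrightarrow> \<rho> j = 0" "\<rho> q = 0" and "rec_eval Succ (map \<rho> as) y"
      then have y: "y = Suc (\<rho> a)" by (auto simp: a elim: rec_eval_SuccE)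
      have "exec (Seq (Loop a (Seq (Inc q) (Inc n))) (Loop n (Inc a))) \<rho> (\<rho>(q := \<rho> q + \<rho> a))"
        using a Succ zero by (intro exec_copy) auto
      then show "exec (Seq (Seq (Loop a (Seq (Inc q) (Inc n))) (Loop n (Inc a))) (Inc q)) \<rho> (\<rho>(q := y))"
        using exec.Inc[of q "\<rho>(q := \<rho> a)"] zero y by (auto intro: exec.Seq)
    qed
    then show ?thesis ..
  next
    case False
    then have "implements Skip Succ as q n"
      by (auto intro!: implementsI elim!: rec_eval_SuccE)
    then show ?thesis ..
  qed
next
  case (Proj i)
  show ?case
  proof (cases "i < length as")
    case True
    let ?a = "as ! i"
    have "implements (Seq (Loop ?a (Seq (Inc q) (Inc n))) (Loop n (Inc ?a))) (Proj i) as q n"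
    proof (rule implementsI)
      fix \<rho> y assume zero: "\<And>j. j \<ge> n \<Longrightarrow> \<rho> j = 0" "\<rho> q = 0" and "rec_eval (Proj i) (map \<rho> as) y"
      then have y: "y = \<rho> ?a" using True by (auto elim: rec_eval_ProjE)
      have "?a \<in> set as" using True by simp
      then have "exec (Seq (Loop ?a (Seq (Inc q) (Inc n))) (Loop n (Inc ?a))) \<rho> (\<rho>(q := \<rho> q + \<rho> ?a))"
        using Proj zero by (intro exec_copy) auto
      then show "exec (Seq (Loop ?a (Seq (Inc q) (Inc n))) (Loop n (Inc ?a))) \<rho> (\<rho>(q := y))"
        using zero y by simp
    qed
    then show ?thesis ..
  next
    case False
    then have "implements Skip (Proj i) as q n"
      by (auto intro!: implementsI elim!: rec_eval_ProjE)
    then show ?thesis ..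
  qed
next
  case (Comp f gs)
  let ?m = "n + length gs"
  have "\<exists>c. implements c (gs ! j) as (n + j) ?m" if "j < length gs" for j
    using that Comp.prems by (intro Comp.IH(2)) auto
  then obtain cs where "\<And>j. j < length gs \<Longrightarrow> implements (cs j) (gs ! j) as (n + j) ?m"
    by metis
  then have "\<exists>c. \<forall>\<rho> ys. (\<forall>j\<ge>n. \<rho> j = 0) \<longrightarrow> list_all2 (\<lambda>g y. rec_eval g (map \<rho> as) y) gs ys
    \<longrightarrow> exec c \<rho> (\<lambda>j. if n \<le> j \<and> j < ?m then ys ! (j - n) else \<rho> j)"
    by (intro exec_list Comp.prems) auto
  then obtain c where c: "\<And>\<rho> ys. (\<forall>j\<ge>n. \<rho> j = 0) \<Longrightarrow> list_all2 (\<lambda>g y. rec_eval g (map \<rho> as) y) gs ys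
    \<Longrightarrow> exec c \<rho> (\<lambda>j. if n \<le> j \<and> j < ?m then ys ! (j - n) else \<rho> j)"
    by blast
  have "\<exists>d. implements d f [n..<?m] q ?m"
    using Comp.prems by (intro Comp.IH(1)) auto
  then obtain d where d: "implements d f [n..<?m] q ?m" ..
  obtain e where e: "\<And>\<rho>. exec e \<rho> (\<lambda>j. if n \<le> j \<and> j < ?m then 0 else \<rho> j)"
    using exec_clear_range by blast
  have "implements (Seq c (Seq d e)) (Comp f gs) as q n"
  proof (rule implementsI)
    fix \<rho> y assume zero: "\<And>j. j \<ge> n \<Longrightarrow> \<rho> j = 0" "\<rho> q = 0" and "rec_eval (Comp f gs) (map \<rho> as) y"
    then obtain ys where ys: "list_all2 (\<lambda>g y. rec_eval g (map \<rho> as) y) gs ys" "rec_eval f ys y"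
      by (auto elim: rec_eval_CompE)
    let ?\<rho> = "\<lambda>j. if n \<le> j \<and> j < ?m then ys ! (j - n) else \<rho> j"
    have "map ?\<rho> [n..<?m] = ys"
      using list_all2_lengthD[OF ys(1)] by (intro nth_equalityI) auto
    then have "exec d ?\<rho> (?\<rho>(q := y))"
      using zero ys(2) Comp.prems by (intro implementsD[OF d]) auto
    moreover have "(\<lambda>j. if n \<le> j \<and> j < ?m then 0 else (?\<rho>(q := y)) j) = \<rho>(q := y)"
      using zero Comp.prems by (auto simp: fun_eq_iff)
    ultimately show "exec (Seq c (Seq d e)) \<rho> (\<rho>(q := y))"
      using c[OF _ ys(1)] zero e[of "?\<rho>(q := y)"] by (auto intro: exec.Seq)
  qed
  then show ?case ..
next
  case (PrimRec f g)
  show ?case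
  proof (cases as)
    case Nil
    have "\<not> rec_eval (PrimRec f g) [] y" for y
      by (auto elim: rec_eval.cases)
    then have "implements Skip (PrimRec f g) as q n"
      by (auto intro!: implementsI simp: Nil)
    then show ?thesis ..
  next
    case (Cons a as')
    have "\<exists>c. implements c f as' q (n + 3)"
      using PrimRec.prems Cons by (intro PrimRec.IH(1)) auto
    then obtain c where c: "implements c f as' q (n + 3)" ..
    have "\<exists>d. implements d g (n # (n + 2) # as') q (n + 3)"
      using PrimRec.prems Cons by (intro PrimRec.IH(2)) auto
    then obtain d where "implements d g (n # (n + 2) # as') q (n + 3)" ..
    from implements_PrimRec[OF c this, of a] show ?thesis
      using PrimRec.prems Cons by auto
  qed
next
  case (Mu f)
  have "\<exists>c. implements c f (q # as) n (n + 1)"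
    using Mu.prems by (intro Mu.IH) auto
  then show ?case using implements_Mu Mu.prems by blast
qed

section \<open>Systems in which every fork has one child\<close>

type_synonym ('d, 'x, 'b, 's) stacks =
  "('x \<Rightarrow> 'd) \<times> (nat \<Rightarrow> ('b \<times> 's) list) \<times> nat list \<times> nat"

fun executable :: "('x \<Rightarrow> 'd) \<Rightarrow> ('d, 'x, 'q, 'b) action \<Rightarrow> bool" where
  "executable \<sigma> (Guard as) \<longleftrightarrow> (\<forall>a\<in>set as. holds \<sigma> a)"
| "executable \<sigma> _ \<longleftrightarrow> True"

fun perform :: "('d, 'x, 'q, 'b, 's) eqdas \<Rightarrow> nat \<Rightarrow> ('d, 'x, 'q, 'b) action \<Rightarrow> 's
    \<Rightarrow> ('d, 'x, 'b, 's) stacks \<Rightarrow> ('d, 'x, 'b, 's) stacks" where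
  "perform A i (Guard as) s (\<sigma>, \<theta>, ps, n) = (\<sigma>, \<theta>(i := (fst (hd (\<theta> i)), s) # tl (\<theta> i)), ps, n)"
| "perform A i (Assign x d) s (\<sigma>, \<theta>, ps, n) =
     (\<sigma>(x := d), \<theta>(i := (fst (hd (\<theta> i)), s) # tl (\<theta> i)), ps, n)"
| "perform A i (DispatchA q b) s (\<sigma>, \<theta>, ps, n) =
     (\<sigma>, \<theta>(i := (fst (hd (\<theta> i)), s) # tl (\<theta> i), n := [(b, lts_init (block_lts A b))]),
      ps @ [n], Suc n)"
| "perform A i (ForkJoin q b p) s (\<sigma>, \<theta>, ps, n) =
     (\<sigma>, \<theta>(i := (b, lts_init (block_lts A b)) # (fst (hd (\<theta> i)), s) # tl (\<theta> i)), ps @ [i], n)"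

text \<open>
  If every fork creates exactly one child, the vertices form chains in which only the last vertex
  is unblocked. In \<open>(\<sigma>, \<theta>, ps, n)\<close> the chains are \<open>\<theta> i\<close> for \<open>i < n\<close>, last vertex first, and \<open>ps\<close>
  lists the chains whose last vertex is a call, in the order of the queue.
\<close>

inductive stack_step :: "('d, 'x, 'q, 'b, 's) eqdas \<Rightarrow> ('d, 'x, 'b, 's) stacks
    \<Rightarrow> ('d, 'x, 'b, 's) stacks \<Rightarrow> bool" for A where
  act: "i \<notin> set ps \<Longrightarrow> \<theta> i = (b, s) # fs \<Longrightarrow> (s, a, s') \<in> lts_trans (block_lts A b)
    \<Longrightarrow> executable \<sigma> a \<Longrightarrow> stack_step A (\<sigma>, \<theta>, ps, n) (perform A i a s' (\<sigma>, \<theta>, ps, n))"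
| finish: "i \<notin> set ps \<Longrightarrow> \<theta> i = (b, lts_final (block_lts A b)) # fs
    \<Longrightarrow> stack_step A (\<sigma>, \<theta>, ps, n) (\<sigma>, \<theta>(i := fs), ps, n)"
| serve: "stack_step A (\<sigma>, \<theta>, i # ps, n) (\<sigma>, \<theta>, ps, n)"

definition initial_stacks :: "('d, 'x, 'q, 'b, 's) eqdas \<Rightarrow> ('d, 'x, 'b, 's) stacks" where
  "initial_stacks A = (\<lambda>x\<in>vars A. dinit A,
     (\<lambda>_. [])(0 := [(main_block A, lts_init (block_lts A (main_block A)))]), [], 1)"

text \<open>The wait edges of a chain listed last vertex first: each vertex waits for the one listed
  just before it.\<close>

fun links :: "'a list \<Rightarrow> ('a \<times> 'a) set" where
  "links (w # v # xs) = insert (v, w) (links (v # xs))"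
| "links _ = {}"

lemma links_subset: "links xs \<subseteq> set (tl xs) \<times> set xs"
  by (induction xs rule: links.induct) auto

lemma links_iff: "distinct xs \<Longrightarrow> v \<in> set xs \<Longrightarrow> (\<exists>w. (v, w) \<in> links xs) \<longleftrightarrow> v \<noteq> hd xs"
  by (induction xs rule: links.induct) (use links_subset in fastforce)+

lemma links_tl: "distinct (v # xs) \<Longrightarrow> links (v # xs) - UNIV \<times> {v} = links xs"
  using links_subset[of xs] by (cases xs) auto

text \<open>With a single queue, one list \<open>ps\<close> records both which chains end in a call
  and in which order they are served.\<close>

locale chain_system =
  fixes A :: "('d, 'x, 'q, 'b, 's) eqdas" and q\<^sub>0 :: 'q
  assumes eqdas: "eqdas A" and cqid: "cqid A = {q\<^sub>0}"
    and single_fork: "\<And>b s q b' p s'. b \<in> blocks A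
      \<Longrightarrow> (s, ForkJoin q b' p, s') \<in> lts_trans (block_lts A b) \<Longrightarrow> p = Some 1"
begin

text \<open>\<open>vs i\<close> names the vertices of chain \<open>i\<close> in the order of
  \<open>\<theta> i\<close>. Only the front of a chain can be a call, namely when \<open>i\<close>
  is in \<open>ps\<close>. Chains from \<open>n\<close> on are empty, so a dispatch can open chain
  \<open>n\<close>.\<close>

definition represents :: "(nat \<Rightarrow> vertex list) \<Rightarrow> ('q, 'b, 's) ctgraph
    \<Rightarrow> (nat \<Rightarrow> ('b \<times> 's) list) \<Rightarrow> nat list \<Rightarrow> nat \<Rightarrow> bool" where
  "represents vs G \<theta> ps n \<longleftrightarrow>
     (\<forall>i. map (\<lambda>v. (vblock G v, vstate G v)) (vs i) = \<theta> i) \<and>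
     (\<forall>i. \<forall>v\<in>set (vs i). vblock G v \<in> blocks A) \<and>
     (\<forall>i\<ge>n. vs i = []) \<and> (\<forall>i. distinct (vs i)) \<and>
     (\<forall>i j. i \<noteq> j \<longrightarrow> set (vs i) \<inter> set (vs j) = {}) \<and>
     (\<forall>i\<in>set ps. vs i \<noteq> []) \<and> distinct ps \<and>
     tasks G = (\<Union>i. set (vs i)) - (\<lambda>i. hd (vs i)) ` set ps \<and>
     queue G = (\<lambda>_. [])(q\<^sub>0 := map (\<lambda>i. hd (vs i)) ps) \<and>
     waits G = (\<Union>i. links (vs i))"

lemma representsD:
  assumes "represents vs G \<theta> ps n"
  shows "\<And>i. map (\<lambda>v. (vblock G v, vstate G v)) (vs i) = \<theta> i"
    and "\<And>i v. v \<in> set (vs i) \<Longrightarrow> vblock G v \<in> blocks A"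
    and "\<And>i. i \<ge> n \<Longrightarrow> vs i = []" and "\<And>i. distinct (vs i)"
    and "\<And>i j v. v \<in> set (vs i) \<Longrightarrow> v \<in> set (vs j) \<Longrightarrow> i = j"
    and "\<And>i. i \<in> set ps \<Longrightarrow> vs i \<noteq> []" and "distinct ps"
    and "tasks G = (\<Union>i. set (vs i)) - (\<lambda>i. hd (vs i)) ` set ps"
    and "queue G = (\<lambda>_. [])(q\<^sub>0 := map (\<lambda>i. hd (vs i)) ps)"
    and "waits G = (\<Union>i. links (vs i))"
proof -
  have c: "\<forall>i. map (\<lambda>v. (vblock G v, vstate G v)) (vs i) = \<theta> i"
      "\<forall>i. \<forall>v\<in>set (vs i). vblock G v \<in> blocks A"
      "\<forall>i\<ge>n. vs i = []" "\<forall>i. distinct (vs i)"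
      "\<forall>i j. i \<noteq> j \<longrightarrow> set (vs i) \<inter> set (vs j) = {}" "\<forall>i\<in>set ps. vs i \<noteq> []"
    using assms unfolding represents_def by - (elim conjE, assumption)+
  show "distinct ps" "tasks G = (\<Union>i. set (vs i)) - (\<lambda>i. hd (vs i)) ` set ps"
      "queue G = (\<lambda>_. [])(q\<^sub>0 := map (\<lambda>i. hd (vs i)) ps)" "waits G = (\<Union>i. links (vs i))"
    using assms unfolding represents_def by - (elim conjE, assumption)+
  show "map (\<lambda>v. (vblock G v, vstate G v)) (vs i) = \<theta> i" for i using c(1) by (rule spec)
  show "v \<in> set (vs i) \<Longrightarrow> vblock G v \<in> blocks A" for i v using c(2) by blast
  show "i \<ge> n \<Longrightarrow> vs i = []" for i using c(3) by blast
  show "distinct (vs i)" for i using c(4) by blast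
  show "v \<in> set (vs i) \<Longrightarrow> v \<in> set (vs j) \<Longrightarrow> i = j" for i j v using c(5) by (metis disjoint_iff)
  show "i \<in> set ps \<Longrightarrow> vs i \<noteq> []" for i using c(6) by blast
qed

section \<open>Effect of the single steps on the chains\<close>

lemma represents_vertices:
  assumes "represents vs G \<theta> ps n" shows "vertices G = (\<Union>i. set (vs i))"
proof -
  note R = representsD[OF assms]
  have "calls G = (\<lambda>i. hd (vs i)) ` set ps" by (auto simp: calls_def R(9))
  moreover have "hd (vs i) \<in> set (vs i)" if "i \<in> set ps" for i using R(6)[OF that] by simp
  ultimately show ?thesis by (auto simp: vertices_def R(8))
qed

text \<open>Every vertex but the front one waits for its neighbour, and the front vertex is a call
  rather than a task when its chain is in \<open>ps\<close>. Disjointness of the chains excludes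
  interference from elsewhere.\<close>

lemma represents_active:
  assumes "represents vs G \<theta> ps n"
  shows "v \<in> tasks G \<and> unblocked G v \<longleftrightarrow> (\<exists>i us. i \<notin> set ps \<and> vs i = v # us)"
proof
  note R = representsD[OF assms]
  assume v: "v \<in> tasks G \<and> unblocked G v"
  then obtain i where i: "v \<in> set (vs i)" by (auto simp: R(8))
  have "(v, w) \<notin> links (vs i)" for w
    using v by (auto simp: unblocked_def R(10))
  then have "v = hd (vs i)" using links_iff[OF R(4) i] by blast
  moreover from this have "i \<notin> set ps" using v by (auto simp: R(8))
  ultimately show "\<exists>i us. i \<notin> set ps \<and> vs i = v # us" using i by (cases "vs i") auto
next
  note R = representsD[OF assms]
  assume "\<exists>i us. i \<notin> set ps \<and> vs i = v # us"
  then obtain i us where i: "i \<notin> set ps" "vs i = v # us" by blast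
  then have v: "v \<in> set (vs i)" by simp
  have "(v, w) \<notin> links (vs j)" for w j
  proof
    assume *: "(v, w) \<in> links (vs j)"
    then have "v \<in> set (vs j)" using links_subset by (metis SigmaD1 list.set_sel(2) subsetD tl_Nil)
    then have "j = i" using R(5) v by blast
    then show False using * links_iff[OF R(4) v] i by auto
  qed
  moreover have "v \<noteq> hd (vs j)" if "j \<in> set ps" for j
    using that R(5)[OF v, of j] R(6)[OF that] i(1) by auto
  ultimately show "v \<in> tasks G \<and> unblocked G v"
    using v by (auto simp: unblocked_def R(8,10))
qed

lemma represents_set_state:
  assumes "represents vs G \<theta> ps n" "vs i = v # us"
  shows "represents vs (set_state v s G) (\<theta>(i := (fst (hd (\<theta> i)), s) # tl (\<theta> i))) ps n"
proof -
  note R = representsD[OF assms(1)]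
  have v: "v \<in> set (vs i)" using assms(2) by simp
  have "map (\<lambda>u. (vblock G u, if u = v then s else vstate G u)) (vs j) = \<theta> j" if "j \<noteq> i" for j
    unfolding R(1)[of j, symmetric] using R(5)[OF v, of j] that by auto
  moreover have "map (\<lambda>u. (vblock G u, if u = v then s else vstate G u)) (vs i) =
      (fst (hd (\<theta> i)), s) # tl (\<theta> i)"
    using R(4)[of i] assms(2) R(1)[of i, symmetric] by auto
  ultimately show ?thesis
    using assms(1) unfolding represents_def set_state_def by (auto simp: fun_upd_def)
qed

lemma represents_dispatch:
  assumes "represents vs G \<theta> ps n" "w \<notin> vertices G" "b \<in> blocks A"
  shows "represents (vs(n := [w])) (enqueue A q\<^sub>0 b [w] G)
    (\<theta>(n := [(b, lts_init (block_lts A b))])) (ps @ [n]) (Suc n)"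
proof -
  note R = representsD[OF assms(1)]
  have w: "w \<notin> set (vs i)" for i using assms(2) by (auto simp: represents_vertices[OF assms(1)])
  have n: "n \<notin> set ps" using R(3,6) by blast
  have hd: "map (\<lambda>i. hd (if i = n then [w] else vs i)) ps = map (\<lambda>i. hd (vs i)) ps"
    using n by auto
  have hd': "(\<lambda>i. hd (if i = n then [w] else vs i)) ` set ps = (\<lambda>i. hd (vs i)) ` set ps"
    using n by auto
  have hdw: "hd (vs i) \<noteq> w" if "i \<in> set ps" for i using w[of i] R(6)[OF that] by (metis list.set_sel(1))
  have "map (\<lambda>v. (if v = w then b else vblock G v, if v = w then lts_init (block_lts A b) else vstate G v)) (vs i)
      = \<theta> i" for i
    using w by (auto intro!: trans[OF _ R(1)])
  moreover have "(\<Union>i. set (if i = n then [w] else vs i)) = insert w (\<Union>i. set (vs i))"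
    using R(3)[of n] by (auto split: if_splits) (metis empty_iff list.set(1))
  moreover have "(\<Union>i. links (if i = n then [w] else vs i)) = (\<Union>i. links (vs i))"
    using R(3)[of n] by (auto split: if_splits) (metis empty_iff links.simps(2))
  ultimately show ?thesis
    unfolding represents_def enqueue_def
    using w n R assms(3) hdw by (auto simp: fun_upd_def hd hd')
qed

text \<open>The new call is put in front of \<open>v\<close>, and the one new wait edge is the link
  by which the chain grows.\<close>

lemma represents_fork:
  assumes "represents vs G \<theta> ps n" "w \<notin> vertices G" "b \<in> blocks A" "i \<notin> set ps" "vs i = v # us"
    and H: "H = enqueue A q\<^sub>0 b [w] G"
  shows "represents (vs(i := w # vs i)) (H\<lparr>waits := waits H \<union> {v} \<times> {w}\<rparr>)
    (\<theta>(i := (b, lts_init (block_lts A b)) # \<theta> i)) (ps @ [i]) n"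
proof -
  note R = representsD[OF assms(1)]
  have w: "w \<notin> set (vs i)" for i using assms(2) by (auto simp: represents_vertices[OF assms(1)])
  have hd: "map (\<lambda>j. hd (if j = i then w # vs i else vs j)) ps = map (\<lambda>i. hd (vs i)) ps"
    using assms(4) by auto
  have hd': "(\<lambda>j. hd (if j = i then w # vs i else vs j)) ` set ps = (\<lambda>i. hd (vs i)) ` set ps"
    using assms(4) by auto
  have hdw: "hd (vs i) \<noteq> w" if "i \<in> set ps" for i using w[of i] R(6)[OF that] by (metis list.set_sel(1))
  have n: "i < n" using R(3)[of i] assms(5) by (cases "i < n") auto
  have "map (\<lambda>v. (if v = w then b else vblock G v, if v = w then lts_init (block_lts A b) else vstate G v)) (vs i)
      = \<theta> i" for i
    using w by (auto intro!: trans[OF _ R(1)])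
  moreover have "(\<Union>j. set (if j = i then w # vs i else vs j)) = insert w (\<Union>i. set (vs i))"
    by (auto split: if_splits)
  moreover have "links (w # vs i) = insert (v, w) (links (vs i))" using assms(5) by simp
  then have "(\<Union>j. links (if j = i then w # vs i else vs j)) = insert (v, w) (\<Union>i. links (vs i))"
    by (auto split: if_splits)
  ultimately show ?thesis
    unfolding represents_def enqueue_def H
    using w n R assms(3,4) hdw by (auto simp: fun_upd_def hd hd')
qed

text \<open>As \<open>v\<close> stands at the front of its list, the edges removed with it are
  exactly the links that the shorter list loses.\<close>

lemma represents_finish:
  assumes "represents vs G \<theta> ps n" "i \<notin> set ps" "vs i = v # us"
  shows "represents (vs(i := us)) (G\<lparr>tasks := tasks G - {v}, waits := waits G - UNIV \<times> {v}\<rparr>)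
    (\<theta>(i := tl (\<theta> i))) ps n"
proof -
  note R = representsD[OF assms(1)]
  have v: "v \<in> set (vs i)" using assms(3) by simp
  have only: "v \<notin> set (vs j)" if "j \<noteq> i" for j using R(5)[OF v] that by blast
  have us: "v \<notin> set us" "distinct us" using R(4)[of i] assms(3) by auto
  have hd': "(\<lambda>j. hd (if j = i then us else vs j)) ` set ps = (\<lambda>i. hd (vs i)) ` set ps"
    using assms(2) by auto
  have sub: "set us \<subseteq> set (vs i)" using assms(3) by auto
  have "(\<Union>j. set (if j = i then us else vs j)) = (\<Union>i. set (vs i)) - {v}"
    using only us assms(3) by (auto split: if_splits) (metis set_ConsD)
  then have "tasks G - {v} = (\<Union>j. set (if j = i then us else vs j)) - (\<lambda>i. hd (vs i)) ` set ps"
    unfolding R(8) by blast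
  moreover have "(\<Union>j. links (if j = i then us else vs j)) = (\<Union>i. links (vs i)) - UNIV \<times> {v}"
  proof -
    have "links (if j = i then us else vs j) = links (vs j) - UNIV \<times> {v}" for j
      using links_tl[of v us] R(4)[of i] assms(3) only[of j] links_subset[of "vs j"] by auto
    then show ?thesis by auto
  qed
  moreover have "map (\<lambda>v. (vblock G v, vstate G v)) us = tl (\<theta> i)"
    using R(1)[of i, symmetric] assms(3) by simp
  moreover have "n \<le> i \<longrightarrow> us = []" using R(3)[of i] assms(3) by auto
  moreover have "set (if j = i then us else vs j) \<inter> set (if k = i then us else vs k) = {}"
    if "j \<noteq> k" for j k
    using R(5) that sub by (auto split: if_splits)
  moreover have "(if k = i then us else vs k) \<noteq> []" if "k \<in> set ps" for k
    using R(6) that assms(2) by auto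
  moreover have "vblock G u \<in> blocks A" if "u \<in> set (if k = i then us else vs k)" for u k
    using R(2)[of u k] that assms(3) by (auto split: if_splits)
  ultimately show ?thesis
    unfolding represents_def fun_upd_def
    by (intro conjI allI ballI impI, simp_all add: hd' us fun_upd_def R(1-4,7,9,10))
      (rule ext, use assms(2) in auto)
qed

lemma represents_serve:
  assumes "represents vs G \<theta> (i # ps) n" "v = hd (vs i)" "us = map (\<lambda>i. hd (vs i)) ps"
  shows "represents vs (G\<lparr>tasks := insert v (tasks G), queue := (queue G)(q\<^sub>0 := us)\<rparr>) \<theta> ps n"
proof -
  note R = representsD[OF assms(1)]
  have "hd (vs i) \<in> set (vs i)" using R(6)[of i] by simp
  moreover from this have "hd (vs i) \<noteq> hd (vs j)" if "j \<in> set ps" for j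
    using R(5)[of "hd (vs i)" i j] R(6)[of j] R(7) that by auto
  ultimately have "insert v (tasks G) = (\<Union>i. set (vs i)) - (\<lambda>i. hd (vs i)) ` set ps"
    unfolding R(8) assms(2) by auto
  then show ?thesis
    unfolding represents_def using R assms(3) by auto
qed

definition simulates :: "('d, 'x, 'q, 'b, 's) config \<Rightarrow> ('d, 'x, 'b, 's) stacks \<Rightarrow> bool" where
  "simulates = (\<lambda>(G, \<sigma>) (\<sigma>', \<theta>, ps, n). \<sigma> = \<sigma>' \<and> (\<exists>vs. represents vs G \<theta> ps n))"

section \<open>Bisimulation between configurations and stacks\<close>

lemma transition_action:
  assumes "b \<in> blocks A" "(s, a, s') \<in> lts_trans (block_lts A b)"
  shows "a \<in> actions A"
  using assms eqdas unfolding eqdas_def Let_def by blast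

text \<open>With the converse \<open>simulates_stack_step\<close>, the relation is a bisimulation.
  Since stacks carry no vertex names, uniqueness of stack steps becomes determinism of the system up
  to those names.\<close>

lemma simulates_step:
  assumes "simulates c a" "step A c c'"
  shows "\<exists>a'. stack_step A a a' \<and> simulates c' a'"
proof -
  obtain \<sigma> \<theta> ps n vs where a: "a = (\<sigma>, \<theta>, ps, n)" "snd c = \<sigma>" "represents vs (fst c) \<theta> ps n"
    using assms(1) unfolding simulates_def by (cases a) auto
  note R = representsD[OF a(3)]
  have en: "\<exists>i us b fs. i \<notin> set ps \<and> vs i = v # us \<and> \<theta> i = (b, vstate (fst c) v) # fs \<and>
      b = vblock (fst c) v \<and> b \<in> blocks A"
    if active: "v \<in> tasks (fst c)" "unblocked (fst c) v" for v
  proof -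
    obtain i us where i: "i \<notin> set ps" "vs i = v # us"
      using represents_active[OF a(3), of v] active by blast
    have "\<theta> i = (vblock (fst c) v, vstate (fst c) v) # map (\<lambda>v. (vblock (fst c) v, vstate (fst c) v)) us"
      using R(1)[of i] i(2) by simp
    then show ?thesis using i R(2)[of v i] by auto
  qed
  from assms(2) show ?thesis
  proof cases
    case (guard G v as s' \<sigma>')
    with en[of v] obtain i us b fs where i: "i \<notin> set ps" "vs i = v # us"
      "\<theta> i = (b, vstate G v) # fs" "b = vblock G v" by (auto simp: enabled_def)
    have "stack_step A a (perform A i (Guard as) s' a)"
      unfolding a using guard i a by (intro stack_step.act) (auto simp: enabled_def)
    then show ?thesis
      using guard a i represents_set_state[OF a(3) i(2), of s'] by (auto simp: simulates_def)
  next
    case (assign G v x d s' \<sigma>')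
    with en[of v] obtain i us b fs where i: "i \<notin> set ps" "vs i = v # us"
      "\<theta> i = (b, vstate G v) # fs" "b = vblock G v" by (auto simp: enabled_def)
    have "stack_step A a (perform A i (Assign x d) s' a)"
      unfolding a using assign i a by (intro stack_step.act) (auto simp: enabled_def)
    then show ?thesis
      using assign a i represents_set_state[OF a(3) i(2), of s'] by (auto simp: simulates_def)
  next
    case (dispatch G v q b' s' w \<sigma>')
    with en[of v] obtain i us b fs where i: "i \<notin> set ps" "vs i = v # us"
      "\<theta> i = (b, vstate G v) # fs" "b = vblock G v" "b \<in> blocks A" by (auto simp: enabled_def)
    have "q = q\<^sub>0" "b' \<in> blocks A"
      using transition_action[of b "vstate G v" "DispatchA q b'" s'] dispatch i cqid
      by (auto simp: enabled_def actions_def)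
    moreover have "w \<notin> vertices (set_state v s' G)"
      using dispatch by (auto simp: vertices_def calls_def set_state_def)
    moreover have "represents vs (set_state v s' G) (\<theta>(i := (fst (hd (\<theta> i)), s') # tl (\<theta> i))) ps n"
      using represents_set_state[OF a(3) i(2)] dispatch by simp
    ultimately have "simulates c' (perform A i (DispatchA q b') s' a)"
      using represents_dispatch dispatch a by (fastforce simp: simulates_def)
    moreover have "stack_step A a (perform A i (DispatchA q b') s' a)"
      unfolding a using dispatch i a by (intro stack_step.act) (auto simp: enabled_def)
    ultimately show ?thesis by blast
  next
    case (forkjoin G v q b' p s' ws H \<sigma>')
    with en[of v] obtain i us b fs where i: "i \<notin> set ps" "vs i = v # us"
      "\<theta> i = (b, vstate G v) # fs" "b = vblock G v" "b \<in> blocks A" by (auto simp: enabled_def)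
    have q: "q = q\<^sub>0" "b' \<in> blocks A"
      using transition_action[of b "vstate G v" "ForkJoin q b' p" s'] forkjoin i cqid
      by (auto simp: enabled_def actions_def)
    have "(vstate G v, ForkJoin q b' p, s') \<in> lts_trans (block_lts A b)"
      using forkjoin i(4) by (simp add: enabled_def)
    then have "p = Some 1" by (rule single_fork[OF i(5)])
    then obtain w where w: "ws = [w]" using forkjoin by (cases ws) auto
    then have "w \<notin> vertices (set_state v s' G)"
      using forkjoin by (auto simp: vertices_def calls_def set_state_def)
    from represents_fork[OF represents_set_state[OF a(3) i(2), of s'] _ q(2) i(1,2) refl, of w] this
    have "simulates c' (perform A i (ForkJoin q b' p) s' a)"
      using forkjoin a q w by (auto simp: simulates_def)
    moreover have "stack_step A a (perform A i (ForkJoin q b' p) s' a)"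
      unfolding a using forkjoin i a by (intro stack_step.act) (auto simp: enabled_def)
    ultimately show ?thesis by blast
  next
    case (finish v G \<sigma>')
    with en[of v] obtain i us b fs where i: "i \<notin> set ps" "vs i = v # us"
      "\<theta> i = (b, vstate G v) # fs" "b = vblock G v" by auto
    have "stack_step A a (\<sigma>, \<theta>(i := fs), ps, n)"
      unfolding a using finish i by (intro stack_step.finish) auto
    then show ?thesis
      using finish a i represents_finish[OF a(3) i(1,2)] by (auto simp: simulates_def)
  next
    case (serve q G v us \<sigma>')
    then have q: "q = q\<^sub>0" using cqid by simp
    then obtain i ps' where ps: "ps = i # ps'" "v = hd (vs i)" "us = map (\<lambda>i. hd (vs i)) ps'"
      using serve R(9) by auto
    then have "stack_step A a (\<sigma>, \<theta>, ps', n)" unfolding a by (auto intro: stack_step.serve)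
    then show ?thesis
      using serve a ps q represents_serve[of vs "fst c" \<theta> i ps' n v us] by (auto simp: simulates_def)
  qed
qed

lemma simulates_stack_step:
  assumes "simulates c a" "stack_step A a a'"
  shows "\<exists>c'. step A c c' \<and> simulates c' a'"
proof -
  obtain G \<sigma> where c: "c = (G, \<sigma>)" by fastforce
  from assms(2) show ?thesis
  proof cases
    case (act i ps \<theta> b s fs e s' \<sigma>' n)
    then obtain vs where rep: "represents vs G \<theta> ps n" and \<sigma>: "\<sigma>' = \<sigma>"
      using assms(1) by (auto simp: simulates_def c)
    note R = representsD[OF rep]
    obtain v us where v: "vs i = v # us" "b = vblock G v" "s = vstate G v"
      using R(1)[of i] act by (cases "vs i") auto
    then have b: "b \<in> blocks A" using R(2)[of v i] by simp
    have en: "enabled A G v e s'"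
      using represents_active[OF rep, of v] v act by (auto simp: enabled_def)
    note rep' = represents_set_state[OF rep v(1), of s']
    \<comment> \<open>Only finitely many chains are nonempty, so there is a fresh vertex in case the
      action creates one.\<close>
    have "finite (\<Union>i. set (vs i))"
    proof (rule finite_subset)
      show "(\<Union>i. set (vs i)) \<subseteq> (\<Union>i<n. set (vs i))"
        using R(3) by (auto simp: not_less[symmetric]) (metis empty_iff empty_set leI lessThan_iff)
    qed auto
    then obtain w where w: "w \<notin> vertices G"
      using ex_new_if_finite[OF infinite_UNIV_nat] represents_vertices[OF rep] by metis
    then have w': "w \<notin> vertices (set_state v s' G)"
      by (auto simp: vertices_def calls_def set_state_def)
    have e: "e \<in> actions A" using transition_action b act by blast
    show ?thesis
    proof (cases e)
      case (Guard as)
      then have "step A c (set_state v s' G, \<sigma>)"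
        unfolding c using act en \<sigma> by (intro step.guard) auto
      then show ?thesis using act Guard rep' \<sigma> by (auto simp: simulates_def)
    next
      case (Assign x d)
      then have "step A c (set_state v s' G, \<sigma>(x := d))"
        unfolding c using en by (intro step.assign) auto
      then show ?thesis using act Assign rep' \<sigma> by (auto simp: simulates_def)
    next
      case (DispatchA q b')
      then have q: "q = q\<^sub>0" "b' \<in> blocks A" using e cqid by (auto simp: actions_def)
      have "step A c (enqueue A q b' [w] (set_state v s' G), \<sigma>)"
        unfolding c using en w DispatchA by (intro step.dispatch) auto
      then show ?thesis
        using act DispatchA represents_dispatch[OF rep' w' q(2)] \<sigma> q by (auto simp: simulates_def)
    next
      case (ForkJoin q b' p)
      then have q: "q = q\<^sub>0" "b' \<in> blocks A" using e cqid by (auto simp: actions_def)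
      have "p = Some 1" using single_fork[OF b] act ForkJoin by blast
      let ?H = "enqueue A q b' [w] (set_state v s' G)"
      have "step A c (?H\<lparr>waits := waits ?H \<union> {v} \<times> set [w]\<rparr>, \<sigma>)"
        unfolding c using en w ForkJoin \<open>p = Some 1\<close> by (intro step.forkjoin) auto
      then show ?thesis
        using act ForkJoin represents_fork[OF rep' w' q(2) _ v(1) refl] \<sigma> q
        by (auto simp: simulates_def)
    qed
  next
    case (finish i ps \<theta> b fs \<sigma>' n)
    then obtain vs where rep: "represents vs G \<theta> ps n" and \<sigma>: "\<sigma>' = \<sigma>"
      using assms(1) by (auto simp: simulates_def c)
    note R = representsD[OF rep]
    obtain v us where v: "vs i = v # us" "b = vblock G v" "lts_final (block_lts A b) = vstate G v"
      using R(1)[of i] finish by (cases "vs i") auto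
    have "step A c (G\<lparr>tasks := tasks G - {v}, waits := waits G - UNIV \<times> {v}\<rparr>, \<sigma>)"
      unfolding c using represents_active[OF rep, of v] v finish by (intro step.finish) auto
    then show ?thesis
      using finish \<sigma> represents_finish[OF rep _ v(1)] by (auto simp: simulates_def)
  next
    case (serve \<sigma>' \<theta> i ps n)
    then obtain vs where rep: "represents vs G \<theta> (i # ps) n" and \<sigma>: "\<sigma>' = \<sigma>"
      using assms(1) by (auto simp: simulates_def c)
    have "step A c (G\<lparr>tasks := insert (hd (vs i)) (tasks G),
        queue := (queue G)(q\<^sub>0 := map (\<lambda>i. hd (vs i)) ps)\<rparr>, \<sigma>)"
      unfolding c using representsD(9)[OF rep] cqid by (intro step.serve) auto
    then show ?thesis
      using serve \<sigma> represents_serve[OF rep refl refl] by (auto simp: simulates_def)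
  qed
qed

lemma simulates_initial: "simulates (initial_config A) (initial_stacks A)"
proof -
  have "represents ((\<lambda>_. [])(0 := [0])) (fst (initial_config A)) (fst (snd (initial_stacks A))) [] 1"
    using eqdas unfolding represents_def initial_config_def initial_stacks_def
    by (auto simp: eqdas_def split: if_splits)
  then show ?thesis by (auto simp: simulates_def initial_config_def initial_stacks_def)
qed

lemma simulates_parikh:
  assumes "simulates (G, \<sigma>) (\<sigma>', \<theta>, ps, n)"
  shows "parikh G s \<ge> 1 \<longleftrightarrow> (\<exists>i. s \<in> snd ` set (\<theta> i))"
proof -
  obtain vs where rep: "represents vs G \<theta> ps n" using assms by (auto simp: simulates_def)
  note R = representsD[OF rep]
  have "finite (\<Union>i. set (vs i))"
  proof (rule finite_subset)
    show "(\<Union>i. set (vs i)) \<subseteq> (\<Union>i<n. set (vs i))"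
      using R(3) by (auto simp: not_less[symmetric]) (metis empty_iff empty_set leI lessThan_iff)
  qed auto
  then have "finite {v \<in> vertices G. vstate G v = s}"
    by (auto simp: represents_vertices[OF rep] intro: rev_finite_subset)
  then have "parikh G s \<ge> 1 \<longleftrightarrow> {v \<in> vertices G. vstate G v = s} \<noteq> {}"
    unfolding parikh_def Suc_le_eq One_nat_def card_gt_0_iff by blast
  also have "\<dots> \<longleftrightarrow> (\<exists>i. \<exists>v\<in>set (vs i). vstate G v = s)"
    by (auto simp: represents_vertices[OF rep])
  also have "\<dots> \<longleftrightarrow> (\<exists>i. s \<in> snd ` set (\<theta> i))"
    unfolding R(1)[symmetric] by force
  finally show ?thesis .
qed

end

section \<open>The simulating system\<close>

definition forced :: "('d, 'x, 'q, 'b, 's) eqdas \<Rightarrow> ('d, 'x, 'b, 's) stacks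
    \<Rightarrow> ('d, 'x, 'b, 's) stacks \<Rightarrow> bool" where
  "forced A c d \<longleftrightarrow> (\<forall>c'. stack_step A c c' \<longleftrightarrow> c' = d)"

fun quiet :: "('d, 'x, 'q, 'b, 's) eqdas \<Rightarrow> ('x \<Rightarrow> 'd) \<Rightarrow> ('b \<times> 's) list \<Rightarrow> bool" where
  "quiet A \<sigma> [] \<longleftrightarrow> True"
| "quiet A \<sigma> ((b, s) # fs) \<longleftrightarrow> s \<noteq> lts_final (block_lts A b) \<and>
     (\<forall>a s'. (s, a, s') \<in> lts_trans (block_lts A b) \<longrightarrow> \<not> executable \<sigma> a)"

lemma forced_act:
  assumes "\<theta> i = (b, s) # fs" "(s, a, s') \<in> lts_trans (block_lts A b)" "executable \<sigma> a"
    and uniq: "\<And>a' t. (s, a', t) \<in> lts_trans (block_lts A b) \<Longrightarrow> executable \<sigma> a' \<Longrightarrow> a' = a \<and> t = s'"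
    and "s \<noteq> lts_final (block_lts A b)" and quiet: "\<And>j. j \<noteq> i \<Longrightarrow> quiet A \<sigma> (\<theta> j)"
  shows "forced A (\<sigma>, \<theta>, [], n) (perform A i a s' (\<sigma>, \<theta>, [], n))"
  unfolding forced_def
proof (intro allI iffI)
  fix c' assume "stack_step A (\<sigma>, \<theta>, [], n) c'"
  then show "c' = perform A i a s' (\<sigma>, \<theta>, [], n)"
  proof cases
    case (act j b' t fs' a' t')
    have "j = i" using quiet[of j] act by (cases "j = i") auto
    with act assms(1) have "b' = b" "t = s" by auto
    with act have "a' = a \<and> t' = s'" by (intro uniq) auto
    with act \<open>j = i\<close> show ?thesis by simp
  next
    case (finish j b' fs')
    then show ?thesis using quiet[of j] assms(1,5) by (cases "j = i") auto
  qed
next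
  have "stack_step A (\<sigma>, \<theta>, [], n) (perform A i a s' (\<sigma>, \<theta>, [], n))"
    by (rule stack_step.act[of i "[]" \<theta> b s fs, OF _ assms(1-3)]) simp
  then show "stack_step A (\<sigma>, \<theta>, [], n) c'" if "c' = perform A i a s' (\<sigma>, \<theta>, [], n)" for c'
    using that by (simp only:)
qed

lemma forced_finish:
  assumes "\<theta> i = (b, lts_final (block_lts A b)) # fs"
    and "\<And>a t. (lts_final (block_lts A b), a, t) \<in> lts_trans (block_lts A b) \<Longrightarrow> \<not> executable \<sigma> a"
    and quiet: "\<And>j. j \<noteq> i \<Longrightarrow> quiet A \<sigma> (\<theta> j)"
  shows "forced A (\<sigma>, \<theta>, [], n) (\<sigma>, \<theta>(i := fs), [], n)"
  unfolding forced_def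
proof (intro allI iffI)
  fix c' assume "stack_step A (\<sigma>, \<theta>, [], n) c'"
  then show "c' = (\<sigma>, \<theta>(i := fs), [], n)"
  proof cases
    case (act j b' t fs' a' t')
    then show ?thesis using quiet[of j] assms(1,2) by (cases "j = i") auto
  next
    case (finish j b' fs')
    then show ?thesis using quiet[of j] assms(1) by (cases "j = i") auto
  qed
qed (use assms in \<open>auto intro: stack_step.finish\<close>)

text \<open>Chain \<open>i\<close> needs no assumption: its front vertex is still a call and cannot
  act.\<close>

lemma forced_serve:
  assumes quiet: "\<And>j. j \<noteq> i \<Longrightarrow> quiet A \<sigma> (\<theta> j)"
  shows "forced A (\<sigma>, \<theta>, [i], n) (\<sigma>, \<theta>, [], n)"
  unfolding forced_def
proof (intro allI iffI)
  fix c' assume "stack_step A (\<sigma>, \<theta>, [i], n) c'"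
  then show "c' = (\<sigma>, \<theta>, [], n)"
  proof cases
    case (act j b' t fs' a' t')
    then show ?thesis using quiet[of j] by auto
  next
    case (finish j b' fs')
    then show ?thesis using quiet[of j] by auto
  qed
qed (auto intro: stack_step.serve)

lemma quiet_stuck:
  assumes "\<And>j. quiet A \<sigma> (\<theta> j)"
  shows "\<not> stack_step A (\<sigma>, \<theta>, [], n) c'"
proof
  assume "stack_step A (\<sigma>, \<theta>, [], n) c'"
  then show False
  proof cases
    case (act j b' t fs' a' t')
    then show ?thesis using assms[of j] by auto
  next
    case (finish j b' fs')
    then show ?thesis using assms[of j] by auto
  qed
qed

section \<open>Codes of values, states and transitions\<close>

instance com :: countable by countable_datatype

datatype val = Idle | Ack | IsZero | NewV nat | IncV nat | DecV nat | RetV nat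

text \<open>\<open>Idle\<close> gets the code 0, which is the initial value of the variable; it
  makes the first worker the controller. \<open>NewV\<close>, \<open>IncV\<close> and
  \<open>DecV\<close> are requests, \<open>Ack\<close> and \<open>IsZero\<close> answers, and
  \<open>RetV\<close> passes between neighbours of a chain.\<close>

fun vcode :: "val \<Rightarrow> nat" where
  "vcode Idle = prod_encode (0, 0)"
| "vcode Ack = prod_encode (1, 0)"
| "vcode IsZero = prod_encode (2, 0)"
| "vcode (NewV r) = prod_encode (3, r)"
| "vcode (IncV r) = prod_encode (4, r)"
| "vcode (DecV r) = prod_encode (5, r)"
| "vcode (RetV r) = prod_encode (6, r)"

lemma vcode_inject [simp]: "vcode v = vcode w \<longleftrightarrow> v = w"
  by (cases v; cases w) auto

datatype ctl = Setup nat | Pre nat | Entry | Run "com list"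

text \<open>The code of \<open>Pre i\<close> must be recursive in \<open>i\<close>, hence the
  explicit pairing. \<open>Run K\<close> may use an arbitrary injection, because these states enter
  the code of a system only through the given number \<open>program_code k p\<close> and the
  constant code of \<open>Run []\<close>.\<close>

fun ccode :: "ctl \<Rightarrow> nat" where
  "ccode (Setup r) = prod_encode (0, r)"
| "ccode (Pre i) = prod_encode (1, i)"
| "ccode Entry = prod_encode (2, 0)"
| "ccode (Run K) = prod_encode (3, to_nat K)"

lemma ccode_inject [simp]: "ccode c = ccode d \<longleftrightarrow> c = d"
  by (cases c; cases d) auto

datatype lst = Start | Fin | Ctl ctl | Wait ctl | Disp ctl
  | Reg bool nat | Push bool nat | Dec bool nat | Back bool nat | Born bool nat

text \<open>The offset 4 reserves 0 to 3 for the main block, whose states must be disjoint from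
  those of the worker.\<close>

fun scode :: "lst \<Rightarrow> nat" where
  "scode Start = 4 + prod_encode (0, 0)"
| "scode Fin = 4 + prod_encode (1, 0)"
| "scode (Ctl c) = 4 + prod_encode (2, ccode c)"
| "scode (Wait c) = 4 + prod_encode (3, ccode c)"
| "scode (Disp c) = 4 + prod_encode (4, ccode c)"
| "scode (Reg b r) = 4 + prod_encode (5, prod_encode (of_bool b, r))"
| "scode (Push b r) = 4 + prod_encode (6, prod_encode (of_bool b, r))"
| "scode (Dec b r) = 4 + prod_encode (7, prod_encode (of_bool b, r))"
| "scode (Back b r) = 4 + prod_encode (8, prod_encode (of_bool b, r))"
| "scode (Born b r) = 4 + prod_encode (9, prod_encode (of_bool b, r))"

lemma scode_inject [simp]: "scode s = scode t \<longleftrightarrow> s = t"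
  by (cases s; cases t) auto

declare vcode.simps [simp del] ccode.simps [simp del] scode.simps [simp del]

lemma scode_ge: "4 \<le> scode s"
  by (cases s) (auto simp: scode.simps)

datatype op = Is val | Nop | Put val | Fork | Spawn

fun act :: "op \<Rightarrow> (nat, nat, nat, nat) action" where
  "act (Is v) = Guard [Eq 0 (vcode v)]"
| "act Nop = Guard []"
| "act (Put v) = Assign 0 (vcode v)"
| "act Fork = ForkJoin 0 1 (Some 1)"
| "act Spawn = DispatchA 0 1"

lemma act_inject [simp]: "act a = act b \<longleftrightarrow> a = b"
  by (cases a; cases b) auto

type_synonym trans = "lst \<times> op \<times> lst"

definition trans_nat :: "trans \<Rightarrow> nat \<times> (nat, nat, nat, nat) action \<times> nat" where
  "trans_nat = (\<lambda>(s, a, t). (scode s, act a, scode t))"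

lemma inj_trans_nat: "inj trans_nat"
  by (auto simp: inj_def trans_nat_def)

text \<open>After its only dispatch the main task rests in state 1, which has no transition and is
  not final. It neither acts nor ends from then on.\<close>

definition main_lts :: nat_lts where
  "main_lts = \<lparr>lts_states = {0..<4}, lts_init = 0, lts_final = 3, lts_trans = {(0, DispatchA 0 1, 1)}\<rparr>"

text \<open>An interval of states has a code that is computable from its end \<open>N\<close>,
  without inspecting \<open>T\<close>.\<close>

definition worker_lts :: "trans set \<Rightarrow> nat \<Rightarrow> nat_lts" where
  "worker_lts T N = \<lparr>lts_states = {4..<N}, lts_init = scode Start, lts_final = scode Fin,
     lts_trans = trans_nat ` T\<rparr>"

definition system :: "trans set \<Rightarrow> nat \<Rightarrow> nat_eqdas" where
  "system T N = \<lparr>domain = {..<N}, dinit = 0, vars = {0}, cqid = {0}, blocks = {0, 1},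
     main_block = 0, block_lts = (\<lambda>b\<in>{0, 1}. if b = 0 then main_lts else worker_lts T N)\<rparr>"

fun op_val :: "op \<Rightarrow> nat" where
  "op_val (Is v) = vcode v"
| "op_val (Put v) = vcode v"
| "op_val _ = 0"

definition bounded_by :: "nat \<Rightarrow> trans set \<Rightarrow> bool" where
  "bounded_by N T \<longleftrightarrow> (\<forall>(s, a, t)\<in>T. scode s < N \<and> scode t < N \<and> op_val a < N)"

lemma eqdas_system:
  assumes "finite T" "bounded_by N T" "scode Start < N" "scode Fin < N"
  shows "eqdas (system T N)"
proof -
  have "act a \<in> actions (system T N)" if "(s, a, t) \<in> T" for s a t
    using that assms(2,3) by (cases a) (auto simp: actions_def system_def bounded_by_def)
  then have "trans_nat ` T \<subseteq> {4..<N} \<times> actions (system T N) \<times> {4..<N}"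
    using assms(2) scode_ge by (fastforce simp: trans_nat_def bounded_by_def)
  moreover have "DispatchA 0 1 \<in> actions (system T N)" by (simp add: actions_def system_def)
  ultimately show ?thesis
    using assms scode_ge
    by (auto simp: eqdas_def system_def main_lts_def worker_lts_def disjoint_family_on_def Let_def)
qed

lemma chain_system_system:
  assumes "finite T" "bounded_by N T" "scode Start < N" "scode Fin < N"
  shows "chain_system (system T N) 0"
proof
  show "eqdas (system T N)" using assms by (rule eqdas_system)
  show "cqid (system T N) = {0}" by (simp add: system_def)
  fix b s q b' p s'
  assume "b \<in> blocks (system T N)" "(s, ForkJoin q b' p, s') \<in> lts_trans (block_lts (system T N) b)"
  moreover have "act a = ForkJoin q b' p \<Longrightarrow> p = Some 1" for a by (cases a) auto
  ultimately show "p = Some 1"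
    by (auto simp: system_def main_lts_def worker_lts_def trans_nat_def split: if_splits)
qed

text \<open>
  A chain is the stack of local states of a thread: chain 0 is the main block, chain 1 the
  controller, and chain \<open>r + 2\<close> with \<open>m + 1\<close> vertices is register \<open>r\<close> with contents \<open>m\<close>.
\<close>

type_synonym conf = "val \<times> (nat \<Rightarrow> lst list) \<times> nat list \<times> nat"

text \<open>Chain 0 is the main task after its dispatch, frozen in state 1. The valuation is
  \<open>undefined\<close> off the only variable because the initial valuation is a restricted
  function.\<close>

fun stacks_of :: "conf \<Rightarrow> (nat, nat, nat, nat) stacks" where
  "stacks_of (v, R, ps, n) = ((\<lambda>_. undefined)(0 := vcode v),
     (\<lambda>i. map (\<lambda>s. (1, scode s)) (R i))(0 := [(0, 1)]), ps, n)"

fun able :: "val \<Rightarrow> op \<Rightarrow> bool" where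
  "able v (Is w) \<longleftrightarrow> v = w"
| "able v _ \<longleftrightarrow> True"

fun calm :: "trans set \<Rightarrow> val \<Rightarrow> lst list \<Rightarrow> bool" where
  "calm T v [] \<longleftrightarrow> True"
| "calm T v (s # ss) \<longleftrightarrow> s \<noteq> Fin \<and> (\<forall>a t. (s, a, t) \<in> T \<longrightarrow> \<not> able v a)"

definition halted :: "conf \<Rightarrow> bool" where
  "halted = (\<lambda>(v, R, ps, n). \<exists>i>0. Ctl (Run []) \<in> set (R i))"

text \<open>Excluding halted sources lets a path witness two things at once: each step is the only
  one possible, and the halting state is not covered on the way.\<close>

definition next_conf :: "trans set \<Rightarrow> nat \<Rightarrow> conf \<Rightarrow> conf \<Rightarrow> bool" where
  "next_conf T N c d \<longleftrightarrow> forced (system T N) (stacks_of c) (stacks_of d) \<and> \<not> halted c"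

lemma executable_act: "executable ((\<lambda>_. undefined)(0 := vcode v)) (act a) \<longleftrightarrow> able v a"
  by (cases a) auto

lemma system_simps [simp]:
  "block_lts (system T N) 0 = main_lts" "block_lts (system T N) (Suc 0) = worker_lts T N"
  "lts_final (worker_lts T N) = scode Fin" "lts_init (worker_lts T N) = scode Start"
  by (simp_all add: system_def worker_lts_def)

lemma worker_trans_iff:
  "(scode s, a, t) \<in> lts_trans (worker_lts T N) \<longleftrightarrow> (\<exists>a' t'. (s, a', t') \<in> T \<and> a = act a' \<and> t = scode t')"
  by (force simp: worker_lts_def trans_nat_def image_iff)

lemma quiet_calm:
  "quiet (system T N) ((\<lambda>_. undefined)(0 := vcode v)) (map (\<lambda>s. (1, scode s)) ss) \<longleftrightarrow> calm T v ss"
proof (cases ss)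
  case (Cons s ss')
  have "(\<forall>a t. (scode s, a, t) \<in> lts_trans (worker_lts T N) \<longrightarrow> \<not> executable ((\<lambda>_. undefined)(0 := vcode v)) a)
      \<longleftrightarrow> (\<forall>a t. (s, a, t) \<in> T \<longrightarrow> \<not> able v a)"
    using executable_act[of v] worker_trans_iff by metis
  then show ?thesis by (simp add: Cons)
qed simp

lemma quiet_main: "quiet (system T N) \<sigma> [(0, 1)]"
  by (simp add: main_lts_def)

lemma quiet_others:
  fixes R :: "nat \<Rightarrow> lst list"
  assumes "\<And>j. j \<noteq> i \<Longrightarrow> j > 0 \<Longrightarrow> calm T v (R j)" "j \<noteq> i"
  shows "quiet (system T N) ((\<lambda>_. undefined)(0 := vcode v)) (((\<lambda>i. map (\<lambda>s. (1, scode s)) (R i))(0 := [(0, 1)])) j)"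
proof (cases "j = 0")
  case True
  then show ?thesis using quiet_main[of T N] by (simp del: quiet.simps)
next
  case False
  then show ?thesis using quiet_calm[of T N v "R j"] assms(1)[of j] assms(2) by (simp del: quiet.simps)
qed

lemma next_act:
  assumes i: "i > 0" "R i = s # ss" and a: "(s, a, t) \<in> T" "able v a"
    and uniq: "\<And>a' t'. (s, a', t') \<in> T \<Longrightarrow> able v a' \<Longrightarrow> a' = a \<and> t' = t"
    and s: "s \<noteq> Fin" and calm: "\<And>j. j \<noteq> i \<Longrightarrow> j > 0 \<Longrightarrow> calm T v (R j)"
    and "n > 0" "\<not> halted (v, R, [], n)"
  shows "next_conf T N (v, R, [], n)
    (case a of
       Put w \<Rightarrow> (w, R(i := t # ss), [], n)
     | Fork \<Rightarrow> (v, R(i := Start # t # ss), [i], n)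
     | Spawn \<Rightarrow> (v, R(i := t # ss, n := [Start]), [n], Suc n)
     | _ \<Rightarrow> (v, R(i := t # ss), [], n))" (is "next_conf T N _ ?c")
proof -
  let ?\<sigma> = "(\<lambda>_. undefined)(0 := vcode v)"
  let ?\<theta> = "(\<lambda>i. map (\<lambda>s. (1, scode s)) (R i))(0 := [(0, 1)])"
  have "forced (system T N) (?\<sigma>, ?\<theta>, [], n) (perform (system T N) i (act a) (scode t) (?\<sigma>, ?\<theta>, [], n))"
  proof (rule forced_act)
    show "?\<theta> i = (1, scode s) # map (\<lambda>s. (1, scode s)) ss" using i by simp
    show "(scode s, act a, scode t) \<in> lts_trans (block_lts (system T N) 1)"
      using a by (auto simp: worker_trans_iff)
    show "executable ?\<sigma> (act a)" using a by (simp only: executable_act)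
    show "scode s \<noteq> lts_final (block_lts (system T N) 1)" using s by simp
    fix a' t' assume "(scode s, a', t') \<in> lts_trans (block_lts (system T N) 1)" "executable ?\<sigma> a'"
    then show "a' = act a \<and> t' = scode t"
      using uniq by (auto simp: worker_trans_iff executable_act simp del: fun_upd_apply)
  next
    fix j assume "j \<noteq> i"
    then show "quiet (system T N) ?\<sigma> (?\<theta> j)" using calm by (intro quiet_others) auto
  qed
  moreover have "perform (system T N) i (act a) (scode t) (?\<sigma>, ?\<theta>, [], n) = stacks_of ?c"
    using i assms(8) by (cases a) (auto simp: fun_eq_iff)
  ultimately show ?thesis using assms(9) by (simp add: next_conf_def)
qed

lemma next_finish:
  assumes i: "i > 0" "R i = Fin # ss" and "\<And>a t. (Fin, a, t) \<notin> T"
    and calm: "\<And>j. j \<noteq> i \<Longrightarrow> j > 0 \<Longrightarrow> calm T v (R j)" and "\<not> halted (v, R, [], n)"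
  shows "next_conf T N (v, R, [], n) (v, R(i := ss), [], n)"
proof -
  let ?\<sigma> = "(\<lambda>_. undefined)(0 := vcode v)"
  let ?\<theta> = "(\<lambda>i. map (\<lambda>s. (1, scode s)) (R i))(0 := [(0, 1)])"
  have "forced (system T N) (?\<sigma>, ?\<theta>, [], n) (?\<sigma>, ?\<theta>(i := map (\<lambda>s. (1, scode s)) ss), [], n)"
  proof (rule forced_finish)
    show "?\<theta> i = (1, lts_final (block_lts (system T N) 1)) # map (\<lambda>s. (1, scode s)) ss"
      using i by simp
    fix a t assume "(lts_final (block_lts (system T N) 1), a, t) \<in> lts_trans (block_lts (system T N) 1)"
    then show "\<not> executable ?\<sigma> a" using assms(3) by (auto simp: worker_trans_iff)
  next
    fix j assume "j \<noteq> i"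
    then show "quiet (system T N) ?\<sigma> (?\<theta> j)" using calm by (intro quiet_others) auto
  qed
  moreover have "(?\<sigma>, ?\<theta>(i := map (\<lambda>s. (1, scode s)) ss), [], n) = stacks_of (v, R(i := ss), [], n)"
    using i by (auto simp: fun_eq_iff)
  ultimately show ?thesis using assms(5) by (simp add: next_conf_def)
qed

lemma next_serve:
  assumes "\<And>j. j \<noteq> i \<Longrightarrow> j > 0 \<Longrightarrow> calm T v (R j)" "\<not> halted (v, R, [i], n)"
  shows "next_conf T N (v, R, [i], n) (v, R, [], n)"
  unfolding next_conf_def stacks_of.simps
  using assms by (intro conjI forced_serve quiet_others) auto

text \<open>
  The controller writes a request into the only variable and waits for the answer of the last
  vertex of the chain concerned; \<open>Reg True r\<close> is the state of the base of chain \<open>r\<close>. A vertex that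
  terminates must not answer before it is gone; it writes \<open>RetV r\<close> instead, and the answer comes
  from the vertex below it.
\<close>

definition reg_trans :: "nat \<Rightarrow> trans set" where
  "reg_trans r = (\<Union>b.
     {(Start, Is (if b then NewV r else IncV r), Born b r), (Born b r, Put Ack, Reg b r),
      (Reg b r, Is (IncV r), Push b r), (Push b r, Fork, Reg b r),
      (Reg b r, Is (DecV r), Dec b r),
      (Dec b r, Put (if b then IsZero else RetV r), if b then Reg b r else Fin),
      (Reg b r, Is (RetV r), Back b r), (Back b r, Put Ack, Reg b r)})"

definition inc_trans :: "ctl \<Rightarrow> nat \<Rightarrow> ctl \<Rightarrow> trans set" where
  "inc_trans c r d = {(Ctl c, Put (IncV r), Wait c), (Wait c, Is Ack, Ctl d)}"

definition dec_trans :: "ctl \<Rightarrow> nat \<Rightarrow> ctl \<Rightarrow> ctl \<Rightarrow> trans set" where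
  "dec_trans c r d e =
     {(Ctl c, Put (DecV r), Wait c), (Wait c, Is Ack, Ctl d), (Wait c, Is IsZero, Ctl e)}"

text \<open>The request is written before the dispatch, so the new task finds \<open>NewV r\<close>
  when it starts and becomes a base.\<close>

definition new_trans :: "ctl \<Rightarrow> nat \<Rightarrow> ctl \<Rightarrow> trans set" where
  "new_trans c r d =
     {(Ctl c, Put (NewV r), Disp c), (Disp c, Spawn, Wait c), (Wait c, Is Ack, Ctl d)}"

definition jump_trans :: "ctl \<Rightarrow> ctl \<Rightarrow> trans set" where
  "jump_trans c d = {(Ctl c, Nop, Ctl d)}"

text \<open>The control points of a program are the lists of commands that remain to be executed.\<close>

fun conts :: "com \<Rightarrow> com list \<Rightarrow> com list set" where
  "conts Skip K = {Skip # K}"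
| "conts (Inc r) K = {Inc r # K}"
| "conts (Seq c d) K = insert (Seq c d # K) (conts c (d # K) \<union> conts d K)"
| "conts (Loop r c) K = insert (Loop r c # K) (conts c (Loop r c # K))"

fun cont_trans :: "com list \<Rightarrow> trans set" where
  "cont_trans [] = {}"
| "cont_trans (Skip # K) = jump_trans (Run (Skip # K)) (Run K)"
| "cont_trans (Inc r # K) = inc_trans (Run (Inc r # K)) r (Run K)"
| "cont_trans (Seq c d # K) = jump_trans (Run (Seq c d # K)) (Run (c # d # K))"
| "cont_trans (Loop r c # K) =
     dec_trans (Run (Loop r c # K)) r (Run (c # Loop r c # K)) (Run K)"

fun regs_of :: "com \<Rightarrow> nat set" where
  "regs_of Skip = {}"
| "regs_of (Inc r) = {r}"
| "regs_of (Seq c d) = regs_of c \<union> regs_of d"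
| "regs_of (Loop r c) = insert r (regs_of c)"

definition program_trans :: "nat \<Rightarrow> com \<Rightarrow> trans set" where
  "program_trans k p = {(Start, Is Idle, Ctl (Setup 0))} \<union>
     (\<Union>r<k. reg_trans r \<union> new_trans (Setup r) r (Setup (Suc r))) \<union>
     jump_trans (Setup k) (Pre 0) \<union> jump_trans Entry (Run [p]) \<union> (\<Union>K\<in>conts p []. cont_trans K)"

text \<open>The only transitions that depend on the input: a row of \<open>x\<close> increments of
  register 0, fitted between the control points \<open>Pre 0\<close> and \<open>Entry\<close> of the
  fixed program part.\<close>

definition input_trans :: "nat \<Rightarrow> trans set" where
  "input_trans x = (\<Union>i<x. inc_trans (Pre i) 0 (Pre (Suc i))) \<union> jump_trans (Pre x) Entry"

lemma finite_regs_of: "finite (regs_of c)"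
  by (induction c) auto

lemma finite_conts: "finite (conts c K)"
  by (induction c arbitrary: K) auto

lemma finite_cont_trans: "finite (cont_trans K)"
  by (cases K rule: cont_trans.cases) (auto simp: jump_trans_def inc_trans_def dec_trans_def)

lemma finite_program_trans: "finite (program_trans k p)"
  by (auto simp: program_trans_def reg_trans_def new_trans_def jump_trans_def finite_conts finite_cont_trans)

lemma finite_input_trans: "finite (input_trans x)"
  by (auto simp: input_trans_def inc_trans_def jump_trans_def)

lemma cont_trans_source:
  "(s, a, t) \<in> cont_trans K \<Longrightarrow> s = Ctl (Run K) \<or> s = Wait (Run K) \<and> (a = Is Ack \<or> a = Is IsZero)"
  by (cases K rule: cont_trans.cases) (auto simp: jump_trans_def inc_trans_def dec_trans_def)

text \<open>Values to which no register reacts; the variable holds one of them whenever the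
  controller begins a command.\<close>

definition neutral :: "val \<Rightarrow> bool" where
  "neutral v \<longleftrightarrow> v \<in> {Idle, Ack, IsZero}"

lemma neutral_simps [simp]: "neutral Idle" "neutral Ack" "neutral IsZero"
  by (simp_all add: neutral_def)

locale machine =
  fixes k :: nat and p :: com and x N :: nat
begin

definition T :: "trans set" where
  "T = program_trans k p \<union> input_trans x"

lemmas T_defs = T_def program_trans_def input_trans_def reg_trans_def new_trans_def jump_trans_def
  inc_trans_def

section \<open>Outgoing transitions of each kind of state\<close>

lemma T_Fin: "(Fin, a, t) \<notin> T"
  by (auto simp: T_defs dest: cont_trans_source)

lemma T_Start: "(Start, a, t) \<in> T \<longleftrightarrow> a = Is Idle \<and> t = Ctl (Setup 0) \<or>
    (\<exists>r b. r < k \<and> a = Is (if b then NewV r else IncV r) \<and> t = Born b r)"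
  by (auto simp: T_defs dest: cont_trans_source)

lemma T_Born: "(Born b r, a, t) \<in> T \<longleftrightarrow> r < k \<and> a = Put Ack \<and> t = Reg b r"
  by (auto simp: T_defs dest: cont_trans_source)

lemma T_Reg: "(Reg b r, a, t) \<in> T \<longleftrightarrow> r < k \<and> (a = Is (IncV r) \<and> t = Push b r \<or>
    a = Is (DecV r) \<and> t = Dec b r \<or> a = Is (RetV r) \<and> t = Back b r)"
  by (auto simp: T_defs dest: cont_trans_source)

lemma T_Push: "(Push b r, a, t) \<in> T \<longleftrightarrow> r < k \<and> a = Fork \<and> t = Reg b r"
  by (auto simp: T_defs dest: cont_trans_source)

lemma T_Dec: "(Dec b r, a, t) \<in> T \<longleftrightarrow> r < k \<and> a = Put (if b then IsZero else RetV r) \<and>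
    t = (if b then Reg b r else Fin)"
  by (auto simp: T_defs dest: cont_trans_source)

lemma T_Back: "(Back b r, a, t) \<in> T \<longleftrightarrow> r < k \<and> a = Put Ack \<and> t = Reg b r"
  by (auto simp: T_defs dest: cont_trans_source)

lemma T_Wait: "(Wait c, a, t) \<in> T \<Longrightarrow> a = Is Ack \<or> a = Is IsZero"
  by (auto simp: T_defs dest: cont_trans_source)

lemma T_Setup:
  "(Ctl (Setup r), a, t) \<in> T \<longleftrightarrow> r < k \<and> a = Put (NewV r) \<and> t = Disp (Setup r) \<or>
     r = k \<and> a = Nop \<and> t = Ctl (Pre 0)"
  "(Disp (Setup r), a, t) \<in> T \<longleftrightarrow> r < k \<and> a = Spawn \<and> t = Wait (Setup r)"
  "(Wait (Setup r), a, t) \<in> T \<longleftrightarrow> r < k \<and> a = Is Ack \<and> t = Ctl (Setup (Suc r))"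
  by (auto simp: T_defs dest: cont_trans_source)

lemma T_Pre:
  "(Ctl (Pre i), a, t) \<in> T \<longleftrightarrow> i < x \<and> a = Put (IncV 0) \<and> t = Wait (Pre i) \<or>
     i = x \<and> a = Nop \<and> t = Ctl Entry"
  "(Wait (Pre i), a, t) \<in> T \<longleftrightarrow> i < x \<and> a = Is Ack \<and> t = Ctl (Pre (Suc i))"
  by (auto simp: T_defs dest: cont_trans_source)

lemma T_Entry: "(Ctl Entry, a, t) \<in> T \<longleftrightarrow> a = Nop \<and> t = Ctl (Run [p])"
  by (auto simp: T_defs dest: cont_trans_source)

lemma T_Run:
  "(Ctl (Run K), a, t) \<in> T \<longleftrightarrow> K \<in> conts p [] \<and> (Ctl (Run K), a, t) \<in> cont_trans K"
  "(Wait (Run K), a, t) \<in> T \<longleftrightarrow> K \<in> conts p [] \<and> (Wait (Run K), a, t) \<in> cont_trans K"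
  by (auto simp: T_defs dest: cont_trans_source)

section \<open>Single steps of the controller and of the register it addresses\<close>

lemma calm_Reg: "calm T v (Reg b r # us)" if "v \<notin> {IncV r, DecV r, RetV r}"
  using that by (auto simp: T_Reg)

lemma calm_Wait: "calm T v (Wait c # us)" if "v \<notin> {Ack, IsZero}"
  using that by (auto dest: T_Wait)

definition others_ok :: "nat \<Rightarrow> (nat \<Rightarrow> lst list) \<Rightarrow> bool" where
  "others_ok i R \<longleftrightarrow> (\<forall>j. j \<noteq> i \<longrightarrow> j > 1 \<longrightarrow>
     Ctl (Run []) \<notin> set (R j) \<and> (R j = [] \<or> (\<exists>b us. R j = Reg b (j - 2) # us)))"

text \<open>\<open>NewV r\<close> addresses no existing chain, since only a vertex in
  \<open>Start\<close> reacts to it.\<close>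

definition about :: "nat \<Rightarrow> val \<Rightarrow> bool" where
  "about i v \<longleftrightarrow> (\<forall>r. v \<in> {IncV r, DecV r, RetV r} \<longrightarrow> i = r + 2)"

lemma about_simps [simp]:
  "neutral v \<Longrightarrow> about i v" "about i (NewV r)" "about i Ack" "about i IsZero"
  "about (Suc (Suc r)) (IncV r)" "about (Suc (Suc r)) (DecV r)" "about (Suc (Suc r)) (RetV r)"
  by (auto simp: about_def neutral_def)

lemma calm_other:
  assumes "others_ok i R" "about i v" "j \<noteq> i" "j > 1"
  shows "calm T v (R j)"
proof -
  have "R j = [] \<or> (\<exists>b us. R j = Reg b (j - 2) # us)"
    using assms unfolding others_ok_def by blast
  moreover have "v \<notin> {IncV (j - 2), DecV (j - 2), RetV (j - 2)}"
  proof
    assume "v \<in> {IncV (j - 2), DecV (j - 2), RetV (j - 2)}"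
    then have "i = j - 2 + 2" using assms(2) unfolding about_def by blast
    then show False using assms(3,4) by simp
  qed
  ultimately show ?thesis using calm_Reg[of v "j - 2"] by (metis calm.simps(1))
qed

lemma not_halted:
  assumes "others_ok i R" "s \<noteq> Ctl (Run [])" "Ctl (Run []) \<notin> set X"
  shows "\<not> halted (v, R(i := X, 1 := [s]), ps, n)"
proof -
  have "Ctl (Run []) \<notin> set ((R(i := X, 1 := [s])) j)" if "j > 0" for j
  proof (cases "j = 1 \<or> j = i")
    case False
    then have "j > 1" using that by simp
    then show ?thesis using assms(1) False unfolding others_ok_def by simp
  qed (use assms in auto)
  then show ?thesis unfolding halted_def prod.case by blast
qed

text \<open>The form \<open>R(i := X, 1 := [s])\<close> displays the two partners of a conversation,
  register chain \<open>i\<close> and the controller in chain 1. All other chains are calm by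
  \<open>others_ok\<close> and \<open>about\<close>.\<close>

lemma next_ctl:
  assumes R: "others_ok i R" "about i v" "calm T v X" "Ctl (Run []) \<notin> set X" "i > 1" "n > 0"
    and s: "s \<noteq> Ctl (Run [])" "s \<noteq> Fin" and a: "(s, a, t) \<in> T" "able v a" "a \<noteq> Fork" "a \<noteq> Spawn"
    and uniq: "\<And>a' t'. (s, a', t') \<in> T \<Longrightarrow> able v a' \<Longrightarrow> a' = a \<and> t' = t"
    and v': "v' = (case a of Put w \<Rightarrow> w | _ \<Rightarrow> v)"
  shows "next_conf T N (v, R(i := X, 1 := [s]), [], n) (v', R(i := X, 1 := [t]), [], n)"
proof -
  have calm: "calm T v ((R(i := X, 1 := [s])) j)" if "j \<noteq> 1" "j > 0" for j
    using calm_other[OF R(1,2), of j] R(3) that by auto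
  have "(R(i := X, 1 := [s])) 1 = s # []" by simp
  from next_act[OF _ this a(1,2) uniq s(2) calm R(6) not_halted[OF R(1) s(1) R(4)], of N] show ?thesis
    using a(3,4) v' by (cases a) auto
qed

lemma next_reg:
  assumes R: "others_ok i R" "about i v" "calm T v [s]" "Ctl (Run []) \<notin> set (y # us)" "i > 1" "n > 0"
    and s: "s \<noteq> Ctl (Run [])" and y: "y \<noteq> Fin" and a: "(y, a, t) \<in> T" "able v a" "a \<noteq> Spawn"
    and uniq: "\<And>a' t'. (y, a', t') \<in> T \<Longrightarrow> able v a' \<Longrightarrow> a' = a \<and> t' = t"
    and v': "v' = (case a of Put w \<Rightarrow> w | _ \<Rightarrow> v)"
    and X: "X = (if a = Fork then Start # t # us else t # us)" "ps = (if a = Fork then [i] else [])"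
  shows "next_conf T N (v, R(i := y # us, 1 := [s]), [], n) (v', R(i := X, 1 := [s]), ps, n)"
proof -
  have calm: "calm T v ((R(i := y # us, 1 := [s])) j)" if "j \<noteq> i" "j > 0" for j
    using calm_other[OF R(1,2), of j] R(3) that by (cases "j = 1") auto
  have i: "(R(i := y # us, 1 := [s])) i = y # us" using R(5) by simp
  have "R(i := y # us, 1 := [s], i := X) = R(i := X, 1 := [s])" for X
    using R(5) by (auto simp: fun_eq_iff)
  with next_act[OF _ i a(1,2) uniq y calm R(6) not_halted[OF R(1) s R(4)], of N] show ?thesis
    using R(5) a(3) v' X by (cases a) auto
qed

lemma next_pop:
  assumes R: "others_ok i R" "about i v" "calm T v [s]" "Ctl (Run []) \<notin> set us" "i > 1"
    and s: "s \<noteq> Ctl (Run [])"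
  shows "next_conf T N (v, R(i := Fin # us, 1 := [s]), [], n) (v, R(i := us, 1 := [s]), [], n)"
proof -
  have calm: "calm T v ((R(i := Fin # us, 1 := [s])) j)" if "j \<noteq> i" "j > 0" for j
    using calm_other[OF R(1,2), of j] R(3) that by (cases "j = 1") auto
  have i: "(R(i := Fin # us, 1 := [s])) i = Fin # us" using R(5) by simp
  have "R(i := Fin # us, 1 := [s], i := us) = R(i := us, 1 := [s])"
    using R(5) by (auto simp: fun_eq_iff)
  moreover have "\<not> halted (v, R(i := Fin # us, 1 := [s]), [], n)"
    using R(4) by (intro not_halted[OF R(1) s]) simp
  ultimately show ?thesis
    using next_finish[where R = "R(i := Fin # us, 1 := [s])" and i = i, OF _ i T_Fin calm, of n N] R(5)
    by simp
qed

lemma next_born: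
  assumes R: "others_ok i R" "about i v" "calm T v [s]" "Ctl (Run []) \<notin> set us" "i > 1"
    and s: "s \<noteq> Ctl (Run [])"
  shows "next_conf T N (v, R(i := Start # us, 1 := [s]), [i], n) (v, R(i := Start # us, 1 := [s]), [], n)"
proof (rule next_serve)
  show "calm T v ((R(i := Start # us, 1 := [s])) j)" if "j \<noteq> i" "j > 0" for j
    using calm_other[OF R(1,2), of j] R(3) that by (cases "j = 1") auto
  show "\<not> halted (v, R(i := Start # us, 1 := [s]), [i], n)"
    using R(4) by (intro not_halted[OF R(1) s]) simp
qed

abbreviation steps :: "conf \<Rightarrow> conf \<Rightarrow> bool" where
  "steps \<equiv> (next_conf T N)\<^sup>+\<^sup>+"

lemma steps_step: "next_conf T N c d \<Longrightarrow> steps d e \<Longrightarrow> steps c e"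
  by (rule tranclp_into_tranclp2)

lemma steps_last: "next_conf T N c d \<Longrightarrow> steps c d"
  by (rule tranclp.r_into_trancl)

text \<open>The variable still holds \<open>IncV r\<close> after the fork, and the parent is back in
  a state that reacts to it. The fork itself prevents a second increment: the parent is blocked, and
  the child consumes the request as its birth signal before it answers.\<close>

lemma steps_inc:
  assumes R: "others_ok (r + 2) R" "Ctl (Run []) \<notin> set us" "n > 0" "r < k" "neutral v" "c \<noteq> Run []"
    and c: "\<And>a t. (Ctl c, a, t) \<in> T \<longleftrightarrow> a = Put (IncV r) \<and> t = Wait c"
      "\<And>a t. (Wait c, a, t) \<in> T \<longleftrightarrow> a = Is Ack \<and> t = Ctl d"
  shows "steps (v, R(r + 2 := Reg b r # us, 1 := [Ctl c]), [], n)
    (Ack, R(r + 2 := Reg False r # Reg b r # us, 1 := [Ctl d]), [], n)"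
proof -
  let ?i = "r + 2"
  have v: "calm T v (Reg b r # us)" using R(5) by (intro calm_Reg) (auto simp: neutral_def)
  have w: "calm T (IncV r) [Wait c]" by (intro calm_Wait) auto
  have 1: "next_conf T N (v, R(?i := Reg b r # us, 1 := [Ctl c]), [], n)
      (IncV r, R(?i := Reg b r # us, 1 := [Wait c]), [], n)"
    by (rule next_ctl[OF R(1) _ v, where a = "Put (IncV r)" and t = "Wait c"])
      (use R in \<open>auto simp: c\<close>)
  have 2: "next_conf T N (IncV r, R(?i := Reg b r # us, 1 := [Wait c]), [], n)
      (IncV r, R(?i := Push b r # us, 1 := [Wait c]), [], n)"
    by (rule next_reg[OF R(1) _ w, where a = "Is (IncV r)" and t = "Push b r"])
      (use R in \<open>auto simp: T_Reg split: if_splits\<close>)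
  have 3: "next_conf T N (IncV r, R(?i := Push b r # us, 1 := [Wait c]), [], n)
      (IncV r, R(?i := Start # Reg b r # us, 1 := [Wait c]), [?i], n)"
    by (rule next_reg[OF R(1) _ w, where a = Fork and t = "Reg b r"])
      (use R in \<open>auto simp: T_Push split: if_splits\<close>)
  have 4: "next_conf T N (IncV r, R(?i := Start # Reg b r # us, 1 := [Wait c]), [?i], n)
      (IncV r, R(?i := Start # Reg b r # us, 1 := [Wait c]), [], n)"
    using R by (intro next_born w) auto
  have 5: "next_conf T N (IncV r, R(?i := Start # Reg b r # us, 1 := [Wait c]), [], n)
      (IncV r, R(?i := Born False r # Reg b r # us, 1 := [Wait c]), [], n)"
    by (rule next_reg[OF R(1) _ w, where a = "Is (IncV r)" and t = "Born False r"])
      (use R in \<open>auto simp: T_Start split: if_splits\<close>)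
  have 6: "next_conf T N (IncV r, R(?i := Born False r # Reg b r # us, 1 := [Wait c]), [], n)
      (Ack, R(?i := Reg False r # Reg b r # us, 1 := [Wait c]), [], n)"
    by (rule next_reg[OF R(1) _ w, where a = "Put Ack" and t = "Reg False r"])
      (use R in \<open>auto simp: T_Born split: if_splits\<close>)
  have a: "calm T Ack (Reg False r # Reg b r # us)" by (intro calm_Reg) auto
  have 7: "next_conf T N (Ack, R(?i := Reg False r # Reg b r # us, 1 := [Wait c]), [], n)
      (Ack, R(?i := Reg False r # Reg b r # us, 1 := [Ctl d]), [], n)"
    by (rule next_ctl[OF R(1) _ a, where a = "Is Ack" and t = "Ctl d"]) (use R in \<open>auto simp: c\<close>)
  show ?thesis
    by (rule steps_step[OF 1], rule steps_step[OF 2],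
        rule steps_step[OF 3], rule steps_step[OF 4],
        rule steps_step[OF 5], rule steps_step[OF 6],
        rule steps_last[OF 7])
qed

text \<open>While the front vertex is in \<open>Fin\<close>, its removal is the only step: the
  controller does not react to \<open>RetV r\<close>, and the vertex below, which does, is still
  blocked.\<close>

lemma steps_dec:
  assumes R: "others_ok (r + 2) R" "Ctl (Run []) \<notin> set us" "n > 0" "r < k" "neutral v" "c \<noteq> Run []"
    and c: "\<And>a t. (Ctl c, a, t) \<in> T \<longleftrightarrow> a = Put (DecV r) \<and> t = Wait c"
      "\<And>a t. (Wait c, a, t) \<in> T \<longleftrightarrow> a = Is Ack \<and> t = Ctl d \<or> a = Is IsZero \<and> t = Ctl e"
  shows "steps (v, R(r + 2 := Reg False r # Reg b r # us, 1 := [Ctl c]), [], n)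
    (Ack, R(r + 2 := Reg b r # us, 1 := [Ctl d]), [], n)"
proof -
  let ?i = "r + 2"
  have v: "calm T v (Reg False r # Reg b r # us)" using R(5) by (intro calm_Reg) (auto simp: neutral_def)
  have w: "calm T (DecV r) [Wait c]" by (intro calm_Wait) auto
  have w': "calm T (RetV r) [Wait c]" by (intro calm_Wait) auto
  have 1: "next_conf T N (v, R(?i := Reg False r # Reg b r # us, 1 := [Ctl c]), [], n)
      (DecV r, R(?i := Reg False r # Reg b r # us, 1 := [Wait c]), [], n)"
    by (rule next_ctl[OF R(1) _ v, where a = "Put (DecV r)" and t = "Wait c"])
      (use R in \<open>auto simp: c\<close>)
  have 2: "next_conf T N (DecV r, R(?i := Reg False r # Reg b r # us, 1 := [Wait c]), [], n)
      (DecV r, R(?i := Dec False r # Reg b r # us, 1 := [Wait c]), [], n)"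
    by (rule next_reg[OF R(1) _ w, where a = "Is (DecV r)" and t = "Dec False r"])
      (use R in \<open>auto simp: T_Reg split: if_splits\<close>)
  have 3: "next_conf T N (DecV r, R(?i := Dec False r # Reg b r # us, 1 := [Wait c]), [], n)
      (RetV r, R(?i := Fin # Reg b r # us, 1 := [Wait c]), [], n)"
    by (rule next_reg[OF R(1) _ w, where a = "Put (RetV r)" and t = Fin])
      (use R in \<open>auto simp: T_Dec split: if_splits\<close>)
  have 4: "next_conf T N (RetV r, R(?i := Fin # Reg b r # us, 1 := [Wait c]), [], n)
      (RetV r, R(?i := Reg b r # us, 1 := [Wait c]), [], n)"
    using R by (intro next_pop w') auto
  have 5: "next_conf T N (RetV r, R(?i := Reg b r # us, 1 := [Wait c]), [], n)
      (RetV r, R(?i := Back b r # us, 1 := [Wait c]), [], n)"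
    by (rule next_reg[OF R(1) _ w', where a = "Is (RetV r)" and t = "Back b r"])
      (use R in \<open>auto simp: T_Reg split: if_splits\<close>)
  have 6: "next_conf T N (RetV r, R(?i := Back b r # us, 1 := [Wait c]), [], n)
      (Ack, R(?i := Reg b r # us, 1 := [Wait c]), [], n)"
    by (rule next_reg[OF R(1) _ w', where a = "Put Ack" and t = "Reg b r"])
      (use R in \<open>auto simp: T_Back split: if_splits\<close>)
  have a: "calm T Ack (Reg b r # us)" by (intro calm_Reg) auto
  have 7: "next_conf T N (Ack, R(?i := Reg b r # us, 1 := [Wait c]), [], n)
      (Ack, R(?i := Reg b r # us, 1 := [Ctl d]), [], n)"
    by (rule next_ctl[OF R(1) _ a, where a = "Is Ack" and t = "Ctl d"]) (use R in \<open>auto simp: c\<close>)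
  show ?thesis
    by (rule steps_step[OF 1], rule steps_step[OF 2],
        rule steps_step[OF 3], rule steps_step[OF 4],
        rule steps_step[OF 5], rule steps_step[OF 6],
        rule steps_last[OF 7])
qed

lemma steps_zero:
  assumes R: "others_ok (r + 2) R" "Ctl (Run []) \<notin> set us" "n > 0" "r < k" "neutral v" "c \<noteq> Run []"
    and c: "\<And>a t. (Ctl c, a, t) \<in> T \<longleftrightarrow> a = Put (DecV r) \<and> t = Wait c"
      "\<And>a t. (Wait c, a, t) \<in> T \<longleftrightarrow> a = Is Ack \<and> t = Ctl d \<or> a = Is IsZero \<and> t = Ctl e"
  shows "steps (v, R(r + 2 := Reg True r # us, 1 := [Ctl c]), [], n)
    (IsZero, R(r + 2 := Reg True r # us, 1 := [Ctl e]), [], n)"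
proof -
  let ?i = "r + 2"
  have v: "calm T v (Reg True r # us)" using R(5) by (intro calm_Reg) (auto simp: neutral_def)
  have w: "calm T (DecV r) [Wait c]" by (intro calm_Wait) auto
  have 1: "next_conf T N (v, R(?i := Reg True r # us, 1 := [Ctl c]), [], n)
      (DecV r, R(?i := Reg True r # us, 1 := [Wait c]), [], n)"
    by (rule next_ctl[OF R(1) _ v, where a = "Put (DecV r)" and t = "Wait c"])
      (use R in \<open>auto simp: c\<close>)
  have 2: "next_conf T N (DecV r, R(?i := Reg True r # us, 1 := [Wait c]), [], n)
      (DecV r, R(?i := Dec True r # us, 1 := [Wait c]), [], n)"
    by (rule next_reg[OF R(1) _ w, where a = "Is (DecV r)" and t = "Dec True r"])
      (use R in \<open>auto simp: T_Reg split: if_splits\<close>)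
  have 3: "next_conf T N (DecV r, R(?i := Dec True r # us, 1 := [Wait c]), [], n)
      (IsZero, R(?i := Reg True r # us, 1 := [Wait c]), [], n)"
    by (rule next_reg[OF R(1) _ w, where a = "Put IsZero" and t = "Reg True r"])
      (use R in \<open>auto simp: T_Dec split: if_splits\<close>)
  have a: "calm T IsZero (Reg True r # us)" by (intro calm_Reg) auto
  have 4: "next_conf T N (IsZero, R(?i := Reg True r # us, 1 := [Wait c]), [], n)
      (IsZero, R(?i := Reg True r # us, 1 := [Ctl e]), [], n)"
    by (rule next_ctl[OF R(1) _ a, where a = "Is IsZero" and t = "Ctl e"])
      (use R in \<open>auto simp: c\<close>)
  show ?thesis
    by (rule steps_step[OF 1], rule steps_step[OF 2],
        rule steps_step[OF 3], rule steps_last[OF 4])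
qed

text \<open>A dispatch opens chain \<open>n\<close>. Registers are created in increasing order, so
  \<open>n\<close> is \<open>r + 2\<close> at this moment and chain and register get matching
  numbers.\<close>

lemma steps_new:
  assumes R: "others_ok (r + 2) R" "r < k" "neutral v" "c \<noteq> Run []"
    and c: "\<And>a t. (Ctl c, a, t) \<in> T \<longleftrightarrow> a = Put (NewV r) \<and> t = Disp c"
      "\<And>a t. (Disp c, a, t) \<in> T \<longleftrightarrow> a = Spawn \<and> t = Wait c"
      "\<And>a t. (Wait c, a, t) \<in> T \<longleftrightarrow> a = Is Ack \<and> t = Ctl d"
  shows "steps (v, R(r + 2 := [], 1 := [Ctl c]), [], r + 2)
    (Ack, R(r + 2 := [Reg True r], 1 := [Ctl d]), [], Suc (r + 2))"
proof -
  let ?i = "r + 2"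
  have w: "calm T (NewV r) [Wait c]" by (intro calm_Wait) auto
  have 1: "next_conf T N (v, R(?i := [], 1 := [Ctl c]), [], ?i) (NewV r, R(?i := [], 1 := [Disp c]), [], ?i)"
    by (rule next_ctl[OF R(1), where a = "Put (NewV r)" and t = "Disp c"])
      (use R in \<open>auto simp: c\<close>)
  have calm: "calm T (NewV r) ((R(?i := [], 1 := [Disp c])) j)" if "j \<noteq> 1" "j > 0" for j
    using calm_other[OF R(1), of _ j] that by auto
  have one: "(R(?i := [], 1 := [Disp c])) 1 = Disp c # []" by simp
  have nh: "\<not> halted (NewV r, R(?i := [], 1 := [Disp c]), [], ?i)"
    by (rule not_halted[OF R(1)]) auto
  have "next_conf T N (NewV r, R(?i := [], 1 := [Disp c]), [], ?i)
      (NewV r, R(?i := [], 1 := [Disp c], 1 := [Wait c], ?i := [Start]), [?i], Suc ?i)"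
  proof -
    have T: "(Disp c, Spawn, Wait c) \<in> T" using c(2) by simp
    have uniq: "a' = Spawn \<and> t' = Wait c" if "(Disp c, a', t') \<in> T" for a' t'
      using that c(2) by blast
    show ?thesis
      by (rule next_act[where a = Spawn and i = 1 and n = ?i, unfolded op.case, OF _ one T _ uniq _ calm _ nh])
        auto
  qed
  also have "R(?i := [], 1 := [Disp c], 1 := [Wait c], ?i := [Start]) = R(?i := [Start], 1 := [Wait c])"
    by (auto simp: fun_eq_iff)
  finally have 2: "next_conf T N (NewV r, R(?i := [], 1 := [Disp c]), [], ?i)
      (NewV r, R(?i := [Start], 1 := [Wait c]), [?i], Suc ?i)" .
  have 3: "next_conf T N (NewV r, R(?i := [Start], 1 := [Wait c]), [?i], Suc ?i)
      (NewV r, R(?i := [Start], 1 := [Wait c]), [], Suc ?i)"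
    using R by (intro next_born w) auto
  have 4: "next_conf T N (NewV r, R(?i := [Start], 1 := [Wait c]), [], Suc ?i)
      (NewV r, R(?i := [Born True r], 1 := [Wait c]), [], Suc ?i)"
    by (rule next_reg[OF R(1) _ w, where a = "Is (NewV r)" and t = "Born True r"])
      (use R in \<open>auto simp: T_Start split: if_splits\<close>)
  have 5: "next_conf T N (NewV r, R(?i := [Born True r], 1 := [Wait c]), [], Suc ?i)
      (Ack, R(?i := [Reg True r], 1 := [Wait c]), [], Suc ?i)"
    by (rule next_reg[OF R(1) _ w, where a = "Put Ack" and t = "Reg True r"])
      (use R in \<open>auto simp: T_Born split: if_splits\<close>)
  have a: "calm T Ack [Reg True r]" by (intro calm_Reg) auto
  have 6: "next_conf T N (Ack, R(?i := [Reg True r], 1 := [Wait c]), [], Suc ?i)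
      (Ack, R(?i := [Reg True r], 1 := [Ctl d]), [], Suc ?i)"
    by (rule next_ctl[OF R(1) _ a, where a = "Is Ack" and t = "Ctl d"]) (use R in \<open>auto simp: c\<close>)
  show ?thesis
    by (rule steps_step[OF 1], rule steps_step[OF 2],
        rule steps_step[OF 3], rule steps_step[OF 4],
        rule steps_step[OF 5], rule steps_last[OF 6])
qed

end

section \<open>Forced runs that cycle or get stuck\<close>

definition covers :: "'s \<Rightarrow> ('d, 'x, 'b, 's) stacks \<Rightarrow> bool" where
  "covers s = (\<lambda>(\<sigma>, \<theta>, ps, n). \<exists>i. s \<in> snd ` set (\<theta> i))"

definition avoids :: "('d, 'x, 'q, 'b, 's) eqdas \<Rightarrow> 's \<Rightarrow> ('d, 'x, 'b, 's) stacks
    \<Rightarrow> ('d, 'x, 'b, 's) stacks \<Rightarrow> bool" where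
  "avoids A s c d \<longleftrightarrow> forced A c d \<and> \<not> covers s c"

context chain_system
begin

lemma simulates_covers:
  "simulates (G, \<sigma>) c \<Longrightarrow> parikh G s \<ge> 1 \<longleftrightarrow> covers s c"
  using simulates_parikh by (cases c) (auto simp: covers_def)

text \<open>The invariant \<open>Q\<close> says that a configuration simulates a stack from which
  the path leads on to \<open>e\<close>. Such a stack has exactly one successor, again on the path,
  so \<open>Q\<close> is preserved by every step and always allows one.\<close>

lemma lasso:
  assumes "(avoids A s)\<^sup>*\<^sup>* (initial_stacks A) e" "(avoids A s)\<^sup>+\<^sup>+ e e"
  shows "\<not> terminating A" and "reachable A (G, \<sigma>) \<Longrightarrow> parikh G s = 0"
proof -
  define Q where "Q c \<longleftrightarrow> (\<exists>a. simulates c a \<and> (avoids A s)\<^sup>*\<^sup>* a e)" for c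
  \<comment> \<open>At \<open>e\<close> itself the path continues around the cycle.\<close>
  have ahead: "\<exists>d. avoids A s a d \<and> (avoids A s)\<^sup>*\<^sup>* d e" if "(avoids A s)\<^sup>*\<^sup>* a e" for a
    using that
  proof (cases rule: converse_rtranclpE)
    case base
    then show ?thesis using tranclpD[OF assms(2)] by simp
  qed blast
  have init: "Q (initial_config A)"
    unfolding Q_def using simulates_initial assms(1) by blast
  have preserve: "Q c'" if Q: "Q c" and step: "step A c c'" for c c'
  proof -
    obtain a where a: "simulates c a" "(avoids A s)\<^sup>*\<^sup>* a e" using \<open>Q c\<close> by (auto simp: Q_def)
    obtain a' where a': "stack_step A a a'" "simulates c' a'" using simulates_step[OF a(1) step] by blast
    obtain d where "avoids A s a d" "(avoids A s)\<^sup>*\<^sup>* d e" using ahead[OF a(2)] by blast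
    moreover from this a'(1) have "a' = d" unfolding avoids_def forced_def by blast
    ultimately show ?thesis unfolding Q_def using a'(2) by blast
  qed
  have progress: "\<exists>c'. step A c c'" if "Q c" for c
  proof -
    obtain a where a: "simulates c a" "(avoids A s)\<^sup>*\<^sup>* a e" using \<open>Q c\<close> by (auto simp: Q_def)
    obtain d where "avoids A s a d" using ahead[OF a(2)] by blast
    then have "stack_step A a d" unfolding avoids_def forced_def by blast
    then show ?thesis using simulates_stack_step[OF a(1)] by blast
  qed
  have "\<exists>f. \<forall>n. (Q (f n) \<and> (n = 0 \<longrightarrow> f n = initial_config A)) \<and> step A (f n) (f (Suc n))"
  proof (rule dependent_nat_choice)
    show "\<exists>c. Q c \<and> (0 = 0 \<longrightarrow> c = initial_config A)" using init by blast
    show "\<exists>c'. (Q c' \<and> (Suc n = 0 \<longrightarrow> c' = initial_config A)) \<and> step A c c'"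
      if "Q c \<and> (n = 0 \<longrightarrow> c = initial_config A)" for c and n :: nat
      using that progress preserve by blast
  qed
  then show "\<not> terminating A" by (auto simp: terminating_def infinite_run_def)
  show "parikh G s = 0" if "reachable A (G, \<sigma>)"
  proof -
    have "Q (G, \<sigma>)"
      using that unfolding reachable_def by (induction rule: rtranclp_induct) (use init preserve in blast)+
    then obtain a where a: "simulates (G, \<sigma>) a" "(avoids A s)\<^sup>*\<^sup>* a e" by (auto simp: Q_def)
    then have "\<not> covers s a" using ahead[OF a(2)] by (auto simp: avoids_def)
    then show ?thesis using simulates_covers[OF a(1), of s] by simp
  qed
qed

text \<open>By induction backwards from \<open>e\<close>: a configuration simulating a point of the
  path can only move to one simulating the next point, so no run outlasts the path.\<close>

lemma dead_end:
  assumes "(forced A)\<^sup>*\<^sup>* (initial_stacks A) e" "\<And>d. \<not> stack_step A e d"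
  shows "terminating A" and "covers s e \<Longrightarrow> \<exists>G \<sigma>. reachable A (G, \<sigma>) \<and> parikh G s \<ge> 1"
proof -
  have "\<nexists>f. f 0 = c \<and> (\<forall>i. step A (f i) (f (Suc i)))"
    if "(forced A)\<^sup>*\<^sup>* a e" "simulates c a" for a c
    using that
  proof (induction arbitrary: c rule: converse_rtranclp_induct)
    case base
    then show ?case using assms(2) simulates_step by metis
  next
    case (step a d)
    show ?case
    proof
      assume "\<exists>f. f 0 = c \<and> (\<forall>i. step A (f i) (f (Suc i)))"
      then obtain f where f: "f 0 = c" "\<And>i. step A (f i) (f (Suc i))" by blast
      then have "simulates (f 1) d"
        using simulates_step[OF step.prems, of "f 1"] step.hyps(1) by (auto simp: forced_def)
      moreover have "\<exists>g. g 0 = f 1 \<and> (\<forall>i. step A (g i) (g (Suc i)))"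
        using f(2) by (intro exI[of _ "\<lambda>i. f (Suc i)"]) simp
      ultimately show False using step.IH by blast
    qed
  qed
  from this[OF assms(1) simulates_initial] show "terminating A"
    by (auto simp: terminating_def infinite_run_def)
  assume "covers s e"
  have "\<exists>c'. (step A)\<^sup>*\<^sup>* (initial_config A) c' \<and> simulates c' e"
    using assms(1)
  proof (induction rule: rtranclp_induct)
    case base
    then show ?case using simulates_initial by blast
  next
    case (step a d)
    then obtain c' where "(step A)\<^sup>*\<^sup>* (initial_config A) c'" "simulates c' a" by blast
    moreover have "stack_step A a d" using step.hyps(2) unfolding forced_def by blast
    ultimately show ?case using simulates_stack_step by (meson rtranclp.rtrancl_into_rtrancl)
  qed
  then obtain G \<sigma> where "reachable A (G, \<sigma>)" "simulates (G, \<sigma>) e" by (auto simp: reachable_def)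
  then show "\<exists>G \<sigma>. reachable A (G, \<sigma>) \<and> parikh G s \<ge> 1"
    using simulates_covers \<open>covers s e\<close> by blast
qed

end

section \<open>Simulation of counter programs\<close>

context machine
begin

definition stack :: "nat \<Rightarrow> nat \<Rightarrow> lst list" where
  "stack r m = replicate m (Reg False r) @ [Reg True r]"

lemma stack_simps: "stack r 0 = [Reg True r]" "stack r (Suc m) = Reg False r # stack r m"
  by (simp_all add: stack_def)

lemma stack_Cons: "\<exists>b us. stack r m = Reg b r # us \<and> Ctl c \<notin> set us"
  by (cases m) (auto simp: stack_def)

definition registers :: "(nat \<Rightarrow> nat) \<Rightarrow> nat \<Rightarrow> nat \<Rightarrow> lst list" where
  "registers \<rho> m = (\<lambda>i. if 2 \<le> i \<and> i < m + 2 then stack (i - 2) (\<rho> (i - 2)) else [])"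

text \<open>\<open>m\<close> is the number of registers created so far; the offset 2 accounts for
  the main task and the controller.\<close>

definition state :: "val \<Rightarrow> ctl \<Rightarrow> (nat \<Rightarrow> nat) \<Rightarrow> nat \<Rightarrow> conf" where
  "state v c \<rho> m =
     (v, (registers \<rho> m)(1 := [Ctl c]), [], m + 2)"

lemma state_upd:
  assumes "r < m"
  shows "(v, (registers \<rho> m)
    (r + 2 := stack r y, 1 := [Ctl c]), [], m + 2) = state v c (\<rho>(r := y)) m"
  using assms by (auto simp: state_def registers_def fun_eq_iff)

lemma others_ok_state:
  "others_ok i (registers \<rho> m)"
proof -
  have "Ctl (Run []) \<notin> set (stack r n) \<and> (\<exists>b us. stack r n = Reg b r # us)" for r n
  proof
    show "Ctl (Run []) \<notin> set (stack r n)" by (simp add: stack_def)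
  qed (use stack_Cons in blast)
  then show ?thesis by (auto simp: others_ok_def registers_def)
qed

lemma state_inc:
  assumes "r < m" "r < k" "neutral v" "c \<noteq> Run []"
    and c: "\<And>a t. (Ctl c, a, t) \<in> T \<longleftrightarrow> a = Put (IncV r) \<and> t = Wait c"
      "\<And>a t. (Wait c, a, t) \<in> T \<longleftrightarrow> a = Is Ack \<and> t = Ctl d"
  shows "steps (state v c \<rho> m) (state Ack d (\<rho>(r := Suc (\<rho> r))) m)"
proof -
  obtain b us where us: "stack r (\<rho> r) = Reg b r # us" "Ctl (Run []) \<notin> set us"
    using stack_Cons by blast
  from steps_inc[OF others_ok_state[where \<rho> = \<rho> and m = m] us(2) _ assms(2-4) c, where n = "m + 2" and b = b]
  show ?thesis
    unfolding us(1)[symmetric] stack_simps(2)[symmetric] state_upd[OF assms(1)] by simp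
qed

lemma state_dec:
  assumes "r < m" "r < k" "neutral v" "c \<noteq> Run []"
    and c: "\<And>a t. (Ctl c, a, t) \<in> T \<longleftrightarrow> a = Put (DecV r) \<and> t = Wait c"
      "\<And>a t. (Wait c, a, t) \<in> T \<longleftrightarrow> a = Is Ack \<and> t = Ctl d \<or> a = Is IsZero \<and> t = Ctl e"
    and y: "\<rho> r = Suc y"
  shows "steps (state v c \<rho> m) (state Ack d (\<rho>(r := y)) m)"
proof -
  obtain b us where us: "stack r y = Reg b r # us" "Ctl (Run []) \<notin> set us"
    using stack_Cons by blast
  have "\<rho>(r := Suc y) = \<rho>" using y by auto
  with steps_dec[OF others_ok_state[where \<rho> = \<rho> and m = m] us(2) _ assms(2-4) c, where n = "m + 2" and b = b]
  show ?thesis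
    unfolding us(1)[symmetric] stack_simps(2)[symmetric] state_upd[OF assms(1)] by simp
qed

lemma state_zero:
  assumes "r < m" "r < k" "neutral v" "c \<noteq> Run []"
    and c: "\<And>a t. (Ctl c, a, t) \<in> T \<longleftrightarrow> a = Put (DecV r) \<and> t = Wait c"
      "\<And>a t. (Wait c, a, t) \<in> T \<longleftrightarrow> a = Is Ack \<and> t = Ctl d \<or> a = Is IsZero \<and> t = Ctl e"
    and y: "\<rho> r = 0"
  shows "steps (state v c \<rho> m) (state IsZero e \<rho> m)"
proof -
  have "\<rho>(r := 0) = \<rho>" using y by auto
  with steps_zero[OF others_ok_state[where \<rho> = \<rho> and m = m] _ _ assms(2-4) c, where n = "m + 2" and us = "[]"]
  show ?thesis
    unfolding stack_simps(1)[symmetric] state_upd[OF assms(1)] by simp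
qed

lemma state_new:
  assumes "m < k" "neutral v" "c \<noteq> Run []" "\<rho> m = 0"
    and c: "\<And>a t. (Ctl c, a, t) \<in> T \<longleftrightarrow> a = Put (NewV m) \<and> t = Disp c"
      "\<And>a t. (Disp c, a, t) \<in> T \<longleftrightarrow> a = Spawn \<and> t = Wait c"
      "\<And>a t. (Wait c, a, t) \<in> T \<longleftrightarrow> a = Is Ack \<and> t = Ctl d"
  shows "steps (state v c \<rho> m) (state Ack d \<rho> (Suc m))"
proof -
  let ?R = "registers \<rho> m"
  have "?R(m + 2 := []) = ?R" by (auto simp: registers_def)
  moreover have "?R(m + 2 := [Reg True m]) =
      registers \<rho> (Suc m)"
    using assms(4) by (auto simp: registers_def fun_eq_iff stack_simps less_Suc_eq)
  ultimately show ?thesis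
    using steps_new[OF others_ok_state[where \<rho> = \<rho> and m = m] assms(1-3) c] by (simp add: state_def)
qed

lemma state_jump:
  assumes "neutral v" "c \<noteq> Run []" "\<And>a t. (Ctl c, a, t) \<in> T \<longleftrightarrow> a = Nop \<and> t = Ctl d"
  shows "steps (state v c \<rho> m) (state v d \<rho> m)"
proof -
  let ?R = "registers \<rho> m"
  have R: "others_ok i ?R" for i by (rule others_ok_state)
  \<comment> \<open>\<open>next_ctl\<close> singles out a register chain, but a jump addresses none;
    chain 2 is taken and overwritten by itself.\<close>
  have "calm T v (?R 2)" using calm_other[OF R[of 0], of v 2] assms(1) by simp
  moreover have "Ctl (Run []) \<notin> set (?R 2)" using R[of 0] unfolding others_ok_def by fastforce
  ultimately have "next_conf T N (v, ?R(2 := ?R 2, 1 := [Ctl c]), [], m + 2) (v, ?R(2 := ?R 2, 1 := [Ctl d]), [], m + 2)"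
    by (intro next_ctl[OF R, where a = Nop and t = "Ctl d"]) (use assms in auto)
  then show ?thesis unfolding state_def fun_upd_triv by (rule steps_last)
qed

text \<open>The continuation \<open>K\<close> is arbitrary because \<open>Seq\<close> and
  \<open>Loop\<close> push onto it. The inclusion of \<open>conts c K\<close> guarantees that the
  control points met on the way have their transitions in \<open>T\<close>.\<close>

lemma steps_exec:
  assumes "exec c \<rho> \<rho>'" "conts c K \<subseteq> conts p []" "regs_of c \<subseteq> {..<k}" "neutral v"
  shows "\<exists>v'. neutral v' \<and> steps (state v (Run (c # K)) \<rho> k) (state v' (Run K) \<rho>' k)"
  using assms
proof (induction arbitrary: K v rule: exec.induct)
  case (Skip \<rho>)
  have "steps (state v (Run (Skip # K)) \<rho> k) (state v (Run K) \<rho> k)"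
    using Skip by (intro state_jump) (auto simp: T_Run jump_trans_def)
  then show ?case using Skip.prems by blast
next
  case (Inc r \<rho>)
  have "steps (state v (Run (Inc r # K)) \<rho> k) (state Ack (Run K) (\<rho>(r := Suc (\<rho> r))) k)"
    using Inc by (intro state_inc) (auto simp: T_Run inc_trans_def)
  then show ?case using neutral_simps by blast
next
  case (Seq c \<rho> \<rho>' d \<rho>'')
  have "steps (state v (Run (Seq c d # K)) \<rho> k) (state v (Run (c # d # K)) \<rho> k)"
    using Seq.prems by (intro state_jump) (auto simp: T_Run jump_trans_def)
  moreover obtain w where w: "neutral w" "steps (state v (Run (c # d # K)) \<rho> k) (state w (Run (d # K)) \<rho>' k)"
    using Seq.IH(1)[of "d # K" v] Seq.prems by auto
  moreover obtain u where "neutral u" "steps (state w (Run (d # K)) \<rho>' k) (state u (Run K) \<rho>'' k)"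
    using Seq.IH(2)[of K w] Seq.prems w(1) by auto
  ultimately show ?case by (meson tranclp_trans)
next
  case (Loop_zero \<rho> r c)
  have "steps (state v (Run (Loop r c # K)) \<rho> k) (state IsZero (Run K) \<rho> k)"
    using Loop_zero by (intro state_zero) (auto simp: T_Run dec_trans_def)
  then show ?case using neutral_simps by blast
next
  case (Loop_Suc \<rho> r n c \<rho>' \<rho>'')
  have "steps (state v (Run (Loop r c # K)) \<rho> k) (state Ack (Run (c # Loop r c # K)) (\<rho>(r := n)) k)"
    using Loop_Suc.prems Loop_Suc.hyps by (intro state_dec[where e = "Run K"]) (auto simp: T_Run dec_trans_def)
  moreover obtain w where w: "neutral w"
      "steps (state Ack (Run (c # Loop r c # K)) (\<rho>(r := n)) k) (state w (Run (Loop r c # K)) \<rho>' k)"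
  proof -
    have "conts c (Loop r c # K) \<subseteq> conts p []" "regs_of c \<subseteq> {..<k}" using Loop_Suc.prems by auto
    from Loop_Suc.IH(1)[OF this neutral_simps(2)] show ?thesis using that by blast
  qed
  moreover obtain u where "neutral u" "steps (state w (Run (Loop r c # K)) \<rho>' k) (state u (Run K) \<rho>'' k)"
    using Loop_Suc.IH(2)[of K w] Loop_Suc.prems w(1) by auto
  ultimately show ?case by (meson tranclp_trans)
qed

lemma steps_setup:
  assumes "m \<le> k"
  shows "\<exists>v. neutral v \<and> (next_conf T N)\<^sup>*\<^sup>* (state Idle (Setup 0) (\<lambda>_. 0) 0) (state v (Setup m) (\<lambda>_. 0) m)"
  using assms
proof (induction m)
  case 0
  show ?case using neutral_simps by blast
next
  case (Suc m)
  then obtain v where v: "neutral v"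
      "(next_conf T N)\<^sup>*\<^sup>* (state Idle (Setup 0) (\<lambda>_. 0) 0) (state v (Setup m) (\<lambda>_. 0) m)" by auto
  have "steps (state v (Setup m) (\<lambda>_. 0) m) (state Ack (Setup (Suc m)) (\<lambda>_. 0) (Suc m))"
    using Suc.prems v by (intro state_new) (auto simp: T_Setup)
  then show ?case using v by (meson neutral_simps(2) rtranclp_trans tranclp_into_rtranclp)
qed

lemma steps_input:
  assumes "i \<le> x" "0 < k" "neutral v"
  shows "\<exists>w. neutral w \<and> (next_conf T N)\<^sup>*\<^sup>* (state v (Pre 0) (\<lambda>_. 0) k) (state w (Pre i) ((\<lambda>_. 0)(0 := i)) k)"
  using assms(1)
proof (induction i)
  case 0
  have "(\<lambda>_ :: nat. 0 :: nat)(0 := 0) = (\<lambda>_. 0)" by auto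
  then show ?case using assms(3) by (metis rtranclp.rtrancl_refl)
next
  case (Suc i)
  then have "i \<le> x" by simp
  from Suc.IH[OF this] obtain w where w: "neutral w"
      "(next_conf T N)\<^sup>*\<^sup>* (state v (Pre 0) (\<lambda>_. 0) k) (state w (Pre i) ((\<lambda>_. 0)(0 := i)) k)" by blast
  let ?\<rho> = "(\<lambda>_ :: nat. 0 :: nat)(0 := i)"
  have "steps (state w (Pre i) ?\<rho> k) (state Ack (Pre (Suc i)) (?\<rho>(0 := Suc (?\<rho> 0))) k)"
    by (rule state_inc[where r = 0 and \<rho> = ?\<rho>])
      (use Suc.prems w assms(2) in \<open>auto simp: T_Pre\<close>)
  then have "steps (state w (Pre i) ((\<lambda>_. 0)(0 := i)) k) (state Ack (Pre (Suc i)) ((\<lambda>_. 0)(0 := Suc i)) k)"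
    by simp
  then show ?case using w by (meson neutral_simps(2) rtranclp_trans tranclp_into_rtranclp)
qed

definition born :: conf where
  "born = (Idle, (\<lambda>_. [])(1 := [Start]), [1], 2)"

lemma steps_born: "steps born (state Idle (Setup 0) (\<lambda>_. 0) 0)"
proof -
  have "next_conf T N (Idle, (\<lambda>_. [])(1 := [Start]), [1], 2) (Idle, (\<lambda>_. [])(1 := [Start]), [], 2)"
    by (rule next_serve) (auto simp: halted_def)
  moreover have "next_conf T N (Idle, (\<lambda>_. [])(1 := [Start]), [], 2)
      (Idle, (\<lambda>_. [])(1 := [Start], 1 := [Ctl (Setup 0)]), [], 2)"
    by (rule next_act[where a = "Is Idle" and i = 1, unfolded op.case])
      (auto simp: halted_def T_Start split: if_splits)
  moreover have "(Idle, (\<lambda>_. [])(1 := [Start], 1 := [Ctl (Setup 0)]), [], 2) = state Idle (Setup 0) (\<lambda>_. 0) 0"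
    by (auto simp: state_def registers_def fun_eq_iff)
  ultimately show ?thesis unfolding born_def by (metis steps_last steps_step)
qed

lemma steps_run:
  assumes "0 < k"
  shows "\<exists>v. neutral v \<and> (next_conf T N)\<^sup>*\<^sup>* born (state v (Run [p]) ((\<lambda>_. 0)(0 := x)) k)"
proof -
  obtain v where v: "neutral v"
      "(next_conf T N)\<^sup>*\<^sup>* (state Idle (Setup 0) (\<lambda>_. 0) 0) (state v (Setup k) (\<lambda>_. 0) k)"
    using steps_setup by blast
  have 1: "steps (state v (Setup k) (\<lambda>_. 0) k) (state v (Pre 0) (\<lambda>_. 0) k)"
    using v by (intro state_jump) (auto simp: T_Setup)
  obtain w where w: "neutral w"
      "(next_conf T N)\<^sup>*\<^sup>* (state v (Pre 0) (\<lambda>_. 0) k) (state w (Pre x) ((\<lambda>_. 0)(0 := x)) k)"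
    using steps_input v assms by blast
  have 2: "steps (state w (Pre x) ((\<lambda>_. 0)(0 := x)) k) (state w Entry ((\<lambda>_. 0)(0 := x)) k)"
    using w by (intro state_jump) (auto simp: T_Pre)
  have 3: "steps (state w Entry ((\<lambda>_. 0)(0 := x)) k) (state w (Run [p]) ((\<lambda>_. 0)(0 := x)) k)"
    using w by (intro state_jump) (auto simp: T_Entry)
  show ?thesis
    using w(1) steps_born v(2) 1 w(2) 2 3 by (meson rtranclp_trans tranclp_into_rtranclp)
qed

lemma next_conf_avoids:
  "next_conf T N c d \<Longrightarrow> avoids (system T N) (scode (Ctl (Run []))) (stacks_of c) (stacks_of d)"
proof -
  \<comment> \<open>The main task, in state 1, must not be mistaken for a halted controller.\<close>
  have "scode (Ctl (Run [])) \<noteq> 1" using scode_ge[of "Ctl (Run [])"] by linarith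
  then have "scode (Ctl (Run [])) \<in> snd ` set (((\<lambda>i. map (\<lambda>s. (1 :: nat, scode s)) (R i))(0 := [(0, 1)])) i)
      \<longleftrightarrow> i > 0 \<and> Ctl (Run []) \<in> set (R i)" for R :: "nat \<Rightarrow> lst list" and i
    by (cases "i = 0") (auto simp: image_iff)
  then have "covers (scode (Ctl (Run []))) (stacks_of c) \<longleftrightarrow> halted c"
    unfolding covers_def halted_def by (cases c) (simp only: stacks_of.simps prod.case)
  then show "next_conf T N c d \<Longrightarrow> ?thesis" by (simp add: avoids_def next_conf_def)
qed

lemma avoids_born:
  "avoids (system T N) (scode (Ctl (Run []))) (initial_stacks (system T N)) (stacks_of born)"
proof -
  let ?\<sigma> = "\<lambda>x\<in>{0 :: nat}. 0 :: nat" and ?\<theta> = "(\<lambda>_. [])(0 := [(0, 0)]) :: nat \<Rightarrow> (nat \<times> nat) list"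
  have "forced (system T N) (?\<sigma>, ?\<theta>, [], 1) (perform (system T N) 0 (DispatchA 0 1) 1 (?\<sigma>, ?\<theta>, [], 1))"
    by (rule forced_act[where b = 0 and s = 0]) (auto simp: main_lts_def)
  \<comment> \<open>The valuations agree because \<open>vcode Idle\<close> is
    \<open>prod_encode (0, 0)\<close>, which is 0.\<close>
  moreover have "perform (system T N) 0 (DispatchA 0 1) 1 (?\<sigma>, ?\<theta>, [], 1) = stacks_of born"
    by (auto simp: born_def fun_eq_iff vcode.simps prod_encode_def)
  moreover have "initial_stacks (system T N) = (?\<sigma>, ?\<theta>, [], 1)"
    by (simp add: initial_stacks_def system_def main_lts_def)
  ultimately show ?thesis
    using scode_ge[of "Ctl (Run [])"] by (auto simp: avoids_def covers_def split: if_splits)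
qed

lemma tranclp_avoids:
  "steps c d \<Longrightarrow> (avoids (system T N) (scode (Ctl (Run []))))\<^sup>+\<^sup>+ (stacks_of c) (stacks_of d)"
  by (induction rule: tranclp_induct) (auto dest: next_conf_avoids intro: tranclp.trancl_into_trancl)

lemma rtranclp_avoids:
  "(next_conf T N)\<^sup>*\<^sup>* c d \<Longrightarrow> (avoids (system T N) (scode (Ctl (Run []))))\<^sup>*\<^sup>* (stacks_of c) (stacks_of d)"
  by (induction rule: rtranclp_induct) (auto dest: next_conf_avoids intro: rtranclp.rtrancl_into_rtrancl)

end

section \<open>Halting and looping machines\<close>

context machine
begin

lemma neutral_calm:
  assumes "neutral v" "j > 1" shows "calm T v (registers \<rho> m j)"
  using calm_other[OF others_ok_state, of 0 v j] assms by simp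

text \<open>The empty continuation has no outgoing transition and is not final, and a neutral value
  leaves the registers calm. So the forced run ends with the controller in the halting
  state.\<close>

lemma halts:
  assumes "chain_system (system T N) 0" "0 < k" "regs_of p \<subseteq> {..<k}" "exec p ((\<lambda>_. 0)(0 := x)) \<rho>"
  shows "terminating (system T N)"
    and "\<exists>G \<sigma>. reachable (system T N) (G, \<sigma>) \<and> parikh G (scode (Ctl (Run []))) \<ge> 1"
proof -
  interpret chain_system "system T N" 0 by fact
  obtain v where "neutral v" "(next_conf T N)\<^sup>*\<^sup>* born (state v (Run [p]) ((\<lambda>_. 0)(0 := x)) k)"
    using steps_run assms(2) by blast
  moreover obtain w where w: "neutral w"
      "steps (state v (Run [p]) ((\<lambda>_. 0)(0 := x)) k) (state w (Run []) \<rho> k)"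
    using steps_exec[OF assms(4), of "[]" v] assms(3) calculation(1) by blast
  ultimately have "(next_conf T N)\<^sup>*\<^sup>* born (state w (Run []) \<rho> k)"
    by (meson rtranclp_trans tranclp_into_rtranclp)
  with avoids_born have path: "(avoids (system T N) (scode (Ctl (Run []))))\<^sup>*\<^sup>*
      (initial_stacks (system T N)) (stacks_of (state w (Run []) \<rho> k))"
    by (meson converse_rtranclp_into_rtranclp rtranclp_avoids)
  have forced: "(forced (system T N))\<^sup>*\<^sup>* (initial_stacks (system T N)) (stacks_of (state w (Run []) \<rho> k))"
    by (rule rtranclp_mono[THEN predicate2D, OF _ path]) (auto simp: avoids_def)
  have calm: "calm T w (((registers \<rho> k)(1 := [Ctl (Run [])])) j)" if "j > 0" for j
    using neutral_calm[OF w(1), of j] that by (auto simp: T_Run)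
  have stuck: "\<not> stack_step (system T N) (stacks_of (state w (Run []) \<rho> k)) d" for d
    unfolding state_def stacks_of.simps
  proof (rule quiet_stuck)
    \<comment> \<open>\<open>quiet_others\<close> speaks of the chains other than \<open>i\<close>;
      the choice \<open>Suc j\<close> makes it apply to any \<open>j\<close>.\<close>
    show "quiet (system T N) ((\<lambda>_. undefined)(0 := vcode w))
        (((\<lambda>i. map (\<lambda>s. (1, scode s)) (((registers \<rho> k)(1 := [Ctl (Run [])])) i))(0 := [(0, 1)])) j)" for j
      by (rule quiet_others[where i = "Suc j"]) (use calm in auto)
  qed
  show "terminating (system T N)" using dead_end(1)[OF forced stuck] .
  have "Ctl (Run []) \<in> set (((registers \<rho> k)(1 := [Ctl (Run [])])) 1)" by simp
  then have "covers (scode (Ctl (Run []))) (stacks_of (state w (Run []) \<rho> k))"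
    unfolding state_def covers_def stacks_of.simps prod.case by (intro exI[of _ 1]) auto
  then show "\<exists>G \<sigma>. reachable (system T N) (G, \<sigma>) \<and> parikh G (scode (Ctl (Run []))) \<ge> 1"
    using dead_end(2)[OF forced stuck] by blast
qed

text \<open>A nonzero register 1 is decremented and incremented again, which restores the
  configuration exactly and gives the cycle required by \<open>lasso\<close>.\<close>

lemma loops:
  assumes "chain_system (system T N) 0" "1 < k" "regs_of p \<subseteq> {..<k}"
    and p: "p = Seq c (Loop 1 (Inc 1))" and "exec c ((\<lambda>_. 0)(0 := x)) \<rho>" "\<rho> 1 \<noteq> 0"
  shows "\<not> terminating (system T N)"
    and "\<not> (\<exists>G \<sigma>. reachable (system T N) (G, \<sigma>) \<and> parikh G (scode (Ctl (Run []))) \<ge> 1)"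
proof -
  interpret chain_system "system T N" 0 by fact
  define I where "I = Inc 1"
  define L where "L = Loop 1 I"
  have p': "p = Seq c L" by (simp add: p L_def I_def)
  have conts: "[p] \<in> conts p []" "[L] \<in> conts p []" "[I, L] \<in> conts p []" "conts c [L] \<subseteq> conts p []"
      "regs_of c \<subseteq> {..<k}"
    using assms(3) by (auto simp: p' L_def I_def)
  have trans: "cont_trans [p] = jump_trans (Run [p]) (Run [c, L])"
      "cont_trans [L] = dec_trans (Run [L]) 1 (Run [I, L]) (Run [])"
      "cont_trans [I, L] = inc_trans (Run [I, L]) 1 (Run [L])"
    unfolding p' by (simp_all add: L_def I_def)
  obtain v where v: "neutral v" "(next_conf T N)\<^sup>*\<^sup>* born (state v (Run [p]) ((\<lambda>_. 0)(0 := x)) k)"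
    using steps_run assms(2) by force
  have 1: "steps (state v (Run [p]) ((\<lambda>_. 0)(0 := x)) k) (state v (Run [c, L]) ((\<lambda>_. 0)(0 := x)) k)"
    using v(1) by (intro state_jump) (auto simp: T_Run conts trans jump_trans_def)
  obtain w where w: "neutral w"
      "steps (state v (Run [c, L]) ((\<lambda>_. 0)(0 := x)) k) (state w (Run [L]) \<rho> k)"
    using steps_exec[OF assms(5) conts(4,5) v(1)] by blast
  obtain y where y: "\<rho> 1 = Suc y" using assms(6) by (cases "\<rho> 1") auto
  \<comment> \<open>The first pass may start with any neutral value but ends with
    \<open>Ack\<close>, so from the second pass on the values match too.\<close>
  have loop: "steps (state u (Run [L]) \<rho> k) (state Ack (Run [L]) \<rho> k)" if "neutral u" for u
  proof -
    have "steps (state u (Run [L]) \<rho> k) (state Ack (Run [I, L]) (\<rho>(1 := y)) k)"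
      by (rule state_dec[where r = 1 and e = "Run []"])
        (use that y assms(2) in \<open>auto simp: T_Run conts trans dec_trans_def\<close>)
    moreover have "steps (state Ack (Run [I, L]) (\<rho>(1 := y)) k)
        (state Ack (Run [L]) ((\<rho>(1 := y))(1 := Suc ((\<rho>(1 := y)) 1))) k)"
      by (rule state_inc[where r = 1]) (use assms(2) in \<open>auto simp: T_Run conts trans inc_trans_def\<close>)
    moreover have "(\<rho>(1 := y))(1 := Suc ((\<rho>(1 := y)) 1)) = \<rho>" using y by auto
    ultimately show ?thesis by (metis tranclp_trans)
  qed
  have "(next_conf T N)\<^sup>*\<^sup>* born (state Ack (Run [L]) \<rho> k)"
    using v(2) 1 w(2) loop[OF w(1)] by (meson rtranclp_trans tranclp_into_rtranclp)
  with avoids_born have path: "(avoids (system T N) (scode (Ctl (Run []))))\<^sup>*\<^sup>*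
      (initial_stacks (system T N)) (stacks_of (state Ack (Run [L]) \<rho> k))"
    by (meson converse_rtranclp_into_rtranclp rtranclp_avoids)
  note lasso = lasso[OF path tranclp_avoids[OF loop[OF neutral_simps(2)]]]
  show "\<not> terminating (system T N)" by (rule lasso(1))
  show "\<not> (\<exists>G \<sigma>. reachable (system T N) (G, \<sigma>) \<and> parikh G (scode (Ctl (Run []))) \<ge> 1)"
    using lasso(2) by fastforce
qed

end

section \<open>The code of the simulating system\<close>

definition tcode :: "trans \<Rightarrow> nat" where
  "tcode t = trans_code (trans_nat t)"

lemma tcode_inject: "tcode t = tcode t' \<longleftrightarrow> t = t'"
  using inj_eq[OF inj_trans_code] inj_eq[OF inj_trans_nat] by (simp add: tcode_def)

definition program_code :: "nat \<Rightarrow> com \<Rightarrow> nat" where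
  "program_code k p = set_encode (tcode ` program_trans k p)"

abbreviation halt_code :: nat where
  "halt_code \<equiv> scode (Ctl (Run []))"

text \<open>
  \<open>margin\<close> bounds the codes of all states in terms of the input alone: the states of a program are
  smaller than the code \<open>x\<close> of its transitions, and the others are those that load the input.
\<close>

definition margin :: "nat \<Rightarrow> nat" where
  "margin x = x + (\<Sum>i<Suc x. scode (Ctl (Pre i)) + scode (Wait (Pre i)))"

text \<open>The summand \<open>Suc halt_code\<close> puts the halting state among the states of
  every instance.\<close>

definition bound :: "nat \<Rightarrow> nat" where
  "bound x = Suc halt_code + margin x"

text \<open>The diagonal: the machine with program \<open>p\<close> loads the code of its own
  program transitions.\<close>

definition instance_of :: "nat \<Rightarrow> com \<Rightarrow> nat_eqdas" where
  "instance_of k p = system (machine.T k p (program_code k p)) (bound (program_code k p))"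

lemma less_set_encode:
  assumes "finite A" "n \<in> A" shows "n < set_encode A"
proof -
  have "n < 2 ^ n" by (rule less_exp)
  also have "2 ^ n \<le> set_encode A"
    using assms by (auto simp: set_encode_def intro: member_le_sum)
  finally show ?thesis .
qed

lemma op_val_le: "op_val a \<le> action_code (act a)"
proof (cases a)
  case (Is v)
  have "vcode v \<le> prod_encode (0, vcode v)" by (rule le_prod_encode_2)
  also have "\<dots> \<le> prod_encode (0, prod_encode (0, vcode v))" by (rule le_prod_encode_2)
  also have "\<dots> \<le> prod_encode (prod_encode (0, prod_encode (0, vcode v)), 0)" by (rule le_prod_encode_1)
  also have "\<dots> \<le> list_encode [prod_encode (0, prod_encode (0, vcode v))]" by simp
  also have "\<dots> \<le> prod_encode (2, list_encode [prod_encode (0, prod_encode (0, vcode v))])"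
    by (rule le_prod_encode_2)
  finally show ?thesis by (simp add: Is)
next
  case (Put v)
  have "vcode v \<le> prod_encode (0, vcode v)" by (rule le_prod_encode_2)
  also have "\<dots> \<le> prod_encode (3, prod_encode (0, vcode v))" by (rule le_prod_encode_2)
  finally show ?thesis by (simp add: Put)
qed auto

lemma tcode_bounds:
  "scode s \<le> tcode (s, a, t)" "op_val a \<le> tcode (s, a, t)" "scode t \<le> tcode (s, a, t)"
  using op_val_le[of a] le_prod_encode_1[of "scode s"] le_prod_encode_2[of _ "scode s"]
    le_prod_encode_1[of "action_code (act a)" "scode t"] le_prod_encode_2[of "scode t" "action_code (act a)"]
  by (auto simp: tcode_def trans_code_def trans_nat_def intro: order_trans)

lemma program_trans_bound:
  assumes "(s, a, t) \<in> program_trans k p"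
  shows "scode s < program_code k p" "op_val a < program_code k p" "scode t < program_code k p"
proof -
  have "tcode (s, a, t) < program_code k p"
    unfolding program_code_def using assms finite_program_trans by (intro less_set_encode) auto
  then show "scode s < program_code k p" "op_val a < program_code k p" "scode t < program_code k p"
    using tcode_bounds[where s = s and a = a and t = t] by linarith+
qed

lemma bound_ge: "program_code k p \<le> bound (program_code k p)"
  by (simp add: bound_def margin_def)

lemma Pre_bound:
  assumes "i \<le> x" shows "scode (Ctl (Pre i)) < bound x" "scode (Wait (Pre i)) < bound x"
proof -
  have "scode (Ctl (Pre i)) + scode (Wait (Pre i)) \<le> (\<Sum>i<Suc x. scode (Ctl (Pre i)) + scode (Wait (Pre i)))"
    using assms by (intro member_le_sum) auto
  then show "scode (Ctl (Pre i)) < bound x" "scode (Wait (Pre i)) < bound x"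
    by (auto simp: bound_def margin_def)
qed

lemma bounded_instance:
  assumes "0 < k"
  shows "bounded_by (bound (program_code k p)) (machine.T k p (program_code k p))"
    "scode Start < bound (program_code k p)" "scode Fin < bound (program_code k p)"
proof -
  let ?x = "program_code k p"
  have prog: "scode s < bound ?x \<and> op_val a < bound ?x \<and> scode t < bound ?x"
    if "(s, a, t) \<in> program_trans k p" for s a t
    using program_trans_bound[OF that] bound_ge by (meson less_le_trans)
  \<comment> \<open>Sample transitions of the program part. They bound the codes of
    \<open>Start\<close> and \<open>Fin\<close>, and of \<open>IncV 0\<close>, \<open>Ack\<close>
    and \<open>Entry\<close>, which also occur in the loading transitions.\<close>
  have F: "(Start, Is Idle, Ctl (Setup 0)) \<in> program_trans k p"
      "(Dec False 0, Put (RetV 0), Fin) \<in> program_trans k p"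
      "(Reg False 0, Is (IncV 0), Push False 0) \<in> program_trans k p"
      "(Born False 0, Put Ack, Reg False 0) \<in> program_trans k p"
      "(Ctl Entry, Nop, Ctl (Run [p])) \<in> program_trans k p"
    using assms by (force simp: program_trans_def reg_trans_def jump_trans_def)+
  show "scode Start < bound ?x" "scode Fin < bound ?x" using prog F by blast+
  have "scode s < bound ?x \<and> op_val a < bound ?x \<and> scode t < bound ?x"
    if "(s, a, t) \<in> input_trans ?x" for s a t
    using that Pre_bound prog[OF F(3)] prog[OF F(4)] prog[OF F(5)]
    by (auto simp: input_trans_def inc_trans_def jump_trans_def)
  with prog show "bounded_by (bound ?x) (machine.T k p ?x)"
    unfolding bounded_by_def machine.T_def by blast
qed

lemma finite_T: "finite (machine.T k p x)"
  by (simp add: machine.T_def finite_program_trans finite_input_trans)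

lemma chain_system_instance: "0 < k \<Longrightarrow> chain_system (instance_of k p) 0"
  unfolding instance_of_def by (intro chain_system_system finite_T bounded_instance)

lemma eqdas_instance: "0 < k \<Longrightarrow> eqdas (instance_of k p)"
  by (rule chain_system.eqdas[OF chain_system_instance])

definition input_code :: "nat \<Rightarrow> nat" where
  "input_code x = (\<Sum>i<x. 2 ^ tcode (Ctl (Pre i), Put (IncV 0), Wait (Pre i)) +
       2 ^ tcode (Wait (Pre i), Is Ack, Ctl (Pre (Suc i)))) + 2 ^ tcode (Ctl (Pre x), Nop, Ctl Entry)"

lemma set_encode_input: "set_encode (tcode ` input_trans x) = input_code x"
proof -
  let ?I = "\<lambda>m. \<Union>i<m. inc_trans (Pre i) 0 (Pre (Suc i))"
  have fin: "finite (?I m)" for m by (auto simp: inc_trans_def)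
  have sum: "set_encode (tcode ` ?I m) = (\<Sum>i<m. 2 ^ tcode (Ctl (Pre i), Put (IncV 0), Wait (Pre i)) +
       2 ^ tcode (Wait (Pre i), Is Ack, Ctl (Pre (Suc i))))" for m
  proof (induction m)
    case (Suc m)
    have "?I (Suc m) = insert (Ctl (Pre m), Put (IncV 0), Wait (Pre m))
        (insert (Wait (Pre m), Is Ack, Ctl (Pre (Suc m))) (?I m))"
      by (auto simp: inc_trans_def less_Suc_eq)
    moreover have "tcode (Ctl (Pre m), Put (IncV 0), Wait (Pre m)) \<notin>
        tcode ` insert (Wait (Pre m), Is Ack, Ctl (Pre (Suc m))) (?I m)"
      by (auto simp: tcode_inject inc_trans_def image_iff)
    moreover have "tcode (Wait (Pre m), Is Ack, Ctl (Pre (Suc m))) \<notin> tcode ` ?I m"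
      by (auto simp: tcode_inject inc_trans_def image_iff)
    ultimately show ?case using fin[of m] Suc.IH by (simp add: set_encode_insert)
  qed simp
  have "input_trans x = insert (Ctl (Pre x), Nop, Ctl Entry) (?I x)"
    by (auto simp: input_trans_def jump_trans_def)
  moreover have "tcode (Ctl (Pre x), Nop, Ctl Entry) \<notin> tcode ` ?I x"
    by (auto simp: tcode_inject inc_trans_def image_iff)
  ultimately show ?thesis using fin[of x] sum[of x] by (simp add: input_code_def set_encode_insert)
qed

text \<open>Loading transitions leave only the control points \<open>Pre i\<close>, from which no
  program transition starts. The two sets are disjoint, so their codes add up.\<close>

lemma set_encode_T: "set_encode (tcode ` machine.T k p x) = program_code k p + input_code x"
proof -
  have "program_trans k p \<inter> input_trans x = {}"
    by (auto simp: program_trans_def input_trans_def reg_trans_def new_trans_def jump_trans_def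
        inc_trans_def dest: cont_trans_source)
  then have "tcode ` program_trans k p \<inter> tcode ` input_trans x = {}"
    by (auto simp: tcode_inject)
  then show ?thesis
    unfolding machine.T_def image_Un program_code_def set_encode_input[symmetric] set_encode_def
    by (intro sum.union_disjoint) (auto intro: finite_program_trans finite_input_trans)
qed

text \<open>The worker has the \<open>halt_code - 3 + margin x\<close> states from 4 to below
  \<open>bound x\<close>. The difference is a constant, and a proper one because
  \<open>halt_code\<close> is at least 4, so no subtraction has to be computed.\<close>

definition instance_code :: "nat \<Rightarrow> nat" where
  "instance_code x = list_encode [\<Sum>i<bound x. 2 ^ i, 0, set_encode {0}, set_encode {0}, set_encode {0, 1}, 0,
     2 ^ prod_encode (0, lts_code main_lts) + 2 ^ prod_encode (1, list_encode
       [\<Sum>i<halt_code - 3 + margin x. 2 ^ (4 + i), scode Start, scode Fin, x + input_code x])]"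

lemma eqdas_code_instance: "eqdas_code (instance_of k p) = instance_code (program_code k p)"
proof -
  let ?x = "program_code k p"
  let ?T = "machine.T k p ?x"
  have N: "bound ?x = 4 + (halt_code - 3 + margin ?x)"
    using scode_ge[of "Ctl (Run [])"] by (simp add: bound_def)
  have "set_encode {4..<4 + m} = (\<Sum>i<m. 2 ^ (4 + i))" for m
    unfolding set_encode_def
    by (rule sum.reindex_bij_witness[of _ "\<lambda>i. i + 4" "\<lambda>i. i - 4"]) auto
  then have states: "set_encode {4..<bound ?x} = (\<Sum>i<halt_code - 3 + margin ?x. 2 ^ (4 + i))"
    unfolding N .
  have "trans_code ` trans_nat ` ?T = tcode ` ?T" by (auto simp: tcode_def image_iff)
  then have worker: "lts_code (worker_lts ?T (bound ?x)) = list_encode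
       [\<Sum>i<halt_code - 3 + margin ?x. 2 ^ (4 + i), scode Start, scode Fin, ?x + input_code ?x]"
    unfolding lts_code_def by (simp only: worker_lts_def lts.select_convs states set_encode_T)
  have "graph_code {0, 1} f = 2 ^ prod_encode (0, f 0) + 2 ^ prod_encode (1, f 1)" for f
    by (simp add: graph_code_def)
  moreover have "set_encode {..<bound ?x} = (\<Sum>i<bound ?x. 2 ^ i)" by (simp add: set_encode_def)
  ultimately show ?thesis
    unfolding eqdas_code_def instance_code_def worker[symmetric]
    by (simp add: instance_of_def system_def del: list_encode.simps)
qed

section \<open>Recursiveness of the codes\<close>

lemma recursive_tl_nth: "i < n \<Longrightarrow> recursive (Suc n) (\<lambda>xs. tl xs ! i)"
  by (intro recursive_tl recursive_nth)

lemmas recursive_rules = recursive_const recursive_hd recursive_tl_nth recursive_nth recursive_Suc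
  recursive_add recursive_pow2 recursive_prod_encode recursive_sum

lemmas code_simps = tcode_def trans_code_def trans_nat_def prod.case act.simps action_code.simps
  scode.simps ccode.simps list_encode.simps

text \<open>Once the codes are unfolded, the term is built from constants, the index, the input,
  sums and pairing, and the rules follow its syntax. Under a bounded sum the index heads the
  argument list, so the input is read as \<open>tl xs ! 0\<close>.\<close>

lemma recursive_margin: "recursive 1 (\<lambda>xs. margin (xs ! 0))"
  unfolding margin_def code_simps by (rule recursive_rules | simp)+

lemma recursive_bound: "recursive 1 (\<lambda>xs. bound (xs ! 0))"
  unfolding bound_def by (rule recursive_const recursive_margin recursive_add)+

lemma recursive_input_code: "recursive 1 (\<lambda>xs. input_code (xs ! 0))"
  unfolding input_code_def code_simps by (rule recursive_rules | simp)+

lemma recursive_instance_code: "recursive 1 (\<lambda>xs. instance_code (xs ! 0))"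
  unfolding instance_code_def list_encode.simps
  by (rule recursive_const recursive_bound recursive_margin recursive_input_code recursive_rules | simp)+

section \<open>Undecidability\<close>

definition halt_target :: "nat_eqdas \<Rightarrow> nat \<Rightarrow> nat" where
  "halt_target A = (\<lambda>s\<in>all_states A. if s = halt_code then 1 else 0)"

text \<open>Splitting the states below, at and above \<open>halt_code\<close> removes the case
  distinction from the graph of the target.\<close>

definition target_code :: "nat \<Rightarrow> nat" where
  "target_code x = (\<Sum>s<halt_code. 2 ^ prod_encode (s, 0)) + 2 ^ prod_encode (halt_code, 1) +
     (\<Sum>i<margin x. 2 ^ prod_encode (Suc halt_code + i, 0))"

lemma recursive_target_code: "recursive 1 (\<lambda>xs. target_code (xs ! 0))"
  unfolding target_code_def by (rule recursive_const recursive_margin recursive_rules | simp)+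

lemma all_states_instance: "all_states (instance_of k p) = {..<bound (program_code k p)}"
proof -
  have "4 \<le> bound (program_code k p)" using scode_ge[of "Ctl (Run [])"] by (simp add: bound_def)
  then show ?thesis
    by (auto simp: all_states_def instance_of_def system_def main_lts_def worker_lts_def)
qed

lemma graph_code_target:
  "graph_code (all_states (instance_of k p)) (halt_target (instance_of k p)) = target_code (program_code k p)"
proof -
  let ?x = "program_code k p" and ?f = "halt_target (instance_of k p)"
  have split: "sum g {..<n + m} = sum g {..<n} + (\<Sum>i<m. g (n + i))" for g :: "nat \<Rightarrow> nat" and n m
    by (induction m) auto
  have f: "?f s = (if s = halt_code then 1 else 0)" if "s < bound ?x" for s
    using that by (simp add: halt_target_def all_states_instance)
  have "graph_code (all_states (instance_of k p)) ?f = (\<Sum>s<bound ?x. 2 ^ prod_encode (s, ?f s))"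
    unfolding graph_code_def all_states_instance set_encode_def
    by (subst sum.reindex) (auto simp: inj_on_def)
  also have "\<dots> = (\<Sum>s<bound ?x. 2 ^ prod_encode (s, if s = halt_code then 1 else 0))"
    using f by (intro sum.cong) auto
  also have "\<dots> = target_code ?x"
    unfolding bound_def split target_code_def by simp
  finally show ?thesis .
qed

lemma parikh_coverable_target:
  "parikh_coverable (instance_of k p) (halt_target (instance_of k p)) \<longleftrightarrow>
     (\<exists>G \<sigma>. reachable (instance_of k p) (G, \<sigma>) \<and> parikh G halt_code \<ge> 1)"
proof -
  have "(\<forall>s\<in>all_states (instance_of k p). halt_target (instance_of k p) s \<le> parikh G s) \<longleftrightarrow>
      parikh G halt_code \<ge> 1" for G :: "(nat, nat, nat) ctgraph"
    by (auto simp: halt_target_def all_states_instance bound_def)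
  then show ?thesis by (simp add: parikh_coverable_def)
qed

text \<open>Common to both problems. There is no circularity: \<open>c\<close> is built from
  \<open>r\<close> and the recursive \<open>h\<close> alone, so \<open>p\<close> and
  \<open>k\<close> are fixed before the number \<open>program_code k p\<close> is formed and handed
  to \<open>p\<close> as its input.\<close>

lemma undecidable:
  assumes rec: "recursive 1 (\<lambda>xs. h (xs ! 0))"
    and inst: "\<And>k p. 0 < k \<Longrightarrow> inst k p \<in> I \<and> code (inst k p) = h (program_code k p)"
    and halts: "\<And>k p \<rho>. 0 < k \<Longrightarrow> regs_of p \<subseteq> {..<k}
      \<Longrightarrow> exec p ((\<lambda>_. 0)(0 := program_code k p)) \<rho> \<Longrightarrow> P (inst k p)"
    and loops: "\<And>k p c \<rho>. 1 < k \<Longrightarrow> regs_of p \<subseteq> {..<k} \<Longrightarrow> p = Seq c (Loop 1 (Inc 1))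
      \<Longrightarrow> exec c ((\<lambda>_. 0)(0 := program_code k p)) \<rho> \<Longrightarrow> \<rho> 1 \<noteq> 0 \<Longrightarrow> \<not> P (inst k p)"
  shows "\<not> decidable_problem code I P"
proof
  assume "decidable_problem code I P"
  then obtain r where r: "\<And>i. i \<in> I \<Longrightarrow> rec_eval r [code i] (if P i then 1 else 0)"
    unfolding decidable_problem_def by blast
  obtain rh where rh: "\<And>xs. length xs = 1 \<Longrightarrow> rec_eval rh xs (h (xs ! 0))"
    using rec unfolding recursive_def by blast
  \<comment> \<open>Register 0 receives the input, register 1 the answer, and scratch space starts
    at 2.\<close>
  obtain c where c: "implements c (Comp r [rh]) [0] 1 2"
    using ex_implements[of "[0]" 2 1] by auto
  define p where "p = Seq c (Loop 1 (Inc 1))"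
  \<comment> \<open>\<open>k\<close> bounds all registers of \<open>p\<close>; it exceeds 1 because
    the final loop uses register 1.\<close>
  obtain k where k: "regs_of p \<subseteq> {..<k}"
    using finite_regs_of finite_nat_set_iff_bounded by (metis lessThan_iff subsetI)
  then have "1 < k" by (auto simp: p_def)
  let ?x = "program_code k p" and ?b = "if P (inst k p) then 1 else 0 :: nat"
  have "inst k p \<in> I" "code (inst k p) = h ?x" using inst \<open>1 < k\<close> by auto
  then have "rec_eval r [h ?x] ?b" using r by metis
  moreover have "rec_eval rh [?x] (h ?x)" using rh[of "[?x]"] by simp
  ultimately have "rec_eval (Comp r [rh]) [?x] ?b"
    by (intro rec_eval.Comp[where ys = "[h ?x]"]) auto
  then have run: "exec c ((\<lambda>_. 0)(0 := ?x)) ((\<lambda>_. 0)(0 := ?x, 1 := ?b))"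
    by (intro implementsD[OF c]) auto
  show False
  proof (cases "P (inst k p)")
    case True
    then show False using loops[OF \<open>1 < k\<close> k p_def run] by simp
  next
    case False
    have "exec (Loop 1 (Inc 1)) ((\<lambda>_. 0)(0 := ?x, 1 := ?b)) ((\<lambda>_. 0)(0 := ?x, 1 := ?b))"
      using False by (intro exec.Loop_zero) simp
    with run have "exec p ((\<lambda>_. 0)(0 := ?x)) ((\<lambda>_. 0)(0 := ?x, 1 := ?b))"
      unfolding p_def by (rule exec.Seq)
    then show False using halts[OF _ k] \<open>1 < k\<close> False by simp
  qed
qed

theorem theorem7:
  shows "\<not> decidable_problem coverability_code coverability_instances
           (\<lambda>(A, f). parikh_coverable A f) \<and>
         \<not> decidable_problem eqdas_code {A. eqdas A} terminating"
proof
  note machine_halts = machine.halts[OF chain_system_instance[unfolded instance_of_def], folded instance_of_def]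
  note machine_loops = machine.loops[OF chain_system_instance[unfolded instance_of_def], folded instance_of_def]
  show "\<not> decidable_problem eqdas_code {A. eqdas A} terminating"
  proof (rule undecidable[OF recursive_instance_code, where inst = instance_of])
    show "instance_of k p \<in> {A. eqdas A} \<and> eqdas_code (instance_of k p) = instance_code (program_code k p)"
      if "0 < k" for k p
      using that by (simp add: eqdas_instance eqdas_code_instance)
  qed (use machine_halts(1) machine_loops(1) in auto)
  show "\<not> decidable_problem coverability_code coverability_instances (\<lambda>(A, f). parikh_coverable A f)"
  proof (rule undecidable[where h = "\<lambda>x. prod_encode (instance_code x, target_code x)"
        and inst = "\<lambda>k p. (instance_of k p, halt_target (instance_of k p))"])
    show "recursive 1 (\<lambda>xs. prod_encode (instance_code (xs ! 0), target_code (xs ! 0)))"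
      by (intro recursive_prod_encode recursive_instance_code recursive_target_code)
    show "(instance_of k p, halt_target (instance_of k p)) \<in> coverability_instances \<and>
        coverability_code (instance_of k p, halt_target (instance_of k p)) =
        prod_encode (instance_code (program_code k p), target_code (program_code k p))"
      if "0 < k" for k p
      using that
      by (simp add: coverability_instances_def coverability_code_def eqdas_instance
          eqdas_code_instance graph_code_target) (simp add: halt_target_def)
  qed (use machine_halts(2) machine_loops(2) in \<open>auto simp: parikh_coverable_target\<close>)
qed

end
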